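(* Let $p\ge1$ and $k\ge1$ be integers and let $s>3/2$. Let $\alpha$ be a kernel (an even function in $L^1(\mathbb{R})$, or more generally an even finite Borel measure on $\mathbb{R}$) with $x^{2k}\alpha(x)\in L^1(\mathbb{R})$, whose zeroth-order moment is $\int\alpha(x)\,dx=1$ and whose moments $\int x^j\alpha(x)\,dx$ vanish for $1\le j\le 2k-1$. Let $u_0\in H^{s+2k+1}$ with $\Vert u_0\Vert_{H^{s+2k+1}}$ sufficiently small (the smallness threshold being independent of $\delta$). For $\delta>0$ let $u^\delta$ and $u$ satisfy, respectively, $$u^\delta_t+\alpha_\delta\ast\big(u^\delta+(u^\delta)^{p+1}\big)_x=0,\qquad u_t+u_x+(u^{p+1})_x=0,$$ with the same initial data $u^\delta(x,0)=u(x,0)=u_0(x)$. Then there are constants $C>0$ and $T>0$, independent of $\delta$, such that $$\Vert u^{\delta}(t)-u(t)\Vert_{H^{s}}\le C\,\delta^{2k}\,t\qquad\text{for all } t\le T .$$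
   Context: $H^s=H^s(\mathbb{R})$ is the $L^2$-based Sobolev space with norm $\Vert u\Vert_{H^s}=\big(\int(1+\xi^2)^s|\widehat u(\xi)|^2d\xi\big)^{1/2}$, where $\widehat u(\xi)=\int u(x)e^{-i\xi x}dx$. Functions $u=u(x,t)$, $x\in\mathbb{R}$, are real-valued and $\ast$ denotes convolution in the $x$-variable. For $\delta>0$, $\alpha_\delta(x)=\frac1\delta\alpha(\frac{x}{\delta})$ (for measures, the push-forward of $\alpha$ under $x\mapsto\delta x$). If the kernel is a measure, moments are $\int x^j\,d\alpha$, and $x^{2k}\alpha\in L^1$ means $\int |x|^{2k}\,d|\alpha|<\infty$. Solutions are understood as the unique solutions in the class $C([0,T],H^{s+2k+1})\cap C^1([0,T],H^{s+2k})$; they exist on a common time interval $[0,T]$ independent of $\delta$. *)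

theory Defs
  imports "HOL-Probability.Probability"
begin

subsection \<open>The Fourier transform on $L^2$ and the Sobolev spaces $H^s$\<close>

definition L2_fun :: "(real \<Rightarrow> real) \<Rightarrow> bool" where
  "L2_fun u \<longleftrightarrow> u \<in> borel_measurable lborel \<and> integrable lborel (\<lambda>x. (u x)\<^sup>2)"

definition truncated_fourier :: "nat \<Rightarrow> (real \<Rightarrow> real) \<Rightarrow> real \<Rightarrow> complex" where
  "truncated_fourier n u \<xi> =
     (LINT x:{- real n..real n}|lborel. complex_of_real (u x) * exp (- \<i> * complex_of_real (x * \<xi>)))"

text \<open>Since an $L^2$ function need not be integrable, the transform
  $\int u(x) e^{-i\xi x}\,dx$ is taken in the sense of Plancherel: as the $L^2$ limit of the
  integrals over $[-n,n]$.\<close>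

definition is_fourier :: "(real \<Rightarrow> real) \<Rightarrow> (real \<Rightarrow> complex) \<Rightarrow> bool" where
  "is_fourier u g \<longleftrightarrow>
     g \<in> borel_measurable lborel \<and> integrable lborel (\<lambda>\<xi>. (cmod (g \<xi>))\<^sup>2) \<and>
     (\<lambda>n. \<integral>\<^sup>+ \<xi>. ennreal ((cmod (g \<xi> - truncated_fourier n u \<xi>))\<^sup>2) \<partial>lborel) \<longlonglongrightarrow> 0"

text \<open>For square integrable \<open>u\<close> such a \<open>g\<close> exists and is unique up to a null set, so the choice
  does not affect the integrals below.\<close>

definition fourier :: "(real \<Rightarrow> real) \<Rightarrow> real \<Rightarrow> complex" where
  "fourier u = (SOME g. is_fourier u g)"

text \<open>$H^s$ is realised inside $L^2$, so the next two definitions are meant for \<open>s \<ge> 0\<close> only.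
  As usual, functions stand for their almost-everywhere classes.\<close>

definition in_H :: "real \<Rightarrow> (real \<Rightarrow> real) \<Rightarrow> bool" where
  "in_H s u \<longleftrightarrow>
     L2_fun u \<and> integrable lborel (\<lambda>\<xi>. (1 + \<xi>\<^sup>2) powr s * (cmod (fourier u \<xi>))\<^sup>2)"

definition H_norm :: "real \<Rightarrow> (real \<Rightarrow> real) \<Rightarrow> real" where
  "H_norm s u = sqrt (LINT \<xi>|lborel. (1 + \<xi>\<^sup>2) powr s * (cmod (fourier u \<xi>))\<^sup>2)"

subsection \<open>Kernels\<close>

text \<open>A finite signed Borel measure $\alpha$ on the line is given by its Jordan decomposition
  $\alpha = \alpha^+ - \alpha^-$, encoded as the pair $(\alpha^+, \alpha^-)$. By mutual singularity
  the total variation is $|\alpha| = \alpha^+ + \alpha^-$.\<close>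

type_synonym kernel = "real measure \<times> real measure"

definition signed_borel :: "kernel \<Rightarrow> bool" where
  "signed_borel \<alpha> \<longleftrightarrow>
     finite_borel_measure (fst \<alpha>) \<and> finite_borel_measure (snd \<alpha>) \<and>
     (\<exists>A\<in>sets borel. emeasure (fst \<alpha>) (- A) = 0 \<and> emeasure (snd \<alpha>) A = 0)"

definition kmeasure :: "kernel \<Rightarrow> real set \<Rightarrow> real" where
  "kmeasure \<alpha> A = measure (fst \<alpha>) A - measure (snd \<alpha>) A"

definition even_kernel :: "kernel \<Rightarrow> bool" where
  "even_kernel \<alpha> \<longleftrightarrow> (\<forall>A\<in>sets borel. kmeasure \<alpha> (uminus ` A) = kmeasure \<alpha> A)"

definition kintegrable :: "kernel \<Rightarrow> (real \<Rightarrow> real) \<Rightarrow> bool" where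
  "kintegrable \<alpha> f \<longleftrightarrow> integrable (fst \<alpha>) f \<and> integrable (snd \<alpha>) f"

definition kint :: "kernel \<Rightarrow> (real \<Rightarrow> real) \<Rightarrow> real" where
  "kint \<alpha> f = (LINT x|fst \<alpha>. f x) - (LINT x|snd \<alpha>. f x)"

definition kscale :: "real \<Rightarrow> kernel \<Rightarrow> kernel" where
  "kscale \<delta> \<alpha> =
     (distr (fst \<alpha>) borel (\<lambda>x. \<delta> * x), distr (snd \<alpha>) borel (\<lambda>x. \<delta> * x))"

definition kconv :: "kernel \<Rightarrow> (real \<Rightarrow> real) \<Rightarrow> real \<Rightarrow> real" where
  "kconv \<alpha> f x = kint \<alpha> (\<lambda>y. f (x - y))"

text \<open>An integrable function \<open>a\<close> as the kernel $a(x)\,dx$.\<close>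

definition kernel_of_fun :: "(real \<Rightarrow> real) \<Rightarrow> kernel" where
  "kernel_of_fun a =
     (density lborel (\<lambda>x. ennreal (a x)), density lborel (\<lambda>x. ennreal (- a x)))"

lemma signed_borel_kernel_of_fun:
  assumes a: "integrable lborel a"
  shows "signed_borel (kernel_of_fun a)"
proof -
  have fin: "finite_borel_measure (density lborel (\<lambda>x. ennreal (b x)))"
    if b: "integrable lborel b" for b :: "real \<Rightarrow> real"
  proof -
    have [measurable]: "b \<in> borel_measurable lborel" using b by auto
    have "(\<integral>\<^sup>+x. ennreal (b x) \<partial>lborel) \<le> (\<integral>\<^sup>+x. ennreal (norm (b x)) \<partial>lborel)"
      by (intro nn_integral_mono) (auto intro!: ennreal_leI)
    also have "\<dots> < \<infinity>" using b by (simp add: integrable_iff_bounded)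
    finally have "(\<integral>\<^sup>+x. ennreal (b x) \<partial>lborel) \<noteq> \<infinity>" by simp
    moreover have "emeasure (density lborel (\<lambda>x. ennreal (b x))) (space lborel)
        = (\<integral>\<^sup>+x. ennreal (b x) \<partial>lborel)"
      by (subst emeasure_density) simp_all
    ultimately have "finite_measure (density lborel (\<lambda>x. ennreal (b x)))"
      by (intro finite_measureI) (simp only: space_density, simp)
    then show ?thesis
      by (rule finite_borel_measure.intro) (rule finite_borel_measure_axioms.intro, simp)
  qed
  have [measurable]: "a \<in> borel_measurable borel" using a by auto
  define A where "A = {x. 0 < a x}"
  have A [measurable]: "A \<in> sets borel" unfolding A_def by measurable
  have 1: "emeasure (density lborel (\<lambda>x. ennreal (a x))) (- A) = 0"
    by (subst emeasure_density)
       (auto simp: A_def nn_integral_0_iff_AE indicator_def ennreal_neg not_less)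
  have 2: "emeasure (density lborel (\<lambda>x. ennreal (- a x))) A = 0"
    by (subst emeasure_density)
       (auto simp: A_def nn_integral_0_iff_AE indicator_def ennreal_neg not_less)
  have "integrable lborel (\<lambda>x. - a x)" using a by simp
  with fin[OF a] fin[of "\<lambda>x. - a x"] A 1 2 show ?thesis
    unfolding signed_borel_def kernel_of_fun_def fst_conv snd_conv by blast
qed

lemma kint_kernel_of_fun:
  assumes [measurable]: "a \<in> borel_measurable borel" "f \<in> borel_measurable borel"
    and af: "integrable lborel (\<lambda>x. a x * f x)"
  shows "kintegrable (kernel_of_fun a) f"
    and "kint (kernel_of_fun a) f = (LINT x|lborel. a x * f x)"
proof -
  have le: "\<bar>max 0 c * y\<bar> \<le> \<bar>c * y\<bar>" "\<bar>max 0 (- c) * y\<bar> \<le> \<bar>c * y\<bar>" for c y :: real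
    by (auto simp: abs_mult intro!: mult_right_mono)
  have i1: "integrable lborel (\<lambda>x. max 0 (a x) * f x)"
  proof (rule Bochner_Integration.integrable_bound[OF af])
    show "AE x in lborel. norm (max 0 (a x) * f x) \<le> norm (a x * f x)"
      unfolding real_norm_def by (intro AE_I2 le)
  qed measurable
  have i2: "integrable lborel (\<lambda>x. max 0 (- a x) * f x)"
  proof (rule Bochner_Integration.integrable_bound[OF af])
    show "AE x in lborel. norm (max 0 (- a x) * f x) \<le> norm (a x * f x)"
      unfolding real_norm_def by (intro AE_I2 le)
  qed measurable
  have d: "ennreal r = ennreal (max 0 r)" for r :: real
    by (simp add: max_def ennreal_neg)
  have e1: "density lborel (\<lambda>x. ennreal (a x)) = density lborel (\<lambda>x. ennreal (max 0 (a x)))"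
    by (rule arg_cong[where f = "density lborel"]) (rule ext, rule d)
  have e2: "density lborel (\<lambda>x. ennreal (- a x)) = density lborel (\<lambda>x. ennreal (max 0 (- a x)))"
    by (rule arg_cong[where f = "density lborel"]) (rule ext, rule d)
  show "kintegrable (kernel_of_fun a) f"
    unfolding kintegrable_def kernel_of_fun_def fst_conv snd_conv e1 e2
    by (intro conjI; subst integrable_real_density) (use i1 i2 in \<open>simp_all\<close>)
  have "kint (kernel_of_fun a) f
      = (LINT x|lborel. max 0 (a x) * f x) - (LINT x|lborel. max 0 (- a x) * f x)"
    unfolding kint_def kernel_of_fun_def fst_conv snd_conv e1 e2
    by (subst (1 2) integral_real_density) simp_all
  also have "\<dots> = (LINT x|lborel. max 0 (a x) * f x - max 0 (- a x) * f x)"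
    by (rule Bochner_Integration.integral_diff[symmetric, OF i1 i2])
  also have "\<dots> = (LINT x|lborel. a x * f x)"
    by (rule Bochner_Integration.integral_cong) (auto simp: max_def algebra_simps)
  finally show "kint (kernel_of_fun a) f = (LINT x|lborel. a x * f x)" .
qed

definition admissible_kernel :: "nat \<Rightarrow> kernel \<Rightarrow> bool" where
  "admissible_kernel k \<alpha> \<longleftrightarrow>
     signed_borel \<alpha> \<and> even_kernel \<alpha> \<and>
     kintegrable \<alpha> (\<lambda>x. \<bar>x\<bar> ^ (2 * k)) \<and>
     kint \<alpha> (\<lambda>x. 1) = 1 \<and>
     (\<forall>j. 1 \<le> j \<and> j \<le> 2 * k - 1 \<longrightarrow> kint \<alpha> (\<lambda>x. x ^ j) = 0)"

subsection \<open>Solutions\<close>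

text \<open>Functions of $(t,x)$ are curried with time first. The derivative with respect to time is the
  norm limit of difference quotients in $H^r$, one-sided at the endpoints of $[0,T]$.\<close>

definition C0_H :: "real \<Rightarrow> real \<Rightarrow> (real \<Rightarrow> real \<Rightarrow> real) \<Rightarrow> bool" where
  "C0_H T r u \<longleftrightarrow>
     (\<forall>t\<in>{0..T}. in_H r (u t) \<and>
        ((\<lambda>\<tau>. H_norm r (\<lambda>x. u \<tau> x - u t x)) \<longlongrightarrow> 0) (at t within {0..T}))"

definition has_time_derivative_H ::
  "real \<Rightarrow> real \<Rightarrow> (real \<Rightarrow> real \<Rightarrow> real) \<Rightarrow> (real \<Rightarrow> real \<Rightarrow> real) \<Rightarrow> bool" where
  "has_time_derivative_H T r u ut \<longleftrightarrow>
     (\<forall>t\<in>{0..T}.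
        ((\<lambda>\<tau>. H_norm r (\<lambda>x. (u \<tau> x - u t x) / (\<tau> - t) - ut t x)) \<longlongrightarrow> 0)
          (at t within {0..T}))"

text \<open>\<open>u\<close> lies in $C([0,T],H^{r+1}) \cap C^1([0,T],H^r)$, with time derivative \<open>ut\<close>.\<close>

definition solution_class ::
  "real \<Rightarrow> real \<Rightarrow> (real \<Rightarrow> real \<Rightarrow> real) \<Rightarrow> (real \<Rightarrow> real \<Rightarrow> real) \<Rightarrow> bool" where
  "solution_class T r u ut \<longleftrightarrow>
     C0_H T (r + 1) u \<and> C0_H T r u \<and> C0_H T r ut \<and> has_time_derivative_H T r u ut"

text \<open>In the following, \<open>r > 1/2\<close>, so every class in $H^{r+1}$ has exactly one continuously
  differentiable representative. At each time a solution is represented by it, and spatial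
  derivatives are classical; the equation is an identity in $H^r$, i.e. it holds for almost
  every \<open>x\<close>.\<close>

definition nonlocal_solution ::
  "kernel \<Rightarrow> nat \<Rightarrow> real \<Rightarrow> real \<Rightarrow> (real \<Rightarrow> real) \<Rightarrow> (real \<Rightarrow> real \<Rightarrow> real) \<Rightarrow> bool" where
  "nonlocal_solution \<alpha> p r T u0 v \<longleftrightarrow>
     (AE x in lborel. v 0 x = u0 x) \<and>
     (\<exists>vt. solution_class T r v vt \<and>
        (\<forall>t\<in>{0..T}. \<exists>g.
           (\<forall>x. ((\<lambda>y. v t y + v t y ^ (p + 1)) has_real_derivative g x) (at x)) \<and>
           (AE x in lborel. vt t x + kconv \<alpha> g x = 0)))"

definition local_solution ::
  "nat \<Rightarrow> real \<Rightarrow> real \<Rightarrow> (real \<Rightarrow> real) \<Rightarrow> (real \<Rightarrow> real \<Rightarrow> real) \<Rightarrow> bool" where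
  "local_solution p r T u0 u \<longleftrightarrow>
     (AE x in lborel. u 0 x = u0 x) \<and>
     (\<exists>ut. solution_class T r u ut \<and>
        (\<forall>t\<in>{0..T}. \<exists>ux fx.
           (\<forall>x. (u t has_real_derivative ux x) (at x)) \<and>
           (\<forall>x. ((\<lambda>y. u t y ^ (p + 1)) has_real_derivative fx x) (at x)) \<and>
           (AE x in lborel. ut t x + ux x + fx x = 0)))"

end

theory Submission
  imports Defs
begin

text \<open>Put $g(y) = y + y^{p+1}$ and $E = u^\delta - u$. With the convolution operator
  $A = \alpha_\delta\ast$, a Fourier multiplier with a real, bounded symbol \<open>m\<close>, the error satisfies
  $E_t = -A\,\partial_x(g(u^\delta) - g(u)) - (A - 1)\,\partial_x g(u)$, and the vanishing moments give
  $|m(\xi) - 1| \le C (\delta|\xi|)^{2k}$, so the last term is $O(\delta^{2k})$ in $H^s$. Since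
  $\partial_x(g(u^\delta) - g(u)) = q E_x + \dots$ with $q = g'(u^\delta)$, the energy
  $\int q\,(\Lambda^s E)^2$ has a time derivative without loss of regularity: up to commutators
  $[\Lambda^s, q]$ the leading part is $\langle q\Lambda^s E, A\,\partial_x(q\Lambda^s E)\rangle = 0$.
  High norms are needed for the reference solution \<open>u\<close> only, and the smallness of $u_0$ keeps
  \<open>q\<close> near 1; a continuation argument makes the estimate uniform in $\delta$.
  All computations take place on the Fourier side, where \<open>q\<close> acts by convolution.\<close>

subsection \<open>Square integrable functions\<close>

text \<open>Why the weight \<open>q\<close>: in the plain \<open>H^s\<close> energy the leading part
  is the pairing of \<Lambda>^s E with A(q \<partial>_x \<Lambda>^s E). Antisymmetry would need the
  commutator of A with q, applied to a derivative, and for a kernel that is merely a measure nothing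
  controls this uniformly in \<delta>. Pairing with q \<Lambda>^s E is antisymmetric without moving
  A past q. The price is a term with q_t. The equation bounds v_t in \<open>H^(s-1)\<close> by norms
  of v of order s, and s - 1 > 1/2 makes the transform of q_t integrable. The commutator of
  \<Lambda>^s with q needs the same margin; this is the origin of s > 3/2. The energy is not
  differentiated in time. Its increments are bounded to first order from above, and a continuity
  argument integrates this bound. Gronwall's lemma is replaced by absorption: on a short interval
  the terms quadratic in E are absorbed at the time of the largest error, and dividing by that
  maximum leaves a bound linear in both \<delta>^(2k) and t. Only two facts about the multiplier are
  used, |m| \<le> A and |m - 1| \<le> d |\<xi>|^(2k), and the existence time and constants are fixed
  before m and d.\<close>

lemma borel_measurable_cnj [measurable]:
  "f \<in> borel_measurable M \<Longrightarrow> (\<lambda>x. cnj (f x)) \<in> borel_measurable M"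
  by (rule borel_measurable_continuous_on[where f = cnj]) (auto intro: continuous_intros)

definition sq_int :: "(real \<Rightarrow> complex) \<Rightarrow> bool" where
  "sq_int F \<longleftrightarrow> F \<in> borel_measurable borel \<and> integrable lborel (\<lambda>x. (cmod (F x))\<^sup>2)"

definition l2 :: "(real \<Rightarrow> complex) \<Rightarrow> real" where
  "l2 F = sqrt (LINT x|lborel. (cmod (F x))\<^sup>2)"

definition l1 :: "(real \<Rightarrow> complex) \<Rightarrow> real" where
  "l1 F = (LINT x|lborel. cmod (F x))"

lemma sq_int_measurable [measurable_dest]: "sq_int F \<Longrightarrow> F \<in> borel_measurable borel"
  by (simp add: sq_int_def)

lemma l2_nonneg [simp]: "0 \<le> l2 F" and l1_nonneg [simp]: "0 \<le> l1 F"
  by (auto simp: l2_def l1_def)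

lemma l2_power2: "(l2 F)\<^sup>2 = (LINT x|lborel. (cmod (F x))\<^sup>2)"
  by (simp add: l2_def)

lemma sq_int_iff_nn:
  "sq_int F \<longleftrightarrow> F \<in> borel_measurable borel \<and> (\<integral>\<^sup>+x. (ennreal (cmod (F x)))\<^sup>2 \<partial>lborel) < \<infinity>"
proof -
  have "integrable lborel (\<lambda>x. (cmod (F x))\<^sup>2) \<longleftrightarrow> (\<integral>\<^sup>+x. (ennreal (cmod (F x)))\<^sup>2 \<partial>lborel) < \<infinity>"
    if [measurable]: "F \<in> borel_measurable borel"
    by (subst integrable_iff_bounded) (simp add: ennreal_power)
  then show ?thesis unfolding sq_int_def by blast
qed

lemma nn_l2: "sq_int F \<Longrightarrow> (\<integral>\<^sup>+x. (ennreal (cmod (F x)))\<^sup>2 \<partial>lborel) = ennreal ((l2 F)\<^sup>2)"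
  unfolding l2_power2 sq_int_def by (subst nn_integral_eq_integral[symmetric]) (auto simp: ennreal_power)

lemma nn_l1: "integrable lborel F \<Longrightarrow> (\<integral>\<^sup>+x. ennreal (cmod (F x)) \<partial>lborel) = ennreal (l1 F)"
  unfolding l1_def by (subst nn_integral_eq_integral) auto

lemma sq_intI_nn:
  assumes "F \<in> borel_measurable borel" "(\<integral>\<^sup>+x. (ennreal (cmod (F x)))\<^sup>2 \<partial>lborel) \<le> ennreal (B\<^sup>2)" "0 \<le> B"
  shows "sq_int F" "l2 F \<le> B"
proof -
  show 1: "sq_int F" using assms by (auto simp: sq_int_iff_nn intro: le_less_trans)
  have "(l2 F)\<^sup>2 \<le> B\<^sup>2" using assms(2) nn_l2[OF 1] by (simp add: ennreal_le_iff)
  then show "l2 F \<le> B" using assms(3) by (rule power2_le_imp_le)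
qed

lemma sq_int_bound:
  assumes "sq_int G" "F \<in> borel_measurable borel" "AE x in lborel. cmod (F x) \<le> c * cmod (G x)" "0 \<le> c"
  shows "sq_int F" "l2 F \<le> c * l2 G"
proof -
  have [measurable]: "F \<in> borel_measurable borel" "G \<in> borel_measurable borel"
    using assms by auto
  have "(\<integral>\<^sup>+x. (ennreal (cmod (F x)))\<^sup>2 \<partial>lborel) \<le> (\<integral>\<^sup>+x. ennreal (c\<^sup>2) * (ennreal (cmod (G x)))\<^sup>2 \<partial>lborel)"
    using assms(3) by (intro nn_integral_mono_AE) (auto simp: ennreal_power ennreal_mult[symmetric] power_mult_distrib[symmetric] intro!: ennreal_leI power_mono)
  also have "\<dots> = ennreal ((c * l2 G)\<^sup>2)"
    by (subst nn_integral_cmult) (auto simp: nn_l2[OF assms(1)] ennreal_mult[symmetric] power_mult_distrib)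
  finally have *: "(\<integral>\<^sup>+x. (ennreal (cmod (F x)))\<^sup>2 \<partial>lborel) \<le> ennreal ((c * l2 G)\<^sup>2)" .
  show "sq_int F" "l2 F \<le> c * l2 G"
    by (rule sq_intI_nn[OF assms(2) *]; use assms(4) in simp)+
qed

lemma sq_int_cong_AE:
  assumes "sq_int G" "F \<in> borel_measurable borel" "AE x in lborel. F x = G x"
  shows "sq_int F" "l2 F = l2 G"
proof -
  have 1: "AE x in lborel. cmod (F x) \<le> 1 * cmod (G x)" using assms(3) by auto
  show F: "sq_int F" using sq_int_bound(1)[OF assms(1,2) 1] by simp
  have 2: "AE x in lborel. cmod (G x) \<le> 1 * cmod (F x)" using assms(3) by auto
  have "G \<in> borel_measurable borel" using assms(1) by auto
  then show "l2 F = l2 G"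
    using sq_int_bound(2)[OF assms(1,2) 1] sq_int_bound(2)[OF F _ 2] by simp
qed

lemma l2_cong_AE:
  assumes "F \<in> borel_measurable borel" "G \<in> borel_measurable borel" "AE x in lborel. F x = G x"
  shows "l2 F = l2 G"
  unfolding l2_def using assms by (intro arg_cong[where f = sqrt] integral_cong_AE) auto

lemma sq_int_mult:
  assumes "sq_int F" "sq_int G" shows "integrable lborel (\<lambda>x. F x * G x)"
proof (rule Bochner_Integration.integrable_bound)
  show "integrable lborel (\<lambda>x. (cmod (F x))\<^sup>2 + (cmod (G x))\<^sup>2)"
    using assms by (auto simp: sq_int_def)
  have [measurable]: "F \<in> borel_measurable borel" "G \<in> borel_measurable borel" using assms by auto
  show "(\<lambda>x. F x * G x) \<in> borel_measurable lborel" by simp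
  have "a * b \<le> a\<^sup>2 + b\<^sup>2" if "0 \<le> a" "0 \<le> b" for a b :: real
    using sum_squares_bound[of a b] mult_nonneg_nonneg[OF that] by (simp only: mult.assoc)
  then show "AE x in lborel. norm (F x * G x) \<le> norm ((cmod (F x))\<^sup>2 + (cmod (G x))\<^sup>2)"
    by (auto simp: norm_mult)
qed

text \<open>Integrate \<open>2ab <= t a^2 + b^2 / t\<close> and choose \<open>t\<close>. The optimal
  \<open>t = l2 G / l2 F\<close> is available only if neither norm vanishes; otherwise
  \<open>t\<close> is taken so large or so small that the surviving term is at most half of the
  left-hand side \<open>2 * ?I\<close>, which contradicts \<open>?I > 0\<close>.\<close>

lemma Cauchy_Schwarz_l2:
  assumes F: "sq_int F" and G: "sq_int G"
  shows "(LINT x|lborel. cmod (F x) * cmod (G x)) \<le> l2 F * l2 G"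
proof -
  let ?I = "LINT x|lborel. cmod (F x) * cmod (G x)"
  have iF: "integrable lborel (\<lambda>x. (cmod (F x))\<^sup>2)" and iG: "integrable lborel (\<lambda>x. (cmod (G x))\<^sup>2)"
    using assms by (auto simp: sq_int_def)
  have iFG: "integrable lborel (\<lambda>x. cmod (F x) * cmod (G x))"
    using integrable_norm[OF sq_int_mult[OF assms]] by (simp add: norm_mult)
  have young: "2 * ?I \<le> t * (l2 F)\<^sup>2 + (l2 G)\<^sup>2 / t" if t: "t > 0" for t
  proof -
    have "2 * (a * b) \<le> t * a\<^sup>2 + b\<^sup>2 / t" for a b :: real
    proof -
      have "0 \<le> (t * a - b)\<^sup>2 / t" using t by simp
      also have "\<dots> = t * a\<^sup>2 + b\<^sup>2 / t - 2 * (a * b)"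
        using t by (simp add: power2_eq_square field_simps)
      finally show ?thesis by simp
    qed
    then have "(LINT x|lborel. 2 * (cmod (F x) * cmod (G x))) \<le> (LINT x|lborel. t * (cmod (F x))\<^sup>2 + (cmod (G x))\<^sup>2 / t)"
      using iF iG iFG by (intro integral_mono) auto
    then show ?thesis using iF iG by (simp add: l2_power2)
  qed
  have nn: "0 \<le> ?I" by simp
  show ?thesis
  proof (rule ccontr)
    assume "\<not> ?thesis"
    then have lt: "l2 F * l2 G < ?I" by simp
    show False
    proof (cases "l2 F = 0 \<or> l2 G = 0")
      case True
      then have "0 < ?I" using lt by auto
      then show False
      proof (cases "l2 F = 0")
        case True
        define t where "t = ((l2 G)\<^sup>2 + 1) / ?I"
        have "t > 0" using \<open>0 < ?I\<close> by (auto simp: t_def intro!: divide_pos_pos add_nonneg_pos)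
        have "(l2 G)\<^sup>2 / t = ?I * ((l2 G)\<^sup>2 / ((l2 G)\<^sup>2 + 1))"
          using \<open>0 < ?I\<close> by (simp add: t_def)
        also have "\<dots> \<le> ?I * 1" using \<open>0 < ?I\<close>
          by (intro mult_left_mono) (auto simp: divide_le_eq_1 add_nonneg_pos)
        finally show False using young[OF \<open>t > 0\<close>] True \<open>0 < ?I\<close> by simp
      next
        case False
        then have G0: "l2 G = 0" using \<open>l2 F = 0 \<or> l2 G = 0\<close> by simp
        define t where "t = ?I / ((l2 F)\<^sup>2 + 1)"
        have "t > 0" using \<open>0 < ?I\<close> by (auto simp: t_def intro!: divide_pos_pos add_nonneg_pos)
        have "t * (l2 F)\<^sup>2 = ?I * ((l2 F)\<^sup>2 / ((l2 F)\<^sup>2 + 1))"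
          by (simp add: t_def)
        also have "\<dots> \<le> ?I * 1" using \<open>0 < ?I\<close>
          by (intro mult_left_mono) (auto simp: divide_le_eq_1 add_nonneg_pos)
        finally show False using young[OF \<open>t > 0\<close>] G0 \<open>0 < ?I\<close> by simp
      qed
    next
      case False
      then have "l2 F > 0" "l2 G > 0" by (simp_all add: order_less_le)
      then have "l2 G / l2 F > 0" by simp
      from young[OF this] have "2 * ?I \<le> 2 * (l2 F * l2 G)"
        using \<open>l2 F > 0\<close> \<open>l2 G > 0\<close> by (simp add: power2_eq_square field_simps)
      then show False using lt by simp
    qed
  qed
qed

lemma Cauchy_Schwarz_norm:
  assumes "sq_int F" "sq_int G"
  shows "cmod (LINT x|lborel. F x * G x) \<le> l2 F * l2 G"
  using integral_norm_bound[of lborel "\<lambda>x. F x * G x"] Cauchy_Schwarz_l2[OF assms]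
  by (simp add: norm_mult)

lemma sq_int_add:
  assumes F: "sq_int F" and G: "sq_int G"
  shows "sq_int (\<lambda>x. F x + G x)" "l2 (\<lambda>x. F x + G x) \<le> l2 F + l2 G"
proof -
  have [measurable]: "F \<in> borel_measurable borel" "G \<in> borel_measurable borel" using assms by auto
  have iF: "integrable lborel (\<lambda>x. (cmod (F x))\<^sup>2)" and iG: "integrable lborel (\<lambda>x. (cmod (G x))\<^sup>2)"
    using assms by (auto simp: sq_int_def)
  have iFG: "integrable lborel (\<lambda>x. cmod (F x) * cmod (G x))"
    using integrable_norm[OF sq_int_mult[OF assms]] by (simp add: norm_mult)
  let ?R = "\<lambda>x. (cmod (F x))\<^sup>2 + 2 * (cmod (F x) * cmod (G x)) + (cmod (G x))\<^sup>2"
  have iR: "integrable lborel ?R" using iF iG iFG by auto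
  have le: "(cmod (F x + G x))\<^sup>2 \<le> ?R x" for x
  proof -
    have "(cmod (F x + G x))\<^sup>2 \<le> (cmod (F x) + cmod (G x))\<^sup>2"
      by (intro power_mono norm_triangle_ineq) auto
    then show ?thesis by (simp add: power2_sum algebra_simps)
  qed
  have i: "integrable lborel (\<lambda>x. (cmod (F x + G x))\<^sup>2)"
    by (rule Bochner_Integration.integrable_bound[OF iR]) (use le in \<open>auto simp: abs_of_nonneg intro: order_trans\<close>)
  then show "sq_int (\<lambda>x. F x + G x)" by (simp add: sq_int_def)
  have "(l2 (\<lambda>x. F x + G x))\<^sup>2 \<le> (LINT x|lborel. ?R x)"
    unfolding l2_power2 by (intro integral_mono i iR le)
  also have "\<dots> = (l2 F)\<^sup>2 + 2 * (LINT x|lborel. cmod (F x) * cmod (G x)) + (l2 G)\<^sup>2"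
    unfolding l2_power2 using iF iG iFG by simp
  also have "\<dots> \<le> (l2 F + l2 G)\<^sup>2"
    using Cauchy_Schwarz_l2[OF assms] by (simp add: power2_sum)
  finally show "l2 (\<lambda>x. F x + G x) \<le> l2 F + l2 G"
    by (rule power2_le_imp_le) simp
qed

lemma sq_int_scale:
  assumes "sq_int F" shows "sq_int (\<lambda>x. c * F x)" "l2 (\<lambda>x. c * F x) = cmod c * l2 F"
proof -
  show "sq_int (\<lambda>x. c * F x)" using assms by (auto simp: sq_int_def norm_mult power_mult_distrib)
  show "l2 (\<lambda>x. c * F x) = cmod c * l2 F"
    by (simp add: l2_def norm_mult power_mult_distrib real_sqrt_mult)
qed

lemma sq_int_diff:
  assumes F: "sq_int F" and G: "sq_int G"
  shows "sq_int (\<lambda>x. F x - G x)" "l2 (\<lambda>x. F x - G x) \<le> l2 F + l2 G"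
  using sq_int_add[OF F sq_int_scale(1)[OF G, of "-1"]] sq_int_scale(2)[OF G, of "-1"] by simp_all

lemma sq_int_cnj: "sq_int F \<Longrightarrow> sq_int (\<lambda>x. cnj (F x))" and l2_cnj: "l2 (\<lambda>x. cnj (F x)) = l2 F"
  by (auto simp: sq_int_def l2_def)

lemma sq_int_zero: "sq_int (\<lambda>x. 0)" "l2 (\<lambda>x. 0) = 0"
  by (auto simp: sq_int_def l2_def)

lemma sq_int_reflect:
  assumes "sq_int F" shows "sq_int (\<lambda>x. F (t - x))"
proof -
  have [measurable]: "F \<in> borel_measurable borel" using assms by auto
  have "integrable lborel (\<lambda>x. (cmod (F (t + (-1) * x)))\<^sup>2)"
    using assms by (subst lborel_integrable_real_affine_iff) (auto simp: sq_int_def)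
  then show ?thesis by (simp add: sq_int_def)
qed

subsection \<open>Young's inequality and convolution\<close>

lemma ennreal_two_mult_le: "2 * (a * b) \<le> a\<^sup>2 + (b::ennreal)\<^sup>2"
proof (cases "a = top \<or> b = top")
  case True then show ?thesis by (auto simp: power2_eq_square ennreal_top_mult ennreal_mult_top)
next
  case False
  then obtain x y where "0 \<le> x" "0 \<le> y" and ab: "a = ennreal x" "b = ennreal y"
    by (metis ennreal_cases)
  have "2 * (x * y) \<le> x\<^sup>2 + y\<^sup>2" using sum_squares_bound[of x y] by (simp add: mult.assoc)
  then have "ennreal (2 * (x * y)) \<le> ennreal (x\<^sup>2 + y\<^sup>2)" by (rule ennreal_leI)
  then show ?thesis using \<open>0 \<le> x\<close> \<open>0 \<le> y\<close>
    by (simp add: ab ennreal_mult ennreal_power[symmetric] ennreal_plus)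
qed

text \<open>Expanding the square as a double integral avoids all case distinctions at infinity.\<close>

lemma nn_integral_weighted_square_le:
  fixes f g :: "real \<Rightarrow> ennreal"
  assumes [measurable]: "f \<in> borel_measurable borel" "g \<in> borel_measurable borel"
  shows "(\<integral>\<^sup>+x. f x * g x \<partial>lborel)\<^sup>2 \<le> (\<integral>\<^sup>+x. (f x)\<^sup>2 * g x \<partial>lborel) * (\<integral>\<^sup>+x. g x \<partial>lborel)"
proof -
  let ?A = "\<integral>\<^sup>+x. (f x)\<^sup>2 * g x \<partial>lborel" and ?B = "\<integral>\<^sup>+x. g x \<partial>lborel"
  have "2 * (\<integral>\<^sup>+x. f x * g x \<partial>lborel)\<^sup>2 = (\<integral>\<^sup>+x. \<integral>\<^sup>+y. 2 * (f x * f y) * (g x * g y) \<partial>lborel \<partial>lborel)"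
  proof -
    have "2 * (f x * f y) * (g x * g y) = 2 * ((f x * g x) * (f y * g y))" for x y by (simp add: mult_ac)
    then show ?thesis
      by (simp add: nn_integral_cmult nn_integral_multc power2_eq_square)
  qed
  also have "\<dots> \<le> (\<integral>\<^sup>+x. \<integral>\<^sup>+y. ((f x)\<^sup>2 + (f y)\<^sup>2) * (g x * g y) \<partial>lborel \<partial>lborel)"
    by (intro nn_integral_mono mult_right_mono ennreal_two_mult_le) auto
  also have "\<dots> = (\<integral>\<^sup>+x. \<integral>\<^sup>+y. ((f x)\<^sup>2 * g x) * g y + g x * ((f y)\<^sup>2 * g y) \<partial>lborel \<partial>lborel)"
    by (simp add: distrib_left distrib_right mult_ac)
  also have "\<dots> = 2 * (?A * ?B)"
    by (simp add: nn_integral_add nn_integral_cmult nn_integral_multc mult.commute mult_2)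
  finally show ?thesis by (simp add: ennreal_mult_le_mult_iff)
qed

lemma nn_integral_reflect_shift:
  fixes f :: "real \<Rightarrow> ennreal"
  assumes [measurable]: "f \<in> borel_measurable borel"
  shows "(\<integral>\<^sup>+x. f (x - t) \<partial>lborel) = (\<integral>\<^sup>+x. f x \<partial>lborel)"
    and "(\<integral>\<^sup>+x. f (t - x) \<partial>lborel) = (\<integral>\<^sup>+x. f x \<partial>lborel)"
  using nn_integral_real_affine[OF assms, of 1 "-t"] nn_integral_real_affine[OF assms, of "-1" t]
  by simp_all

text \<open>Cauchy-Schwarz with \<open>g\<close> as a weight splits off one factor of the mass of
  \<open>g\<close>; integrating the remaining convolution in \<xi> by Tonelli and translation
  invariance produces the second factor.\<close>

lemma Young_nn:
  fixes f g :: "real \<Rightarrow> ennreal"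
  assumes [measurable]: "f \<in> borel_measurable borel" "g \<in> borel_measurable borel"
  shows "(\<integral>\<^sup>+\<xi>. (\<integral>\<^sup>+\<eta>. f (\<xi> - \<eta>) * g \<eta> \<partial>lborel)\<^sup>2 \<partial>lborel) \<le> (\<integral>\<^sup>+x. g x \<partial>lborel)\<^sup>2 * (\<integral>\<^sup>+x. (f x)\<^sup>2 \<partial>lborel)"
proof -
  let ?B = "\<integral>\<^sup>+x. g x \<partial>lborel"
  have "(\<integral>\<^sup>+\<xi>. (\<integral>\<^sup>+\<eta>. f (\<xi> - \<eta>) * g \<eta> \<partial>lborel)\<^sup>2 \<partial>lborel)
      \<le> (\<integral>\<^sup>+\<xi>. (\<integral>\<^sup>+\<eta>. (f (\<xi> - \<eta>))\<^sup>2 * g \<eta> \<partial>lborel) * ?B \<partial>lborel)"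
    by (intro nn_integral_mono nn_integral_weighted_square_le) simp_all
  also have "\<dots> = (\<integral>\<^sup>+\<xi>. \<integral>\<^sup>+\<eta>. (f (\<xi> - \<eta>))\<^sup>2 * g \<eta> \<partial>lborel \<partial>lborel) * ?B"
    by (rule nn_integral_multc) simp
  also have "(\<integral>\<^sup>+\<xi>. \<integral>\<^sup>+\<eta>. (f (\<xi> - \<eta>))\<^sup>2 * g \<eta> \<partial>lborel \<partial>lborel)
      = (\<integral>\<^sup>+\<eta>. \<integral>\<^sup>+\<xi>. (f (\<xi> - \<eta>))\<^sup>2 * g \<eta> \<partial>lborel \<partial>lborel)"
    by (rule lborel_pair.Fubini'[symmetric]) simp
  also have "\<dots> = (\<integral>\<^sup>+\<eta>. (\<integral>\<^sup>+x. (f x)\<^sup>2 \<partial>lborel) * g \<eta> \<partial>lborel)"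
    by (simp add: nn_integral_multc nn_integral_reflect_shift(1)[of "\<lambda>x. (f x)\<^sup>2"])
  also have "\<dots> = (\<integral>\<^sup>+x. (f x)\<^sup>2 \<partial>lborel) * ?B"
    by (rule nn_integral_cmult) simp
  finally show ?thesis by (simp add: power2_eq_square mult_ac)
qed

lemma Young_nn':
  fixes f g :: "real \<Rightarrow> ennreal"
  assumes [measurable]: "f \<in> borel_measurable borel" "g \<in> borel_measurable borel"
  shows "(\<integral>\<^sup>+\<xi>. (\<integral>\<^sup>+\<eta>. f (\<xi> - \<eta>) * g \<eta> \<partial>lborel)\<^sup>2 \<partial>lborel) \<le> (\<integral>\<^sup>+x. f x \<partial>lborel)\<^sup>2 * (\<integral>\<^sup>+x. (g x)\<^sup>2 \<partial>lborel)"
proof -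
  have "(\<integral>\<^sup>+\<eta>. f (\<xi> - \<eta>) * g \<eta> \<partial>lborel) = (\<integral>\<^sup>+\<eta>. g (\<xi> - \<eta>) * f \<eta> \<partial>lborel)" for \<xi>
    using nn_integral_reflect_shift(2)[of "\<lambda>\<eta>. f (\<xi> - \<eta>) * g \<eta>" \<xi>] by (simp add: mult.commute)
  then show ?thesis using Young_nn[OF assms(2,1)] by simp
qed

text \<open>A divergent Bochner integral is 0 by convention, so the usual bound extends to all
  \<open>f\<close>. \<open>Young_kernel\<close> can therefore treat every frequency alike.\<close>

lemma norm_integral_le_nn:
  fixes f :: "'a \<Rightarrow> complex"
  shows "ennreal (cmod (integral\<^sup>L M f)) \<le> (\<integral>\<^sup>+x. ennreal (cmod (f x)) \<partial>M)"
  by (cases "integrable M f") (auto simp: integral_norm_bound_ennreal not_integrable_integral_eq)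

text \<open>The common form of the product and the commutator estimates: one dominating convolution
  has the weighted \<open>L^2\<close> factor on the left and an \<open>L^1\<close> factor on the
  right, the other has them exchanged. The constant 2 generously replaces the \<open>sqrt 2\<close>
  that comes from \<open>(a + b)^2 <= 2 (a^2 + b^2)\<close>.\<close>

lemma Young_kernel:
  fixes K :: "real \<Rightarrow> real \<Rightarrow> complex"
  assumes K [measurable]: "case_prod K \<in> borel_measurable (borel \<Otimes>\<^sub>M borel)"
    and f1: "sq_int f1" and g1: "integrable lborel g1" and f2: "integrable lborel f2" and g2: "sq_int g2"
    and le: "\<And>\<xi> \<eta>. cmod (K \<xi> \<eta>) \<le> c * (cmod (f1 (\<xi> - \<eta>)) * cmod (g1 \<eta>) + cmod (f2 (\<xi> - \<eta>)) * cmod (g2 \<eta>))"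
    and c: "0 \<le> c"
  shows "sq_int (\<lambda>\<xi>. LINT \<eta>|lborel. K \<xi> \<eta>)"
    and "l2 (\<lambda>\<xi>. LINT \<eta>|lborel. K \<xi> \<eta>) \<le> 2 * c * (l2 f1 * l1 g1 + l1 f2 * l2 g2)"
proof -
  let ?B = "2 * c * (l2 f1 * l1 g1 + l1 f2 * l2 g2)"
  have [measurable]: "f1 \<in> borel_measurable borel" "g2 \<in> borel_measurable borel" using f1 g2 by auto
  have [measurable]: "f2 \<in> borel_measurable borel" "g1 \<in> borel_measurable borel"
    using borel_measurable_integrable[OF f2] borel_measurable_integrable[OF g1] by simp_all
  have [measurable]: "(\<lambda>\<xi>. LINT \<eta>|lborel. K \<xi> \<eta>) \<in> borel_measurable borel"
    by (rule lborel.borel_measurable_lebesgue_integral) (simp add: case_prod_beta')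
  define I1 where "I1 \<xi> = (\<integral>\<^sup>+\<eta>. ennreal (cmod (f1 (\<xi> - \<eta>))) * ennreal (cmod (g1 \<eta>)) \<partial>lborel)" for \<xi>
  define I2 where "I2 \<xi> = (\<integral>\<^sup>+\<eta>. ennreal (cmod (f2 (\<xi> - \<eta>))) * ennreal (cmod (g2 \<eta>)) \<partial>lborel)" for \<xi>
  have [measurable]: "I1 \<in> borel_measurable borel" "I2 \<in> borel_measurable borel"
    unfolding I1_def I2_def by measurable
  have "ennreal (cmod (LINT \<eta>|lborel. K \<xi> \<eta>)) \<le> ennreal c * (I1 \<xi> + I2 \<xi>)" for \<xi>
  proof -
    have "ennreal (cmod (LINT \<eta>|lborel. K \<xi> \<eta>)) \<le> (\<integral>\<^sup>+\<eta>. ennreal (cmod (K \<xi> \<eta>)) \<partial>lborel)"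
      by (rule norm_integral_le_nn)
    also have "\<dots> \<le> (\<integral>\<^sup>+\<eta>. ennreal c * (ennreal (cmod (f1 (\<xi> - \<eta>))) * ennreal (cmod (g1 \<eta>)) + ennreal (cmod (f2 (\<xi> - \<eta>))) * ennreal (cmod (g2 \<eta>))) \<partial>lborel)"
      using le c by (intro nn_integral_mono) (auto simp: ennreal_mult[symmetric] ennreal_plus[symmetric] simp del: ennreal_plus intro!: ennreal_leI)
    also have "\<dots> = ennreal c * (I1 \<xi> + I2 \<xi>)"
      unfolding I1_def I2_def by (subst nn_integral_cmult, simp, subst nn_integral_add, simp_all)
    finally show ?thesis .
  qed
  then have "(\<integral>\<^sup>+\<xi>. (ennreal (cmod (LINT \<eta>|lborel. K \<xi> \<eta>)))\<^sup>2 \<partial>lborel) \<le> (\<integral>\<^sup>+\<xi>. (ennreal c * (I1 \<xi> + I2 \<xi>))\<^sup>2 \<partial>lborel)"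
    by (intro nn_integral_mono power_mono) auto
  also have "\<dots> \<le> (\<integral>\<^sup>+\<xi>. ennreal (2 * c\<^sup>2) * ((I1 \<xi>)\<^sup>2 + (I2 \<xi>)\<^sup>2) \<partial>lborel)"
  proof (intro nn_integral_mono)
    fix \<xi>
    have "(I1 \<xi> + I2 \<xi>)\<^sup>2 = (I1 \<xi>)\<^sup>2 + (I2 \<xi>)\<^sup>2 + 2 * (I1 \<xi> * I2 \<xi>)"
      by (simp add: power2_eq_square distrib_left distrib_right mult_ac add_ac mult_2_right)
    also have "\<dots> \<le> (I1 \<xi>)\<^sup>2 + (I2 \<xi>)\<^sup>2 + ((I1 \<xi>)\<^sup>2 + (I2 \<xi>)\<^sup>2)"
      by (intro add_left_mono ennreal_two_mult_le)
    also have "\<dots> = 2 * ((I1 \<xi>)\<^sup>2 + (I2 \<xi>)\<^sup>2)" by (simp add: mult_2)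
    finally have "(ennreal c)\<^sup>2 * (I1 \<xi> + I2 \<xi>)\<^sup>2 \<le> (ennreal c)\<^sup>2 * (2 * ((I1 \<xi>)\<^sup>2 + (I2 \<xi>)\<^sup>2))"
      by (rule mult_left_mono) simp
    also have "\<dots> = ennreal (2 * c\<^sup>2) * ((I1 \<xi>)\<^sup>2 + (I2 \<xi>)\<^sup>2)"
      using c by (simp add: ennreal_power ennreal_mult mult_ac distrib_left)
    finally show "(ennreal c * (I1 \<xi> + I2 \<xi>))\<^sup>2 \<le> ennreal (2 * c\<^sup>2) * ((I1 \<xi>)\<^sup>2 + (I2 \<xi>)\<^sup>2)"
      by (simp add: power_mult_distrib)
  qed
  also have "\<dots> = ennreal (2 * c\<^sup>2) * ((\<integral>\<^sup>+\<xi>. (I1 \<xi>)\<^sup>2 \<partial>lborel) + (\<integral>\<^sup>+\<xi>. (I2 \<xi>)\<^sup>2 \<partial>lborel))"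
    by (subst nn_integral_cmult, simp, subst nn_integral_add, simp_all)
  also have "\<dots> \<le> ennreal (2 * c\<^sup>2) * ((ennreal (l1 g1))\<^sup>2 * ennreal ((l2 f1)\<^sup>2) + (ennreal (l1 f2))\<^sup>2 * ennreal ((l2 g2)\<^sup>2))"
    unfolding I1_def I2_def nn_l2[OF f1, symmetric] nn_l2[OF g2, symmetric] nn_l1[OF g1, symmetric] nn_l1[OF f2, symmetric]
    by (intro mult_left_mono add_mono Young_nn Young_nn') simp_all
  also have "\<dots> = ennreal (2 * c\<^sup>2 * ((l2 f1 * l1 g1)\<^sup>2 + (l1 f2 * l2 g2)\<^sup>2))"
    by (simp add: ennreal_power ennreal_mult[symmetric] ennreal_plus[symmetric] power_mult_distrib mult_ac del: ennreal_plus)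
  also have "\<dots> \<le> ennreal (?B\<^sup>2)"
  proof (rule ennreal_leI)
    have "0 \<le> (l2 f1 * l1 g1) * (l1 f2 * l2 g2)" by simp
    then have "(l2 f1 * l1 g1)\<^sup>2 + (l1 f2 * l2 g2)\<^sup>2 \<le> (l2 f1 * l1 g1 + l1 f2 * l2 g2)\<^sup>2"
      by (simp add: power2_sum)
    then have "2 * c\<^sup>2 * ((l2 f1 * l1 g1)\<^sup>2 + (l1 f2 * l2 g2)\<^sup>2) \<le> 2 * c\<^sup>2 * (l2 f1 * l1 g1 + l1 f2 * l2 g2)\<^sup>2"
      by (intro mult_left_mono) auto
    also have "\<dots> \<le> 4 * c\<^sup>2 * (l2 f1 * l1 g1 + l1 f2 * l2 g2)\<^sup>2"
      by (intro mult_right_mono) auto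
    finally show "2 * c\<^sup>2 * ((l2 f1 * l1 g1)\<^sup>2 + (l1 f2 * l2 g2)\<^sup>2) \<le> ?B\<^sup>2"
      by (simp add: power_mult_distrib)
  qed
  finally have *: "(\<integral>\<^sup>+\<xi>. (ennreal (cmod (LINT \<eta>|lborel. K \<xi> \<eta>)))\<^sup>2 \<partial>lborel) \<le> ennreal (?B\<^sup>2)" .
  have B: "0 \<le> ?B" using c by simp
  show "sq_int (\<lambda>\<xi>. LINT \<eta>|lborel. K \<xi> \<eta>)" "l2 (\<lambda>\<xi>. LINT \<eta>|lborel. K \<xi> \<eta>) \<le> ?B"
    by (rule sq_intI_nn[OF _ * B]; simp)+
qed

section \<open>Convolution on the frequency side as an operator and as a symmetric form\<close>

definition cconv :: "(real \<Rightarrow> complex) \<Rightarrow> (real \<Rightarrow> complex) \<Rightarrow> real \<Rightarrow> complex" where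
  "cconv F G \<xi> = (LINT \<eta>|lborel. F (\<xi> - \<eta>) * G \<eta>)"

lemma cconv_measurable [measurable]:
  assumes [measurable]: "F \<in> borel_measurable borel" "G \<in> borel_measurable borel"
  shows "cconv F G \<in> borel_measurable borel"
  unfolding cconv_def by (rule lborel.borel_measurable_lebesgue_integral) simp

lemma cconv_integrand:
  assumes "sq_int F" "sq_int G" shows "integrable lborel (\<lambda>\<eta>. F (\<xi> - \<eta>) * G \<eta>)"
  by (rule sq_int_mult[OF sq_int_reflect[OF assms(1)] assms(2)])

lemma sq_int_cconv:
  assumes "integrable lborel Q" "sq_int e"
  shows "sq_int (cconv Q e)" "l2 (cconv Q e) \<le> 2 * l1 Q * l2 e"
proof -
  have [measurable]: "e \<in> borel_measurable borel" "Q \<in> borel_measurable borel"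
    using assms borel_measurable_integrable[OF assms(1)] by auto
  have m: "(\<lambda>(\<xi>, \<eta>). Q (\<xi> - \<eta>) * e \<eta>) \<in> borel_measurable (borel \<Otimes>\<^sub>M borel)" by measurable
  have z: "integrable lborel (\<lambda>x::real. 0::complex)" by simp
  have le: "cmod (Q (\<xi> - \<eta>) * e \<eta>) \<le> 1 * (cmod 0 * cmod 0 + cmod (Q (\<xi> - \<eta>)) * cmod (e \<eta>))" for \<xi> \<eta>
    by (simp add: norm_mult)
  from Young_kernel[OF m sq_int_zero(1) z assms le]
  show "sq_int (cconv Q e)" "l2 (cconv Q e) \<le> 2 * l1 Q * l2 e"
    unfolding cconv_def by (simp_all add: sq_int_zero)
qed

lemma cconv_diff_left:
  assumes "sq_int P" "sq_int Q" "sq_int e"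
  shows "cconv (\<lambda>x. P x - Q x) e \<xi> = cconv P e \<xi> - cconv Q e \<xi>"
  unfolding cconv_def left_diff_distrib
  by (rule Bochner_Integration.integral_diff[OF cconv_integrand[OF assms(1,3)] cconv_integrand[OF assms(2,3)]])

lemma cconv_add_right:
  assumes "sq_int Q" "sq_int e" "sq_int f"
  shows "cconv Q (\<lambda>x. e x + f x) \<xi> = cconv Q e \<xi> + cconv Q f \<xi>"
  unfolding cconv_def distrib_left
  by (rule Bochner_Integration.integral_add[OF cconv_integrand[OF assms(1,2)] cconv_integrand[OF assms(1,3)]])

text \<open>The Fourier picture of the fact that multiplication by a real function is self-adjoint:
  reality becomes the Hermitian symmetry of \<open>Q\<close>, and exchanging the two integrations
  moves the operator to the other side.\<close>

lemma cconv_symmetric_form: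
  assumes Q: "integrable lborel Q" and e: "sq_int e" and f: "sq_int f"
    and herm: "AE x in lborel. Q (- x) = cnj (Q x)"
  shows "(LINT \<xi>|lborel. cconv Q e \<xi> * cnj (f \<xi>)) = cnj (LINT \<xi>|lborel. cconv Q f \<xi> * cnj (e \<xi>))"
proof -
  have [measurable]: "e \<in> borel_measurable borel" "f \<in> borel_measurable borel" using e f by auto
  have [measurable]: "Q \<in> borel_measurable borel" using borel_measurable_integrable[OF Q] by simp
  let ?K = "\<lambda>\<xi> \<eta>. Q (\<xi> - \<eta>) * e \<eta> * cnj (f \<xi>)"
  \<comment> \<open>Absolute convergence for Fubini: \<open>C\<close> is square integrable by
    Young's inequality, and a product of two square integrable functions is dominated by the sum of
    their squares.\<close>
  have fin: "(\<integral>\<^sup>+\<xi>. \<integral>\<^sup>+\<eta>. ennreal (cmod (?K \<xi> \<eta>)) \<partial>lborel \<partial>lborel) < \<infinity>"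
  proof -
    have cQ: "integrable lborel (\<lambda>x. complex_of_real (cmod (Q x)))" using Q by simp
    have ce: "sq_int (\<lambda>x. complex_of_real (cmod (e x)))" using e by (auto simp: sq_int_def)
    define C where "C \<xi> = (\<integral>\<^sup>+\<eta>. ennreal (cmod (Q (\<xi> - \<eta>))) * ennreal (cmod (e \<eta>)) \<partial>lborel)" for \<xi>
    have [measurable]: "C \<in> borel_measurable borel" unfolding C_def by measurable
    have "(\<integral>\<^sup>+\<xi>. \<integral>\<^sup>+\<eta>. ennreal (cmod (?K \<xi> \<eta>)) \<partial>lborel \<partial>lborel) = (\<integral>\<^sup>+\<xi>. C \<xi> * ennreal (cmod (f \<xi>)) \<partial>lborel)"
      unfolding C_def by (simp add: norm_mult ennreal_mult nn_integral_multc)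
    also have "\<dots> \<le> (\<integral>\<^sup>+\<xi>. (C \<xi>)\<^sup>2 + (ennreal (cmod (f \<xi>)))\<^sup>2 \<partial>lborel)"
    proof (rule nn_integral_mono)
      fix x
      have "C x * ennreal (cmod (f x)) \<le> 2 * (C x * ennreal (cmod (f x)))" by (simp add: mult_2)
      also have "\<dots> \<le> (C x)\<^sup>2 + (ennreal (cmod (f x)))\<^sup>2" by (rule ennreal_two_mult_le)
      finally show "C x * ennreal (cmod (f x)) \<le> (C x)\<^sup>2 + (ennreal (cmod (f x)))\<^sup>2" .
    qed
    also have "\<dots> = (\<integral>\<^sup>+\<xi>. (C \<xi>)\<^sup>2 \<partial>lborel) + ennreal ((l2 f)\<^sup>2)"
      by (subst nn_integral_add) (simp_all add: nn_l2[OF f])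
    also have "\<dots> \<le> (ennreal (l1 Q))\<^sup>2 * ennreal ((l2 e)\<^sup>2) + ennreal ((l2 f)\<^sup>2)"
      unfolding C_def nn_l2[OF e, symmetric] nn_l1[OF Q, symmetric]
      by (intro add_right_mono Young_nn') simp_all
    also have "\<dots> < \<infinity>" by (simp add: ennreal_power ennreal_mult[symmetric] ennreal_plus[symmetric] del: ennreal_plus)
    finally show ?thesis .
  qed
  have int: "integrable (lborel \<Otimes>\<^sub>M lborel) (\<lambda>(\<xi>, \<eta>). ?K \<xi> \<eta>)"
  proof (subst integrable_iff_bounded, intro conjI)
    show "(\<lambda>(\<xi>, \<eta>). ?K \<xi> \<eta>) \<in> borel_measurable (lborel \<Otimes>\<^sub>M lborel)" by measurable
    show "(\<integral>\<^sup>+x. ennreal (norm (case x of (\<xi>, \<eta>) \<Rightarrow> ?K \<xi> \<eta>)) \<partial>(lborel \<Otimes>\<^sub>M lborel)) < \<infinity>"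
      using fin by (subst lborel.nn_integral_fst[symmetric]) simp_all
  qed
  have "(LINT \<xi>|lborel. cconv Q e \<xi> * cnj (f \<xi>)) = (LINT \<xi>|lborel. LINT \<eta>|lborel. ?K \<xi> \<eta>)"
    unfolding cconv_def by simp
  also have "\<dots> = (LINT \<eta>|lborel. LINT \<xi>|lborel. ?K \<xi> \<eta>)"
    by (rule lborel_pair.Fubini_integral[symmetric]) (use int in simp)
  also have "\<dots> = (LINT \<eta>|lborel. cnj (cconv Q f \<eta> * cnj (e \<eta>)))"
  proof (rule Bochner_Integration.integral_cong[OF refl])
    fix \<eta>
    have "AE \<xi> in lborel. Q (- (\<xi> - \<eta>)) = cnj (Q (\<xi> - \<eta>))"
      using AE_borel_affine[of "1::real" "\<lambda>x. Q (- x) = cnj (Q x)" "- \<eta>"] herm by simp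
    then have "AE \<xi> in lborel. ?K \<xi> \<eta> = cnj (Q (\<eta> - \<xi>) * f \<xi> * cnj (e \<eta>))"
      by eventually_elim simp
    then have "(LINT \<xi>|lborel. ?K \<xi> \<eta>) = (LINT \<xi>|lborel. cnj (Q (\<eta> - \<xi>) * f \<xi> * cnj (e \<eta>)))"
      by (intro integral_cong_AE) simp_all
    also have "\<dots> = cnj (cconv Q f \<eta> * cnj (e \<eta>))"
      unfolding cconv_def
      using Bochner_Integration.integral_cnj[of lborel "\<lambda>\<xi>. Q (\<eta> - \<xi>) * f \<xi> * cnj (e \<eta>)"] by simp
    finally show "(LINT \<xi>|lborel. ?K \<xi> \<eta>) = cnj (cconv Q f \<eta> * cnj (e \<eta>))" .
  qed
  also have "\<dots> = cnj (LINT \<xi>|lborel. cconv Q f \<xi> * cnj (e \<xi>))" by (rule Bochner_Integration.integral_cnj)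
  finally show ?thesis .
qed

subsection \<open>The Fourier transform on $L^1$\<close>

text \<open>The sign of the exponent is that of the inverse transform.\<close>

definition ft :: "(real \<Rightarrow> complex) \<Rightarrow> real \<Rightarrow> complex" where
  "ft F x = (LINT \<xi>|lborel. F \<xi> * iexp (x * \<xi>))"

lemma integrable_lborel_measurable:
  "integrable lborel (F :: real \<Rightarrow> complex) \<Longrightarrow> F \<in> borel_measurable borel"
  using borel_measurable_integrable by force

lemma ft_integrand:
  assumes F: "integrable lborel F" shows "integrable lborel (\<lambda>\<xi>. F \<xi> * iexp (x * \<xi>))"
proof (rule Bochner_Integration.integrable_bound[OF F])
  have [measurable]: "F \<in> borel_measurable borel" by (rule integrable_lborel_measurable[OF F])
  show "(\<lambda>\<xi>. F \<xi> * iexp (x * \<xi>)) \<in> borel_measurable lborel" by measurable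
qed (simp add: norm_mult)

lemma cmod_ft_le:
  assumes F: "integrable lborel F" shows "cmod (ft F x) \<le> l1 F"
  using integral_norm_bound[of lborel "\<lambda>\<xi>. F \<xi> * iexp (x * \<xi>)"] by (simp add: ft_def l1_def norm_mult)

lemma continuous_ft:
  assumes F: "integrable lborel F" shows "isCont (ft F) x"
proof (rule continuous_at_sequentiallyI)
  fix u :: "nat \<Rightarrow> real" assume u: "u \<longlonglongrightarrow> x"
  have [measurable]: "F \<in> borel_measurable borel" by (rule integrable_lborel_measurable[OF F])
  show "(\<lambda>n. ft F (u n)) \<longlonglongrightarrow> ft F x"
    unfolding ft_def
  proof (rule integral_dominated_convergence[where w = "\<lambda>\<xi>. cmod (F \<xi>)"])
    show "AE \<xi> in lborel. (\<lambda>n. F \<xi> * iexp (u n * \<xi>)) \<longlonglongrightarrow> F \<xi> * iexp (x * \<xi>)"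
      by (intro AE_I2 tendsto_intros u)
  qed (use F in \<open>auto simp: norm_mult\<close>)
qed

lemma ft_measurable [measurable]:
  assumes F: "integrable lborel F" shows "ft F \<in> borel_measurable borel"
  by (intro borel_measurable_continuous_onI continuous_at_imp_continuous_on ballI continuous_ft[OF F])

lemma ft_add:
  assumes "integrable lborel F" "integrable lborel G" shows "ft (\<lambda>\<xi>. F \<xi> + G \<xi>) x = ft F x + ft G x"
  unfolding ft_def distrib_right
  by (rule Bochner_Integration.integral_add[OF ft_integrand[OF assms(1)] ft_integrand[OF assms(2)]])

lemma ft_diff:
  assumes "integrable lborel F" "integrable lborel G" shows "ft (\<lambda>\<xi>. F \<xi> - G \<xi>) x = ft F x - ft G x"
  unfolding ft_def left_diff_distrib
  by (rule Bochner_Integration.integral_diff[OF ft_integrand[OF assms(1)] ft_integrand[OF assms(2)]])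

lemma ft_scale: "ft (\<lambda>\<xi>. c * F \<xi>) x = c * ft F x"
  by (simp add: ft_def mult.assoc)

lemma ft_cong_AE:
  assumes "F \<in> borel_measurable borel" "G \<in> borel_measurable borel" "AE x in lborel. F x = G x"
  shows "ft F x = ft G x"
  unfolding ft_def using assms by (intro integral_cong_AE) auto

lemma ft_cnj_reflect: "ft (\<lambda>x. cnj (h (- x))) y = cnj (ft h y)"
proof -
  have "ft (\<lambda>x. cnj (h (- x))) y = (LINT x|lborel. cnj (h (- x)) * iexp (y * x))" by (simp add: ft_def)
  also have "\<dots> = (LINT x|lborel. cnj (h x * iexp (y * x)))"
    by (subst lborel_integral_real_affine[of "-1" _ 0]) (simp_all add: exp_cnj)
  finally show ?thesis by (simp only: Bochner_Integration.integral_cnj ft_def)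
qed

lemma integrable_pairI:
  fixes K :: "real \<Rightarrow> real \<Rightarrow> complex"
  assumes [measurable]: "case_prod K \<in> borel_measurable (borel \<Otimes>\<^sub>M borel)"
    and fin: "(\<integral>\<^sup>+x. \<integral>\<^sup>+y. ennreal (cmod (K x y)) \<partial>lborel \<partial>lborel) < \<infinity>"
  shows "integrable (lborel \<Otimes>\<^sub>M lborel) (case_prod K)"
proof (subst integrable_iff_bounded, intro conjI)
  have *: "(\<lambda>x. ennreal (norm (case_prod K x))) \<in> borel_measurable (lborel \<Otimes>\<^sub>M lborel)" by measurable
  show "(\<integral>\<^sup>+x. ennreal (norm (case_prod K x)) \<partial>(lborel \<Otimes>\<^sub>M lborel)) < \<infinity>"
    using fin lborel.nn_integral_fst[OF *] by simp
qed measurable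

lemma ft_multiplication:
  assumes F: "integrable lborel F" and G: "integrable lborel G"
  shows "(LINT x|lborel. ft F x * G x) = (LINT \<xi>|lborel. F \<xi> * ft G \<xi>)"
proof -
  have [measurable]: "F \<in> borel_measurable borel" "G \<in> borel_measurable borel"
    using integrable_lborel_measurable F G by auto
  let ?K = "\<lambda>x \<xi>. F \<xi> * iexp (x * \<xi>) * G x"
  have "(\<integral>\<^sup>+x. \<integral>\<^sup>+\<xi>. ennreal (cmod (?K x \<xi>)) \<partial>lborel \<partial>lborel) = ennreal (l1 F) * ennreal (l1 G)"
    unfolding nn_l1[OF F, symmetric] nn_l1[OF G, symmetric]
    by (simp add: norm_mult ennreal_mult nn_integral_multc nn_integral_cmult)
  then have fin: "(\<integral>\<^sup>+x. \<integral>\<^sup>+\<xi>. ennreal (cmod (?K x \<xi>)) \<partial>lborel \<partial>lborel) < \<infinity>"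
    by (simp add: ennreal_mult[symmetric])
  have int: "integrable (lborel \<Otimes>\<^sub>M lborel) (\<lambda>(x, \<xi>). ?K x \<xi>)"
    by (rule integrable_pairI[OF _ fin]) measurable
  have "(LINT x|lborel. ft F x * G x) = (LINT x|lborel. LINT \<xi>|lborel. ?K x \<xi>)"
    by (simp add: ft_def)
  also have "\<dots> = (LINT \<xi>|lborel. LINT x|lborel. ?K x \<xi>)"
    by (rule lborel_pair.Fubini_integral[symmetric]) (use int in simp)
  also have "\<dots> = (LINT \<xi>|lborel. F \<xi> * ft G \<xi>)"
    unfolding ft_def integral_mult_right_zero[symmetric]
    by (intro Bochner_Integration.integral_cong refl) (simp add: mult_ac)
  finally show ?thesis .
qed

lemma ft_cconv:
  assumes F: "integrable lborel F" and G: "integrable lborel G"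
  shows "integrable lborel (cconv F G)" "ft (cconv F G) x = ft F x * ft G x"
proof -
  have [measurable]: "F \<in> borel_measurable borel" "G \<in> borel_measurable borel"
    using integrable_lborel_measurable F G by auto
  have fin: "(\<integral>\<^sup>+\<xi>. \<integral>\<^sup>+\<eta>. ennreal (cmod (F (\<xi> - \<eta>) * G \<eta> * iexp (x * \<xi>))) \<partial>lborel \<partial>lborel) < \<infinity>" for x
  proof -
    have "(\<integral>\<^sup>+\<xi>. \<integral>\<^sup>+\<eta>. ennreal (cmod (F (\<xi> - \<eta>) * G \<eta> * iexp (x * \<xi>))) \<partial>lborel \<partial>lborel)
        = (\<integral>\<^sup>+\<xi>. \<integral>\<^sup>+\<eta>. ennreal (cmod (F (\<xi> - \<eta>))) * ennreal (cmod (G \<eta>)) \<partial>lborel \<partial>lborel)"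
      by (simp add: norm_mult ennreal_mult)
    also have "\<dots> = (\<integral>\<^sup>+\<eta>. \<integral>\<^sup>+\<xi>. ennreal (cmod (F (\<xi> - \<eta>))) * ennreal (cmod (G \<eta>)) \<partial>lborel \<partial>lborel)"
      by (rule lborel_pair.Fubini'[symmetric]) simp
    also have "\<dots> = ennreal (l1 F) * ennreal (l1 G)"
      unfolding nn_l1[OF F, symmetric] nn_l1[OF G, symmetric]
      by (simp add: nn_integral_multc nn_integral_cmult nn_integral_reflect_shift(1)[of "\<lambda>x. ennreal (cmod (F x))"])
    also have "\<dots> < \<infinity>" by (simp add: ennreal_mult[symmetric])
    finally show ?thesis .
  qed
  have int: "integrable (lborel \<Otimes>\<^sub>M lborel) (\<lambda>(\<xi>, \<eta>). F (\<xi> - \<eta>) * G \<eta> * iexp (x * \<xi>))" for x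
    by (rule integrable_pairI[OF _ fin]) measurable
  show "integrable lborel (cconv F G)"
    using lborel_pair.integrable_fst'[OF int[of 0]] by (simp add: cconv_def[abs_def])
  have "ft (cconv F G) x = (LINT \<xi>|lborel. LINT \<eta>|lborel. F (\<xi> - \<eta>) * G \<eta> * iexp (x * \<xi>))"
    by (simp add: ft_def cconv_def)
  also have "\<dots> = (LINT \<eta>|lborel. LINT \<xi>|lborel. F (\<xi> - \<eta>) * G \<eta> * iexp (x * \<xi>))"
    by (rule lborel_pair.Fubini_integral[symmetric]) (use int[of x] in simp)
  also have "\<dots> = (LINT \<eta>|lborel. ft F x * (G \<eta> * iexp (x * \<eta>)))"
  proof (intro Bochner_Integration.integral_cong refl)
    fix \<eta>
    have "(LINT \<xi>|lborel. F (\<xi> - \<eta>) * G \<eta> * iexp (x * \<xi>)) = (LINT \<xi>|lborel. F \<xi> * G \<eta> * iexp (x * (\<eta> + \<xi>)))"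
      by (subst lborel_integral_real_affine[of 1 _ \<eta>]) simp_all
    also have "\<dots> = (LINT \<xi>|lborel. (F \<xi> * iexp (x * \<xi>)) * (G \<eta> * iexp (x * \<eta>)))"
      by (intro Bochner_Integration.integral_cong refl) (simp add: distrib_left exp_add)
    finally show "(LINT \<xi>|lborel. F (\<xi> - \<eta>) * G \<eta> * iexp (x * \<xi>)) = ft F x * (G \<eta> * iexp (x * \<eta>))"
      by (simp add: ft_def)
  qed
  finally show "ft (cconv F G) x = ft F x * ft G x" by (simp add: ft_def)
qed

subsection \<open>Gaussian summation\<close>

lemma inverse_Suc_mult_tendsto_0: "(\<lambda>n. 1 / real (Suc n) * x) \<longlonglongrightarrow> 0 * x"
  by (intro tendsto_mult tendsto_const LIMSEQ_Suc[OF lim_1_over_n])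

definition gauss :: "real \<Rightarrow> real \<Rightarrow> complex" where
  "gauss \<epsilon> x = complex_of_real (exp (- (\<epsilon> * x)\<^sup>2 / 2))"

lemma gauss_measurable [measurable]: "gauss \<epsilon> \<in> borel_measurable borel"
  unfolding gauss_def by measurable

lemma norm_gauss_le: "cmod (gauss \<epsilon> x) \<le> 1"
  by (simp add: gauss_def)

lemma gauss_std: "gauss 1 x = complex_of_real (sqrt (2 * pi) * std_normal_density x)"
  by (simp add: gauss_def std_normal_density_def)

lemma integrable_gauss:
  assumes "\<epsilon> > 0" shows "integrable lborel (gauss \<epsilon>)"
proof -
  have "integrable lborel std_normal_density"
    using integrable_std_normal_moment[of 0] by simp
  then have 1: "integrable lborel (gauss 1)"
    unfolding gauss_std[abs_def] by (intro integrable_of_real integrable_mult_right)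
  have "integrable lborel (\<lambda>x. gauss 1 (0 + \<epsilon> * x))"
    using 1 assms by (subst lborel_integrable_real_affine_iff) auto
  then show ?thesis by (simp add: gauss_def[abs_def])
qed

text \<open>Read off from the characteristic function of the standard normal distribution, followed
  by a dilation by \<epsilon>.\<close>

lemma ft_gauss:
  assumes e: "\<epsilon> > 0"
  shows "ft (gauss \<epsilon>) y = complex_of_real (sqrt (2 * pi) / \<epsilon>) * gauss (1 / \<epsilon>) y"
proof -
  let ?t = "y / \<epsilon>"
  have "complex_of_real (exp (- ?t\<^sup>2 / 2)) = (CLINT x|std_normal_distribution. iexp (?t * x))"
    using fun_cong[OF char_std_normal_distribution, of ?t] by (simp add: char_def)
  also have "\<dots> = (LINT x|lborel. std_normal_density x *\<^sub>R iexp (?t * x))"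
    by (subst integral_density) (auto simp: normal_density_nonneg)
  finally have "complex_of_real (sqrt (2 * pi)) * complex_of_real (exp (- ?t\<^sup>2 / 2))
      = complex_of_real (sqrt (2 * pi)) * (LINT x|lborel. std_normal_density x *\<^sub>R iexp (?t * x))" by simp
  also have "\<dots> = (LINT x|lborel. complex_of_real (sqrt (2 * pi)) * (std_normal_density x *\<^sub>R iexp (?t * x)))"
    by (rule integral_mult_right_zero[symmetric])
  also have "\<dots> = (LINT x|lborel. gauss 1 x * iexp (?t * x))"
    by (intro Bochner_Integration.integral_cong refl) (simp add: gauss_std scaleR_conv_of_real)
  also have "\<dots> = \<epsilon> *\<^sub>R (LINT x|lborel. gauss 1 (0 + \<epsilon> * x) * iexp (?t * (0 + \<epsilon> * x)))"
    using e by (subst lborel_integral_real_affine[of \<epsilon> _ 0]) simp_all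
  also have "\<dots> = \<epsilon> *\<^sub>R ft (gauss \<epsilon>) y"
    using e by (simp add: ft_def gauss_def)
  finally show ?thesis
    using e by (simp add: gauss_def scaleR_conv_of_real field_simps)
qed

text \<open>The multiplication formula moves the damping factor onto \<open>k\<close>, where it
  becomes an averaging over the scale \<epsilon> about 0. One \<open>sqrt (2 * pi)\<close> comes
  from the transform of the Gaussian, the other from the normalisation of the normal
  density.\<close>

lemma gauss_pairing:
  assumes k: "integrable lborel k" and e: "\<epsilon> > 0"
  shows "(LINT x|lborel. ft k x * gauss \<epsilon> x)
    = 2 * pi * (LINT z|lborel. complex_of_real (std_normal_density z) * k (\<epsilon> * z))"
proof -
  have "(LINT x|lborel. ft k x * gauss \<epsilon> x) = (LINT y|lborel. k y * ft (gauss \<epsilon>) y)"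
    by (rule ft_multiplication[OF k integrable_gauss[OF e]])
  also have "\<dots> = \<epsilon> *\<^sub>R (LINT z|lborel. k (0 + \<epsilon> * z) * ft (gauss \<epsilon>) (0 + \<epsilon> * z))"
    using e by (subst lborel_integral_real_affine[of \<epsilon> _ 0]) simp_all
  also have "\<dots> = \<epsilon> *\<^sub>R (LINT z|lborel. complex_of_real (2 * pi / \<epsilon>) * (complex_of_real (std_normal_density z) * k (\<epsilon> * z)))"
  proof -
    have "k (0 + \<epsilon> * z) * ft (gauss \<epsilon>) (0 + \<epsilon> * z) = complex_of_real (2 * pi / \<epsilon>) * (complex_of_real (std_normal_density z) * k (\<epsilon> * z))" for z
    proof -
      have "gauss (1 / \<epsilon>) (\<epsilon> * z) = gauss 1 z" using e by (simp add: gauss_def)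
      moreover have "complex_of_real (sqrt (2 * pi)) * complex_of_real (sqrt (2 * pi)) = complex_of_real (2 * pi)"
        unfolding of_real_mult[symmetric] by (simp add: real_sqrt_mult_self)
      ultimately show ?thesis using e
        by (simp add: ft_gauss[OF e] gauss_std mult_ac)
    qed
    then show ?thesis by simp
  qed
  also have "\<dots> = 2 * pi * (LINT z|lborel. complex_of_real (std_normal_density z) * k (\<epsilon> * z))"
    using e by (simp add: scaleR_conv_of_real)
  finally show ?thesis .
qed

lemma integrable_std_normal_mult:
  fixes k :: "real \<Rightarrow> complex"
  assumes [measurable]: "k \<in> borel_measurable borel" and B: "\<And>x. cmod (k x) \<le> B"
  shows "integrable lborel (\<lambda>z. complex_of_real (std_normal_density z) * k (\<epsilon> * z))"
proof (rule Bochner_Integration.integrable_bound)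
  show "integrable lborel (\<lambda>z. B * std_normal_density z)"
    using integrable_std_normal_moment[of 0] by simp
  have "cmod (complex_of_real (std_normal_density z) * k (\<epsilon> * z)) \<le> B * std_normal_density z" for z
    using mult_right_mono[OF B, of "std_normal_density z" "\<epsilon> * z"]
    by (simp add: norm_mult normal_density_nonneg mult.commute)
  then show "AE z in lborel. cmod (complex_of_real (std_normal_density z) * k (\<epsilon> * z)) \<le> norm (B * std_normal_density z)"
    by (auto intro: order_trans abs_ge_self)
qed measurable

lemma integral_std_normal_density: "(LINT z|lborel. std_normal_density z) = 1"
  using integral_std_normal_moment_even[of 0] by simp

lemma gauss_pairing_bound:
  fixes k :: "real \<Rightarrow> complex"
  assumes k: "integrable lborel k" and e: "\<epsilon> > 0" and B: "\<And>x. cmod (k x) \<le> B"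
  shows "cmod (LINT x|lborel. ft k x * gauss \<epsilon> x) \<le> 2 * pi * B"
proof -
  have [measurable]: "k \<in> borel_measurable borel" by (rule integrable_lborel_measurable[OF k])
  have "cmod (LINT z|lborel. complex_of_real (std_normal_density z) * k (\<epsilon> * z))
      \<le> (LINT z|lborel. cmod (complex_of_real (std_normal_density z) * k (\<epsilon> * z)))"
    by (rule integral_norm_bound)
  also have "\<dots> \<le> (LINT z|lborel. B * std_normal_density z)"
  proof (rule integral_mono)
    show "integrable lborel (\<lambda>z. cmod (complex_of_real (std_normal_density z) * k (\<epsilon> * z)))"
      by (intro integrable_norm integrable_std_normal_mult[OF _ B]) simp
    show "integrable lborel (\<lambda>z. B * std_normal_density z)"
      using integrable_std_normal_moment[of 0] by simp
    show "cmod (complex_of_real (std_normal_density z) * k (\<epsilon> * z)) \<le> B * std_normal_density z" for z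
      using mult_right_mono[OF B, of "std_normal_density z" "\<epsilon> * z"]
      by (simp add: norm_mult normal_density_nonneg mult.commute)
  qed
  also have "\<dots> = B" by (simp add: integral_std_normal_density)
  finally show ?thesis unfolding gauss_pairing[OF k e] by (simp add: norm_mult)
qed

lemma gauss_pairing_limit:
  fixes k :: "real \<Rightarrow> complex"
  assumes k: "integrable lborel k" and B: "\<And>x. cmod (k x) \<le> B" and c: "isCont k 0"
  shows "(\<lambda>n. LINT x|lborel. ft k x * gauss (1 / real (Suc n)) x) \<longlonglongrightarrow> 2 * pi * k 0"
proof -
  have [measurable]: "k \<in> borel_measurable borel" by (rule integrable_lborel_measurable[OF k])
  have *: "(\<lambda>n. LINT z|lborel. complex_of_real (std_normal_density z) * k (1 / real (Suc n) * z))
      \<longlonglongrightarrow> (LINT z|lborel. complex_of_real (std_normal_density z) * k 0)"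
  proof (rule integral_dominated_convergence[where w = "\<lambda>z. B * std_normal_density z"])
    show "integrable lborel (\<lambda>z. B * std_normal_density z)"
      using integrable_std_normal_moment[of 0] by simp
    show "AE z in lborel. (\<lambda>n. complex_of_real (std_normal_density z) * k (1 / real (Suc n) * z))
        \<longlonglongrightarrow> complex_of_real (std_normal_density z) * k 0"
    proof (intro AE_I2 tendsto_mult tendsto_const)
      fix z :: real
      have "(\<lambda>n. 1 / real (Suc n) * z) \<longlonglongrightarrow> 0 * z" by (rule inverse_Suc_mult_tendsto_0)
      then show "(\<lambda>n. k (1 / real (Suc n) * z)) \<longlonglongrightarrow> k 0"
        using isCont_tendsto_compose[OF c] by simp
    qed
    show "AE z in lborel. cmod (complex_of_real (std_normal_density z) * k (1 / real (Suc n) * z)) \<le> B * std_normal_density z" for n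
    proof (rule AE_I2)
      fix z
      show "cmod (complex_of_real (std_normal_density z) * k (1 / real (Suc n) * z)) \<le> B * std_normal_density z"
        using mult_right_mono[OF B, of "std_normal_density z" "1 / real (Suc n) * z"]
        by (simp add: norm_mult normal_density_nonneg mult.commute)
    qed
  qed measurable
  have "(LINT z|lborel. complex_of_real (std_normal_density z) * k 0) = k 0"
    using integral_std_normal_density by simp
  then have "(\<lambda>n. 2 * pi * (LINT z|lborel. complex_of_real (std_normal_density z) * k (1 / real (Suc n) * z)))
      \<longlonglongrightarrow> 2 * pi * k 0"
    using * by (intro tendsto_mult tendsto_const) simp
  moreover have "(LINT x|lborel. ft k x * gauss (1 / real (Suc n)) x)
      = 2 * pi * (LINT z|lborel. complex_of_real (std_normal_density z) * k (1 / real (Suc n) * z))" for n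
    by (rule gauss_pairing[OF k]) simp
  ultimately show ?thesis by simp
qed

lemma gauss_tendsto_1: "(\<lambda>n. gauss (1 / real (Suc n)) x) \<longlonglongrightarrow> 1"
proof -
  have "(\<lambda>n. complex_of_real (exp (- (1 / real (Suc n) * x)\<^sup>2 / 2))) \<longlonglongrightarrow> complex_of_real (exp (- (0 * x)\<^sup>2 / 2))"
    by (intro tendsto_of_real tendsto_exp tendsto_divide tendsto_minus tendsto_power inverse_Suc_mult_tendsto_0 tendsto_const) simp
  then show ?thesis by (simp add: gauss_def)
qed

subsection \<open>Plancherel's inequality, injectivity and inversion\<close>

lemma l2_reflect:
  assumes "sq_int F" shows "l2 (\<lambda>x. F (t - x)) = l2 F"
proof -
  have [measurable]: "F \<in> borel_measurable borel" using assms by auto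
  have "(LINT x|lborel. (cmod (F x))\<^sup>2) = (LINT x|lborel. (cmod (F (t - x)))\<^sup>2)"
    by (subst lborel_integral_real_affine[of "-1" _ t]) simp_all
  then show ?thesis by (simp add: l2_def)
qed

text \<open>The transform of the autocorrelation of \<open>f\<close> is the nonnegative function
  $|\hat f|^2$, and the autocorrelation is bounded by the square of the $L^2$ norm.\<close>

lemma Plancherel_le:
  assumes f: "integrable lborel f" and f2: "sq_int f"
  shows "sq_int (ft f)" "l2 (ft f) \<le> sqrt (2 * pi) * l2 f"
proof -
  have [measurable]: "f \<in> borel_measurable borel" using f2 by auto
  have [measurable]: "ft f \<in> borel_measurable borel" using f by measurable
  define h where "h x = cnj (f (- x))" for x
  have h: "integrable lborel h"
    unfolding h_def using f lborel_integrable_real_affine_iff[of "-1" f 0] by simp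
  have h2: "sq_int h" "l2 h = l2 f"
    unfolding h_def using sq_int_cnj[OF sq_int_reflect[OF f2, of 0]] l2_reflect[OF f2, of 0]
    by (simp_all add: l2_cnj)
  let ?k = "cconv f h"
  have k: "integrable lborel ?k" by (rule ft_cconv(1)[OF f h])
  have kB: "cmod (?k z) \<le> (l2 f)\<^sup>2" for z
    using Cauchy_Schwarz_norm[OF sq_int_reflect[OF f2, of z] h2(1)] l2_reflect[OF f2, of z]
    by (simp add: cconv_def h2(2) power2_eq_square)
  have ftk: "ft ?k x = complex_of_real ((cmod (ft f x))\<^sup>2)" for x
    unfolding ft_cconv(2)[OF f h] h_def ft_cnj_reflect complex_norm_square ..
  have step: "(\<integral>\<^sup>+x. ennreal ((cmod (ft f x))\<^sup>2 * exp (- (1 / real (Suc n) * x)\<^sup>2 / 2)) \<partial>lborel) \<le> ennreal (2 * pi * (l2 f)\<^sup>2)" for n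
  proof -
    let ?\<epsilon> = "1 / real (Suc n)"
    let ?g = "\<lambda>x. (cmod (ft f x))\<^sup>2 * exp (- (?\<epsilon> * x)\<^sup>2 / 2)"
    have "integrable lborel (\<lambda>x. (l1 f)\<^sup>2 * cmod (gauss ?\<epsilon> x))"
      using integrable_norm[OF integrable_gauss[of ?\<epsilon>]] by simp
    then have int: "integrable lborel ?g"
    proof (rule Bochner_Integration.integrable_bound)
      have le: "?g x \<le> (l1 f)\<^sup>2 * cmod (gauss ?\<epsilon> x)" for x
      proof -
        have "?g x = (cmod (ft f x))\<^sup>2 * cmod (gauss ?\<epsilon> x)" by (simp only: gauss_def norm_of_real abs_exp_cancel)
        also have "\<dots> \<le> (l1 f)\<^sup>2 * cmod (gauss ?\<epsilon> x)"
          by (intro mult_right_mono power_mono cmod_ft_le[OF f] norm_ge_zero)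
        finally show ?thesis .
      qed
      have "norm (?g x) \<le> norm ((l1 f)\<^sup>2 * cmod (gauss ?\<epsilon> x))" for x
      proof -
        have "norm (?g x) = ?g x" by (simp only: real_norm_def abs_mult abs_power2 abs_exp_cancel)
        then show ?thesis using le[of x] abs_ge_self[of "(l1 f)\<^sup>2 * cmod (gauss ?\<epsilon> x)"] by (simp only: real_norm_def)
      qed
      then show "AE x in lborel. norm (?g x) \<le> norm ((l1 f)\<^sup>2 * cmod (gauss ?\<epsilon> x))"
        by (rule AE_I2)
      show "?g \<in> borel_measurable lborel" by measurable
    qed
    have "complex_of_real (LINT x|lborel. ?g x) = (LINT x|lborel. ft ?k x * gauss ?\<epsilon> x)"
      unfolding ftk gauss_def of_real_mult[symmetric] by (rule integral_complex_of_real[symmetric])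
    then have "cmod (complex_of_real (LINT x|lborel. ?g x)) \<le> 2 * pi * (l2 f)\<^sup>2"
      using gauss_pairing_bound[OF k _ kB, of ?\<epsilon>] by simp
    then have "(LINT x|lborel. ?g x) \<le> 2 * pi * (l2 f)\<^sup>2"
      unfolding norm_of_real by (rule order_trans[OF abs_ge_self])
    then show ?thesis
      using nn_integral_eq_integral[OF int] by (simp add: ennreal_leI)
  qed
  \<comment> \<open>Fatou's lemma removes the damping. It yields only one half of Plancherel's
    identity, which suffices to extend the transform to \<open>L^2\<close> by completeness.\<close>
  have "(\<integral>\<^sup>+x. (ennreal (cmod (ft f x)))\<^sup>2 \<partial>lborel)
      = (\<integral>\<^sup>+x. liminf (\<lambda>n. ennreal ((cmod (ft f x))\<^sup>2 * exp (- (1 / real (Suc n) * x)\<^sup>2 / 2))) \<partial>lborel)"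
  proof (intro nn_integral_cong)
    fix x :: real
    have "(\<lambda>n. Re (gauss (1 / real (Suc n)) x)) \<longlonglongrightarrow> Re 1" by (intro tendsto_Re gauss_tendsto_1)
    then have lim: "(\<lambda>n. ennreal ((cmod (ft f x))\<^sup>2 * exp (- (1 / real (Suc n) * x)\<^sup>2 / 2))) \<longlonglongrightarrow> ennreal ((cmod (ft f x))\<^sup>2 * 1)"
      by (intro tendsto_ennrealI tendsto_mult tendsto_const) (simp add: gauss_def)
    show "(ennreal (cmod (ft f x)))\<^sup>2 = liminf (\<lambda>n. ennreal ((cmod (ft f x))\<^sup>2 * exp (- (1 / real (Suc n) * x)\<^sup>2 / 2)))"
      using lim_imp_Liminf[OF sequentially_bot lim] by (simp add: ennreal_power)
  qed
  also have "\<dots> \<le> liminf (\<lambda>n. \<integral>\<^sup>+x. ennreal ((cmod (ft f x))\<^sup>2 * exp (- (1 / real (Suc n) * x)\<^sup>2 / 2)) \<partial>lborel)"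
    by (rule nn_integral_liminf) measurable
  also have "\<dots> \<le> liminf (\<lambda>n. ennreal (2 * pi * (l2 f)\<^sup>2))"
    by (intro Liminf_mono always_eventually allI step)
  also have "\<dots> = ennreal ((sqrt (2 * pi) * l2 f)\<^sup>2)"
    by (simp add: Liminf_const power_mult_distrib)
  finally have *: "(\<integral>\<^sup>+x. (ennreal (cmod (ft f x)))\<^sup>2 \<partial>lborel) \<le> ennreal ((sqrt (2 * pi) * l2 f)\<^sup>2)" .
  show "sq_int (ft f)" "l2 (ft f) \<le> sqrt (2 * pi) * l2 f"
    by (rule sq_intI_nn[OF _ *]; simp)+
qed

definition ind :: "real \<Rightarrow> real \<Rightarrow> real \<Rightarrow> complex" where
  "ind a b x = complex_of_real (indicator {a..b} x)"

lemma ind_measurable [measurable]: "ind a b \<in> borel_measurable borel"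
  unfolding ind_def by measurable

lemma ind_le_1: "cmod (ind a b x) \<le> 1" by (simp add: ind_def indicator_def)

lemma integrable_ind: "integrable lborel (ind a b)"
proof -
  have "integrable lborel (indicator {a..b} :: real \<Rightarrow> real)"
    by (intro integrable_real_indicator) (auto simp: emeasure_lborel_Icc_eq)
  then show ?thesis unfolding ind_def[abs_def] by (rule integrable_of_real)
qed

lemma sq_int_ind: "sq_int (ind a b)"
proof -
  have "(cmod (ind a b x))\<^sup>2 = cmod (ind a b x)" for x by (simp add: ind_def indicator_def)
  then show ?thesis using integrable_norm[OF integrable_ind[of a b]] by (simp add: sq_int_def)
qed

text \<open>\<open>gauss_pairing_limit\<close> is applied to the correlation of \<open>f\<close>
  with an indicator: its value at 0 is the integral of \<open>f\<close> over the interval, and it is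
  continuous there by dominated convergence, since the indicator jumps at two points only. Testing
  against intervals avoids pointwise inversion, which fails for a general integrable
  \<open>f\<close>.\<close>

lemma interval_inversion:
  assumes f: "integrable lborel f"
  shows "(\<lambda>n. LINT x|lborel. (cnj (ft (ind a b) x) * ft f x) * gauss (1 / real (Suc n)) x)
    \<longlonglongrightarrow> 2 * pi * (LINT y|lborel. ind a b y * f y)"
proof -
  have [measurable]: "f \<in> borel_measurable borel" by (rule integrable_lborel_measurable[OF f])
  define h where "h x = cnj (ind a b (- x))" for x
  have h: "integrable lborel h"
    unfolding h_def using integrable_ind[of a b] lborel_integrable_real_affine_iff[of "-1" "ind a b" 0] by simp
  let ?k = "cconv h f"
  have k: "integrable lborel ?k" by (rule ft_cconv(1)[OF h f])
  have keq: "?k z = (LINT y|lborel. ind a b (y - z) * f y)" for z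
    unfolding cconv_def h_def by (simp add: ind_def)
  have le: "cmod (ind a b (y - z) * f y) \<le> cmod (f y)" for y z
    using mult_right_mono[OF ind_le_1] by (simp add: norm_mult)
  have int: "integrable lborel (\<lambda>y. ind a b (y - z) * f y)" for z
    by (rule Bochner_Integration.integrable_bound[OF f]) (use le in auto)
  have kB: "cmod (?k z) \<le> l1 f" for z
    unfolding keq l1_def
    by (rule order_trans[OF integral_norm_bound integral_mono]) (use f int le in auto)
  have cont: "isCont ?k 0"
  proof (rule continuous_at_sequentiallyI)
    fix u :: "nat \<Rightarrow> real" assume u: "u \<longlonglongrightarrow> 0"
    show "(\<lambda>n. ?k (u n)) \<longlonglongrightarrow> ?k 0" unfolding keq
    proof (rule integral_dominated_convergence[where w = "\<lambda>y. cmod (f y)"])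
      have "AE y in lborel. y \<noteq> a" "AE y in lborel. y \<noteq> b" by (rule AE_lborel_singleton)+
      then show "AE y in lborel. (\<lambda>n. ind a b (y - u n) * f y) \<longlonglongrightarrow> ind a b (y - 0) * f y"
      proof eventually_elim
        case (elim y)
        have lim: "(\<lambda>n. y - u n) \<longlonglongrightarrow> y" using tendsto_diff[OF tendsto_const u, of y] by simp
        have "eventually (\<lambda>n. ind a b (y - u n) = ind a b y) sequentially"
        proof -
          consider "y < a" | "a < y" "y < b" | "b < y" using elim by linarith
          then show ?thesis
          proof cases
            case 1
            then show ?thesis using order_tendstoD(2)[OF lim 1] by (auto elim!: eventually_mono simp: ind_def indicator_def)
          next
            case 2
            show ?thesis using order_tendstoD(1)[OF lim 2(1)] order_tendstoD(2)[OF lim 2(2)]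
              by eventually_elim (use 2 in \<open>auto simp: ind_def indicator_def\<close>)
          next
            case 3
            then show ?thesis using order_tendstoD(1)[OF lim 3] by (auto elim!: eventually_mono simp: ind_def indicator_def)
          qed
        qed
        then have "(\<lambda>n. ind a b (y - u n)) \<longlonglongrightarrow> ind a b y" by (rule tendsto_eventually)
        then show ?case by (auto intro!: tendsto_intros)
      qed
    qed (use f le in auto)
  qed
  have "ft ?k x = cnj (ft (ind a b) x) * ft f x" for x
    unfolding ft_cconv(2)[OF h f] h_def ft_cnj_reflect ..
  then show ?thesis using gauss_pairing_limit[OF k kB cont] by (simp add: keq)
qed

text \<open>Closed intervals form an intersection-stable generator of the Borel sets, so vanishing
  integrals over them extend to every Borel set by the \<pi>-\<lambda> argument.\<close>

lemma AE_zero_of_intervals: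
  fixes f :: "real \<Rightarrow> complex"
  assumes f: "integrable lborel f" and z: "\<And>a b. (LINT y|lborel. ind a b y * f y) = 0"
  shows "AE x in lborel. f x = 0"
proof (rule sigma_finite_measure.density_zero[OF lborel.sigma_finite_measure_axioms f])
  have [measurable]: "f \<in> borel_measurable borel" by (rule integrable_lborel_measurable[OF f])
  have si: "set_integrable lborel A f" if "A \<in> sets borel" for A
    unfolding set_integrable_def by (rule integrable_mult_indicator) (use that f in auto)
  have Icc: "set_lebesgue_integral lborel {a..b} f = 0" for a b
    using z[of a b] by (simp add: set_lebesgue_integral_def ind_def scaleR_conv_of_real)
  \<comment> \<open>The integral over the whole line starts the complement case of the induction
    below.\<close>
  have whole: "integral\<^sup>L lborel f = 0"
  proof (rule LIMSEQ_unique)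
    show "(\<lambda>n. set_lebesgue_integral lborel {- real n..real n} f) \<longlonglongrightarrow> integral\<^sup>L lborel f"
      unfolding set_lebesgue_integral_def
    proof (rule integral_dominated_convergence[where w = "\<lambda>x. cmod (f x)"])
      show "AE x in lborel. (\<lambda>n. indicator {- real n..real n} x *\<^sub>R f x) \<longlonglongrightarrow> f x"
      proof (intro AE_I2 tendsto_eventually)
        fix x :: real
        obtain N where "\<bar>x\<bar> \<le> real N" using real_arch_simple by blast
        then show "\<forall>\<^sub>F n in sequentially. indicator {- real n..real n} x *\<^sub>R f x = f x"
          by (intro eventually_sequentiallyI[of N]) (auto simp: indicator_def)
      qed
    qed (use f in \<open>auto simp: indicator_def\<close>)
    show "(\<lambda>n. set_lebesgue_integral lborel {- real n..real n} f) \<longlonglongrightarrow> 0" by (simp add: Icc)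
  qed
  let ?E = "range (\<lambda>(a, b). {a..b::real})"
  have E: "sets borel = sigma_sets UNIV ?E"
    by (subst borel_eq_atLeastAtMost) simp
  fix A assume "A \<in> sets (lborel :: real measure)"
  then have AE: "A \<in> sigma_sets UNIV ?E" using E by simp
  have "Int_stable ?E"
  proof (rule Int_stableI)
    fix A B assume "A \<in> ?E" "B \<in> ?E"
    then obtain a b c d where "A = {a..b}" "B = {c..d}" by auto
    then have "A \<inter> B = {max a c..min b d}" by auto
    then show "A \<inter> B \<in> ?E" by auto
  qed
  moreover have "?E \<subseteq> Pow UNIV" by simp
  ultimately show "set_lebesgue_integral lborel A f = 0" using AE
  proof (induction rule: sigma_sets_induct_disjoint[consumes 3, case_names basic empty compl union])
    case (basic A) then show ?case using Icc by auto
  next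
    case empty then show ?case by (simp add: set_lebesgue_integral_def)
  next
    case (compl A)
    then have A: "A \<in> sets borel" using E by simp
    have "set_lebesgue_integral lborel (A \<union> (UNIV - A)) f
        = set_lebesgue_integral lborel A f + set_lebesgue_integral lborel (UNIV - A) f"
      by (rule set_integral_Un) (use A si in auto)
    then show ?case using compl whole by (simp add: set_lebesgue_integral_def)
  next
    case (union A)
    then have A: "A i \<in> sets borel" for i using E by auto
    have "set_lebesgue_integral lborel (\<Union>i. A i) f = (\<Sum>i. set_lebesgue_integral lborel (A i) f)"
      by (rule lebesgue_integral_countable_add) (use union(1) A si in \<open>auto simp: disjoint_family_on_def\<close>)
    then show ?case using union by simp
  qed
qed

text \<open>If the transform vanishes, so do all damped integrals in
  \<open>interval_inversion\<close>, hence all integrals of \<open>f\<close> over intervals. This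
  uniqueness is what determines \<open>hat\<close> up to a null set.\<close>

lemma ft_inj:
  assumes f: "integrable lborel f" and z: "\<And>x. ft f x = 0"
  shows "AE x in lborel. f x = 0"
proof (rule AE_zero_of_intervals[OF f])
  fix a b :: real
  have "(\<lambda>n::nat. 0) \<longlonglongrightarrow> 2 * pi * (LINT y|lborel. ind a b y * f y)"
    using interval_inversion[OF f, of a b] by (simp add: z)
  then show "(LINT y|lborel. ind a b y * f y) = 0"
    using LIMSEQ_unique[OF tendsto_const[of "0::complex" sequentially]] by fastforce
qed

lemma ft_inj_eq:
  assumes f: "integrable lborel f" "integrable lborel g" and z: "\<And>x. ft f x = ft g x"
  shows "AE x in lborel. f x = g x"
  using ft_inj[of "\<lambda>x. f x - g x"] f z by (simp add: ft_diff)

text \<open>For square integrable \<open>f\<close> the product of the two transforms is integrable,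
  so that the damping in \<open>interval_inversion\<close> can be removed by dominated
  convergence.\<close>

lemma interval_Parseval:
  assumes f: "integrable lborel f" and f2: "sq_int f"
  shows "(LINT x|lborel. cnj (ft (ind a b) x) * ft f x) = 2 * pi * (LINT y|lborel. ind a b y * f y)"
proof (rule LIMSEQ_unique[OF _ interval_inversion[OF f, of a b]])
  have [measurable]: "ft (ind a b) \<in> borel_measurable borel" "ft f \<in> borel_measurable borel"
    using f integrable_ind by measurable
  have int: "integrable lborel (\<lambda>x. cnj (ft (ind a b) x) * ft f x)"
    by (intro sq_int_mult sq_int_cnj Plancherel_le f f2 integrable_ind sq_int_ind)
  show "(\<lambda>n. LINT x|lborel. (cnj (ft (ind a b) x) * ft f x) * gauss (1 / real (Suc n)) x)
      \<longlonglongrightarrow> (LINT x|lborel. cnj (ft (ind a b) x) * ft f x)"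
  proof (rule integral_dominated_convergence[where w = "\<lambda>x. cmod (cnj (ft (ind a b) x) * ft f x)"])
    show "AE x in lborel. (\<lambda>n. (cnj (ft (ind a b) x) * ft f x) * gauss (1 / real (Suc n)) x)
        \<longlonglongrightarrow> cnj (ft (ind a b) x) * ft f x"
    proof (rule AE_I2)
      fix x
      show "(\<lambda>n. (cnj (ft (ind a b) x) * ft f x) * gauss (1 / real (Suc n)) x) \<longlonglongrightarrow> cnj (ft (ind a b) x) * ft f x"
        using tendsto_mult[OF tendsto_const gauss_tendsto_1, of "cnj (ft (ind a b) x) * ft f x" x] by simp
    qed
    show "AE x in lborel. cmod ((cnj (ft (ind a b) x) * ft f x) * gauss (1 / real (Suc n)) x)
        \<le> cmod (cnj (ft (ind a b) x) * ft f x)" for n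
      using mult_left_mono[OF norm_gauss_le] by (intro AE_I2) (simp add: norm_mult)
  qed (use int in \<open>auto intro: integrable_norm\<close>)
qed

subsection \<open>Completeness of $L^2$\<close>

lemma l2_zero_AE:
  assumes "sq_int F" "l2 F = 0" shows "AE x in lborel. F x = 0"
proof -
  have "(LINT x|lborel. (cmod (F x))\<^sup>2) = 0" using assms(2) l2_power2[of F] by simp
  then have "AE x in lborel. (cmod (F x))\<^sup>2 = 0"
    using assms(1) by (subst (asm) integral_nonneg_eq_0_iff_AE) (auto simp: sq_int_def)
  then show ?thesis by eventually_elim simp
qed

text \<open>The Riesz-Fischer argument with a rapidly convergent subsequence of increments
  \<open>d j\<close>. Weighting their squares by \<open>2 ^ j\<close> leaves a finite integral, so
  for almost every \<open>x\<close> the increments are bounded by a multiple of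
  \<open>sqrt (1/2) ^ j\<close>, and the subsequence converges there.\<close>

lemma sq_int_complete:
  assumes F: "\<And>n. sq_int (F n)"
    and Cau: "\<And>e. e > 0 \<Longrightarrow> \<exists>N. \<forall>m\<ge>N. \<forall>n\<ge>N. l2 (\<lambda>x. F m x - F n x) < e"
  shows "\<exists>g. sq_int g \<and> (\<lambda>n. l2 (\<lambda>x. g x - F n x)) \<longlonglongrightarrow> 0"
proof -
  have [measurable]: "F n \<in> borel_measurable borel" for n using F[of n] by auto
  have sd: "sq_int (\<lambda>x. F m x - F n x)" for m n by (rule sq_int_diff[OF F F])
  have "\<forall>j. \<exists>N. \<forall>m\<ge>N. \<forall>n\<ge>N. l2 (\<lambda>x. F m x - F n x) < (1/2) ^ j"
    by (intro allI Cau) simp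
  then obtain N where N: "\<And>j m n. m \<ge> N j \<Longrightarrow> n \<ge> N j \<Longrightarrow> l2 (\<lambda>x. F m x - F n x) < (1/2) ^ j"
    by metis
  \<comment> \<open>\<open>N\<close> itself need not be monotone; the running sums plus
    \<open>j\<close> give nondecreasing indices with \<open>r j\<close> at least \<open>N j\<close>
    and at least \<open>j\<close>.\<close>
  define r where "r j = (\<Sum>i\<le>j. N i) + j" for j
  have rN: "N j \<le> r j" for j
    unfolding r_def by (rule trans_le_add1, rule member_le_sum) auto
  have rmono: "r j \<le> r (Suc j)" for j by (simp add: r_def)
  have rge: "j \<le> r j" for j by (simp add: r_def)
  define d where "d j x = F (r (Suc j)) x - F (r j) x" for j x
  have [measurable]: "d j \<in> borel_measurable borel" for j unfolding d_def by measurable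
  have sqd: "sq_int (d j)" for j unfolding d_def by (rule sd)
  have ld: "l2 (d j) \<le> (1/2) ^ j" for j
    unfolding d_def using N[of j "r (Suc j)" "r j"] rN[of j] rmono[of j] by simp
  have "(\<integral>\<^sup>+x. (\<Sum>j. ennreal (2 ^ j) * (ennreal (cmod (d j x)))\<^sup>2) \<partial>lborel)
      = (\<Sum>j. \<integral>\<^sup>+x. ennreal (2 ^ j) * (ennreal (cmod (d j x)))\<^sup>2 \<partial>lborel)"
    by (rule nn_integral_suminf) measurable
  also have "\<dots> = (\<Sum>j. ennreal (2 ^ j * (l2 (d j))\<^sup>2))"
    by (simp add: nn_integral_cmult nn_l2[OF sqd] ennreal_mult)
  also have "\<dots> \<le> (\<Sum>j. ennreal ((1/2) ^ j))"
  proof (intro suminf_le ennreal_leI)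
    fix j
    have "2 ^ j * (l2 (d j))\<^sup>2 \<le> 2 ^ j * ((1/2) ^ j)\<^sup>2"
      by (intro mult_left_mono power_mono ld) auto
    also have "\<dots> = (2 * (1/4)) ^ j"
      unfolding power2_eq_square power_mult_distrib[symmetric] by simp
    finally show "2 ^ j * (l2 (d j))\<^sup>2 \<le> (1/2) ^ j" by simp
  qed auto
  also have "\<dots> = ennreal (\<Sum>j. (1/2) ^ j)"
    by (rule suminf_ennreal2) (auto intro: summable_geometric)
  also have "\<dots> < \<infinity>" by simp
  finally have "AE x in lborel. (\<Sum>j. ennreal (2 ^ j) * (ennreal (cmod (d j x)))\<^sup>2) \<noteq> \<infinity>"
    by (intro nn_integral_PInf_AE) auto
  then have conv: "AE x in lborel. convergent (\<lambda>j. F (r j) x)"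
  proof eventually_elim
    case (elim x)
    define S where "S = enn2real (\<Sum>j. ennreal (2 ^ j) * (ennreal (cmod (d j x)))\<^sup>2)"
    have S: "(\<Sum>j. ennreal (2 ^ j) * (ennreal (cmod (d j x)))\<^sup>2) = ennreal S"
      unfolding S_def using elim by (simp add: less_top)
    have S0: "0 \<le> S" by (simp add: S_def)
    have dle: "cmod (d j x) \<le> sqrt S * (sqrt (1/2)) ^ j" for j
    proof -
      have "ennreal (2 ^ j) * (ennreal (cmod (d j x)))\<^sup>2 \<le> ennreal S"
        unfolding S[symmetric]
        using sum_le_suminf[of "\<lambda>j. ennreal (2 ^ j) * (ennreal (cmod (d j x)))\<^sup>2" "{j}"] by simp
      then have "ennreal (2 ^ j * (cmod (d j x))\<^sup>2) \<le> ennreal S"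
        by (simp add: ennreal_power ennreal_mult)
      then have "2 ^ j * (cmod (d j x))\<^sup>2 \<le> S" using S0 by (simp add: ennreal_le_iff)
      then have "(cmod (d j x))\<^sup>2 \<le> S * (1/2) ^ j"
        by (simp add: power_one_over field_simps)
      then have "cmod (d j x) \<le> sqrt (S * (1/2) ^ j)" by (rule real_le_rsqrt)
      then show ?thesis by (simp add: real_sqrt_mult real_sqrt_power)
    qed
    moreover have "summable (\<lambda>j. sqrt S * (sqrt (1/2)) ^ j)"
    proof (intro summable_mult summable_geometric)
      have "sqrt (1/2) < sqrt 1" by (subst real_sqrt_less_iff) simp
      then show "norm (sqrt (1/2) :: real) < 1" by simp
    qed
    ultimately have "summable (\<lambda>j. d j x)"
      using summable_comparison_test'[of "\<lambda>j. sqrt S * (sqrt (1/2)) ^ j" 0 "\<lambda>j. d j x"] dle by simp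
    then have "convergent (\<lambda>n. \<Sum>j<n. d j x)" by (simp add: summable_iff_convergent)
    moreover have "(\<Sum>j<n. d j x) = F (r n) x - F (r 0) x" for n
      unfolding d_def by (rule sum_lessThan_telescope)
    ultimately have "convergent (\<lambda>n. F (r n) x - F (r 0) x)" by simp
    then have "convergent (\<lambda>n. F (r n) x - F (r 0) x + F (r 0) x)"
      by (rule convergent_add[OF _ convergent_const])
    then show ?case by simp
  qed
  define g where "g x = lim (\<lambda>j. F (r j) x)" for x
  have [measurable]: "g \<in> borel_measurable borel"
    unfolding g_def by (rule borel_measurable_lim_metric) measurable
  have gl: "AE x in lborel. (\<lambda>j. F (r j) x) \<longlonglongrightarrow> g x"
    using conv by eventually_elim (simp add: g_def convergent_LIMSEQ_iff)
  \<comment> \<open>Fatou's lemma along the subsequence controls the distance of the pointwise limit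
    from every late member of the original sequence.\<close>
  have main: "sq_int (\<lambda>x. g x - F n x) \<and> l2 (\<lambda>x. g x - F n x) \<le> e"
    if e: "e > 0" and M: "\<forall>m\<ge>M. \<forall>n\<ge>M. l2 (\<lambda>x. F m x - F n x) < e" and n: "n \<ge> M" for e M n
  proof -
    have "(\<integral>\<^sup>+x. (ennreal (cmod (g x - F n x)))\<^sup>2 \<partial>lborel)
        = (\<integral>\<^sup>+x. liminf (\<lambda>j. (ennreal (cmod (F (r j) x - F n x)))\<^sup>2) \<partial>lborel)"
    proof (intro nn_integral_cong_AE)
      show "AE x in lborel. (ennreal (cmod (g x - F n x)))\<^sup>2 = liminf (\<lambda>j. (ennreal (cmod (F (r j) x - F n x)))\<^sup>2)"
        using gl
      proof eventually_elim
        case (elim x)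
        have "(\<lambda>j. ennreal ((cmod (F (r j) x - F n x))\<^sup>2)) \<longlonglongrightarrow> ennreal ((cmod (g x - F n x))\<^sup>2)"
          by (intro tendsto_intros elim)
        from lim_imp_Liminf[OF sequentially_bot this] show ?case by (simp add: ennreal_power)
      qed
    qed
    also have "\<dots> \<le> liminf (\<lambda>j. \<integral>\<^sup>+x. (ennreal (cmod (F (r j) x - F n x)))\<^sup>2 \<partial>lborel)"
      by (rule nn_integral_liminf) measurable
    also have "\<dots> \<le> liminf (\<lambda>j. ennreal (e\<^sup>2))"
    proof (intro Liminf_mono eventually_sequentiallyI[of M])
      fix j assume "j \<ge> M"
      then have "r j \<ge> M" using rge[of j] by simp
      then have "l2 (\<lambda>x. F (r j) x - F n x) \<le> e" using M n less_imp_le by blast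
      then show "(\<integral>\<^sup>+x. (ennreal (cmod (F (r j) x - F n x)))\<^sup>2 \<partial>lborel) \<le> ennreal (e\<^sup>2)"
        unfolding nn_l2[OF sd] by (intro ennreal_leI power_mono) auto
    qed
    also have "\<dots> = ennreal (e\<^sup>2)" by (simp add: Liminf_const)
    finally have *: "(\<integral>\<^sup>+x. (ennreal (cmod (g x - F n x)))\<^sup>2 \<partial>lborel) \<le> ennreal (e\<^sup>2)" .
    show ?thesis using sq_intI_nn[OF _ *] e by simp
  qed
  obtain M0 where "\<forall>m\<ge>M0. \<forall>n\<ge>M0. l2 (\<lambda>x. F m x - F n x) < 1" using Cau[of 1] by auto
  from main[OF _ this order_refl] have "sq_int (\<lambda>x. g x - F M0 x)" by simp
  from sq_int_add(1)[OF this F[of M0]] have "sq_int g" by simp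
  moreover have "(\<lambda>n. l2 (\<lambda>x. g x - F n x)) \<longlonglongrightarrow> 0"
  proof (rule LIMSEQ_I)
    fix e :: real assume "0 < e"
    then have e2: "e / 2 > 0" by simp
    obtain M where M: "\<forall>m\<ge>M. \<forall>n\<ge>M. l2 (\<lambda>x. F m x - F n x) < e / 2" using Cau[OF e2] by auto
    have "norm (l2 (\<lambda>x. g x - F n x) - 0) < e" if "n \<ge> M" for n
      using main[OF e2 M that] \<open>0 < e\<close> by simp
    then show "\<exists>no. \<forall>n\<ge>no. norm (l2 (\<lambda>x. g x - F n x) - 0) < e" by blast
  qed
  ultimately show ?thesis by blast
qed

subsection \<open>The Fourier transform on $L^2$\<close>

definition trunc :: "nat \<Rightarrow> (real \<Rightarrow> real) \<Rightarrow> real \<Rightarrow> complex" where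
  "trunc n u x = ind (- real n) (real n) x * complex_of_real (u x)"

lemma L2_fun_sq_int: "L2_fun u \<longleftrightarrow> u \<in> borel_measurable borel \<and> sq_int (\<lambda>x. complex_of_real (u x))"
  unfolding L2_fun_def sq_int_def by auto

lemma ind_mult_sq_int:
  assumes "sq_int f" shows "integrable lborel (\<lambda>x. ind a b x * f x)" "sq_int (\<lambda>x. ind a b x * f x)"
proof -
  have [measurable]: "f \<in> borel_measurable borel" using assms by auto
  show "integrable lborel (\<lambda>x. ind a b x * f x)" by (rule sq_int_mult[OF sq_int_ind assms])
  have "cmod (ind a b x * f x) \<le> 1 * cmod (f x)" for x
    using mult_right_mono[OF ind_le_1, of "cmod (f x)" a b x] by (simp add: norm_mult)
  then show "sq_int (\<lambda>x. ind a b x * f x)"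
    by (intro sq_int_bound(1)[OF assms, of _ 1]) auto
qed

lemma trunc_int:
  assumes "L2_fun u" shows "integrable lborel (trunc n u)" "sq_int (trunc n u)"
  using ind_mult_sq_int assms unfolding trunc_def[abs_def] L2_fun_sq_int by auto

lemma truncated_fourier_eq: "truncated_fourier n u \<xi> = ft (trunc n u) (- \<xi>)"
  unfolding truncated_fourier_def set_lebesgue_integral_def ft_def trunc_def
  by (intro Bochner_Integration.integral_cong refl) (simp add: ind_def indicator_def mult.commute)

lemma sq_int_truncated_fourier:
  assumes u: "L2_fun u" shows "sq_int (truncated_fourier n u)"
  using sq_int_reflect[OF Plancherel_le(1)[OF trunc_int(1)[OF u, of n] trunc_int(2)[OF u, of n]], of 0]
  unfolding truncated_fourier_eq[abs_def] by simp

lemma truncated_fourier_diff_le: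
  assumes u: "L2_fun u"
  shows "l2 (\<lambda>\<xi>. truncated_fourier m u \<xi> - truncated_fourier n u \<xi>) \<le> sqrt (2 * pi) * l2 (\<lambda>x. trunc m u x - trunc n u x)"
proof -
  let ?f = "\<lambda>x. trunc m u x - trunc n u x"
  have i: "integrable lborel ?f" and s: "sq_int ?f"
    using trunc_int[OF u] by (auto intro: sq_int_diff)
  have "(\<lambda>\<xi>. truncated_fourier m u \<xi> - truncated_fourier n u \<xi>) = (\<lambda>\<xi>. ft ?f (0 - \<xi>))"
    by (simp add: truncated_fourier_eq ft_diff trunc_int[OF u])
  then show ?thesis
    using Plancherel_le(2)[OF i s] l2_reflect[OF Plancherel_le(1)[OF i s], of 0] by simp
qed

lemma trunc_Cauchy:
  assumes u: "L2_fun u" and e: "e > 0"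
  shows "\<exists>N. \<forall>m\<ge>N. \<forall>n\<ge>N. l2 (\<lambda>x. trunc m u x - trunc n u x) < e"
proof -
  have uc: "sq_int (\<lambda>x. complex_of_real (u x))" and [measurable]: "u \<in> borel_measurable borel"
    using u by (auto simp: L2_fun_sq_int)
  let ?R = "\<lambda>n x. complex_of_real (u x) - trunc n u x"
  have R: "sq_int (?R n)" for n by (rule sq_int_diff(1)[OF uc trunc_int(2)[OF u]])
  have "(\<lambda>n. LINT x|lborel. (cmod (?R n x))\<^sup>2) \<longlonglongrightarrow> integral\<^sup>L (lborel :: real measure) (\<lambda>x. 0::real)"
  proof (rule integral_dominated_convergence[where w = "\<lambda>x. (u x)\<^sup>2" and f = "\<lambda>x. 0" and s = "\<lambda>n x. (cmod (?R n x))\<^sup>2"])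
    show "(\<lambda>x. (cmod (?R n x))\<^sup>2) \<in> borel_measurable lborel" for n
      using R[of n] by (auto simp: sq_int_def)
    show "integrable lborel (\<lambda>x. (u x)\<^sup>2)" using u by (simp add: L2_fun_def)
    show "AE x in lborel. (\<lambda>n. (cmod (?R n x))\<^sup>2) \<longlonglongrightarrow> 0"
    proof (intro AE_I2 tendsto_eventually)
      fix x :: real
      obtain N where "\<bar>x\<bar> \<le> real N" using real_arch_simple by blast
      then show "\<forall>\<^sub>F n in sequentially. (cmod (?R n x))\<^sup>2 = 0"
        by (intro eventually_sequentiallyI[of N]) (auto simp: trunc_def ind_def indicator_def)
    qed
    show "AE x in lborel. norm ((cmod (?R n x))\<^sup>2) \<le> (u x)\<^sup>2" for n
      by (intro AE_I2) (simp add: trunc_def ind_def indicator_def)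
  qed simp
  then have "(\<lambda>n. sqrt (LINT x|lborel. (cmod (?R n x))\<^sup>2)) \<longlonglongrightarrow> sqrt 0"
    by (intro tendsto_real_sqrt) simp
  then have "(\<lambda>n. l2 (?R n)) \<longlonglongrightarrow> 0" by (simp add: l2_def)
  then obtain N where N: "\<And>n. n \<ge> N \<Longrightarrow> l2 (?R n) < e / 2"
    using e by (force dest: LIMSEQ_D[of _ _ "e / 2"])
  have "l2 (\<lambda>x. trunc m u x - trunc n u x) < e" if "m \<ge> N" "n \<ge> N" for m n
  proof -
    have "l2 (\<lambda>x. ?R n x - ?R m x) \<le> l2 (?R n) + l2 (?R m)" by (rule sq_int_diff(2)[OF R R])
    moreover have "(\<lambda>x. ?R n x - ?R m x) = (\<lambda>x. trunc m u x - trunc n u x)" by auto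
    ultimately show ?thesis using N[OF that(1)] N[OF that(2)] by simp
  qed
  then show ?thesis by blast
qed

lemma is_fourier_iff:
  assumes u: "L2_fun u"
  shows "is_fourier u g \<longleftrightarrow> sq_int g \<and> (\<lambda>n. l2 (\<lambda>\<xi>. g \<xi> - truncated_fourier n u \<xi>)) \<longlonglongrightarrow> 0"
proof -
  have "(\<lambda>n. \<integral>\<^sup>+\<xi>. ennreal ((cmod (g \<xi> - truncated_fourier n u \<xi>))\<^sup>2) \<partial>lborel) \<longlonglongrightarrow> 0
      \<longleftrightarrow> (\<lambda>n. l2 (\<lambda>\<xi>. g \<xi> - truncated_fourier n u \<xi>)) \<longlonglongrightarrow> 0" if g: "sq_int g"
  proof -
    have eq: "(\<integral>\<^sup>+\<xi>. ennreal ((cmod (g \<xi> - truncated_fourier n u \<xi>))\<^sup>2) \<partial>lborel)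
        = ennreal ((l2 (\<lambda>\<xi>. g \<xi> - truncated_fourier n u \<xi>))\<^sup>2)" for n
      unfolding nn_l2[OF sq_int_diff(1)[OF g sq_int_truncated_fourier[OF u]], symmetric]
      by (simp add: ennreal_power)
    have "(\<lambda>n. ennreal ((l2 (\<lambda>\<xi>. g \<xi> - truncated_fourier n u \<xi>))\<^sup>2)) \<longlonglongrightarrow> ennreal 0
      \<longleftrightarrow> (\<lambda>n. (l2 (\<lambda>\<xi>. g \<xi> - truncated_fourier n u \<xi>))\<^sup>2) \<longlonglongrightarrow> 0"
      by (rule tendsto_ennreal_iff) auto
    also have "\<dots> \<longleftrightarrow> (\<lambda>n. l2 (\<lambda>\<xi>. g \<xi> - truncated_fourier n u \<xi>)) \<longlonglongrightarrow> 0"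
    proof
      assume "(\<lambda>n. (l2 (\<lambda>\<xi>. g \<xi> - truncated_fourier n u \<xi>))\<^sup>2) \<longlonglongrightarrow> 0"
      from tendsto_real_sqrt[OF this] show "(\<lambda>n. l2 (\<lambda>\<xi>. g \<xi> - truncated_fourier n u \<xi>)) \<longlonglongrightarrow> 0" by simp
    next
      assume "(\<lambda>n. l2 (\<lambda>\<xi>. g \<xi> - truncated_fourier n u \<xi>)) \<longlonglongrightarrow> 0"
      from tendsto_power[OF this, of 2] show "(\<lambda>n. (l2 (\<lambda>\<xi>. g \<xi> - truncated_fourier n u \<xi>))\<^sup>2) \<longlonglongrightarrow> 0" by simp
    qed
    finally show ?thesis unfolding eq by simp
  qed
  then show ?thesis unfolding is_fourier_def sq_int_def by auto
qed

lemma is_fourier_exists: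
  assumes u: "L2_fun u" shows "is_fourier u (fourier u)"
proof -
  have "\<exists>g. sq_int g \<and> (\<lambda>n. l2 (\<lambda>x. g x - truncated_fourier n u x)) \<longlonglongrightarrow> 0"
  proof (rule sq_int_complete[OF sq_int_truncated_fourier[OF u]])
    fix e :: real assume "e > 0"
    then have "e / sqrt (2 * pi) > 0" by simp
    from trunc_Cauchy[OF u this] obtain N where
      N: "\<forall>m\<ge>N. \<forall>n\<ge>N. l2 (\<lambda>x. trunc m u x - trunc n u x) < e / sqrt (2 * pi)" by blast
    have "l2 (\<lambda>\<xi>. truncated_fourier m u \<xi> - truncated_fourier n u \<xi>) < e" if "m \<ge> N" "n \<ge> N" for m n
    proof -
      have "l2 (\<lambda>x. trunc m u x - trunc n u x) < e / sqrt (2 * pi)" using N that by blast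
      then have "sqrt (2 * pi) * l2 (\<lambda>x. trunc m u x - trunc n u x) < e" by (simp add: field_simps)
      then show ?thesis using truncated_fourier_diff_le[OF u, of m n] by linarith
    qed
    then show "\<exists>N. \<forall>m\<ge>N. \<forall>n\<ge>N. l2 (\<lambda>\<xi>. truncated_fourier m u \<xi> - truncated_fourier n u \<xi>) < e" by blast
  qed
  then show ?thesis unfolding fourier_def is_fourier_iff[OF u, symmetric] by (rule someI_ex)
qed

lemma is_fourier_unique:
  assumes u: "L2_fun u" and g: "is_fourier u g" and h: "is_fourier u h"
  shows "AE \<xi> in lborel. g \<xi> = h \<xi>"
proof -
  have gs: "sq_int g" and gl: "(\<lambda>n. l2 (\<lambda>\<xi>. g \<xi> - truncated_fourier n u \<xi>)) \<longlonglongrightarrow> 0"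
    and hs: "sq_int h" and hl: "(\<lambda>n. l2 (\<lambda>\<xi>. h \<xi> - truncated_fourier n u \<xi>)) \<longlonglongrightarrow> 0"
    using g h by (auto simp: is_fourier_iff[OF u])
  have le: "l2 (\<lambda>\<xi>. g \<xi> - h \<xi>) \<le> l2 (\<lambda>\<xi>. g \<xi> - truncated_fourier n u \<xi>) + l2 (\<lambda>\<xi>. h \<xi> - truncated_fourier n u \<xi>)" for n
    using sq_int_diff(2)[OF sq_int_diff(1)[OF gs sq_int_truncated_fourier[OF u, of n]] sq_int_diff(1)[OF hs sq_int_truncated_fourier[OF u, of n]]]
    by simp
  have "l2 (\<lambda>\<xi>. g \<xi> - h \<xi>) \<le> 0 + 0"
    by (rule LIMSEQ_le_const[OF tendsto_add[OF gl hl]]) (use le in blast)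
  then have "l2 (\<lambda>\<xi>. g \<xi> - h \<xi>) = 0" using l2_nonneg[of "\<lambda>\<xi>. g \<xi> - h \<xi>"] by linarith
  from l2_zero_AE[OF sq_int_diff(1)[OF gs hs] this] show ?thesis by eventually_elim simp
qed

lemma is_fourier_lin:
  assumes u: "L2_fun u" and v: "L2_fun v" and g: "is_fourier u g" and h: "is_fourier v h"
  shows "L2_fun (\<lambda>x. a * u x + b * v x)"
    and "is_fourier (\<lambda>x. a * u x + b * v x) (\<lambda>\<xi>. complex_of_real a * g \<xi> + complex_of_real b * h \<xi>)"
proof -
  let ?a = "complex_of_real a" and ?b = "complex_of_real b" and ?w = "\<lambda>x. a * u x + b * v x"
  show w: "L2_fun ?w"
    using u v sq_int_add(1)[OF sq_int_scale(1)[of _ ?a] sq_int_scale(1)[of _ ?b]]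
    by (auto simp: L2_fun_sq_int)
  have gs: "sq_int g" and gl: "(\<lambda>n. l2 (\<lambda>\<xi>. g \<xi> - truncated_fourier n u \<xi>)) \<longlonglongrightarrow> 0"
    and hs: "sq_int h" and hl: "(\<lambda>n. l2 (\<lambda>\<xi>. h \<xi> - truncated_fourier n v \<xi>)) \<longlonglongrightarrow> 0"
    using g h by (auto simp: is_fourier_iff[OF u] is_fourier_iff[OF v])
  have T: "truncated_fourier n ?w \<xi> = ?a * truncated_fourier n u \<xi> + ?b * truncated_fourier n v \<xi>" for n \<xi>
  proof -
    have "trunc n ?w = (\<lambda>x. ?a * trunc n u x + ?b * trunc n v x)"
      by (auto simp: trunc_def algebra_simps)
    then show ?thesis
      using ft_add[of "\<lambda>x. ?a * trunc n u x" "\<lambda>x. ?b * trunc n v x"] trunc_int[OF u] trunc_int[OF v]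
      by (simp add: truncated_fourier_eq ft_scale)
  qed
  have sg: "sq_int (\<lambda>\<xi>. g \<xi> - truncated_fourier n u \<xi>)" for n by (rule sq_int_diff(1)[OF gs sq_int_truncated_fourier[OF u]])
  have sh: "sq_int (\<lambda>\<xi>. h \<xi> - truncated_fourier n v \<xi>)" for n by (rule sq_int_diff(1)[OF hs sq_int_truncated_fourier[OF v]])
  have le: "l2 (\<lambda>\<xi>. (?a * g \<xi> + ?b * h \<xi>) - truncated_fourier n ?w \<xi>)
      \<le> \<bar>a\<bar> * l2 (\<lambda>\<xi>. g \<xi> - truncated_fourier n u \<xi>) + \<bar>b\<bar> * l2 (\<lambda>\<xi>. h \<xi> - truncated_fourier n v \<xi>)" for n
  proof -
    have "(\<lambda>\<xi>. (?a * g \<xi> + ?b * h \<xi>) - truncated_fourier n ?w \<xi>)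
        = (\<lambda>\<xi>. ?a * (g \<xi> - truncated_fourier n u \<xi>) + ?b * (h \<xi> - truncated_fourier n v \<xi>))"
      by (auto simp: T algebra_simps)
    then show ?thesis
      using sq_int_add(2)[OF sq_int_scale(1)[OF sg, of ?a n] sq_int_scale(1)[OF sh, of ?b n]]
      by (simp add: sq_int_scale(2)[OF sg] sq_int_scale(2)[OF sh])
  qed
  have "(\<lambda>n. \<bar>a\<bar> * l2 (\<lambda>\<xi>. g \<xi> - truncated_fourier n u \<xi>) + \<bar>b\<bar> * l2 (\<lambda>\<xi>. h \<xi> - truncated_fourier n v \<xi>)) \<longlonglongrightarrow> \<bar>a\<bar> * 0 + \<bar>b\<bar> * 0"
    by (intro tendsto_add tendsto_mult tendsto_const gl hl)
  then have lim: "(\<lambda>n. \<bar>a\<bar> * l2 (\<lambda>\<xi>. g \<xi> - truncated_fourier n u \<xi>) + \<bar>b\<bar> * l2 (\<lambda>\<xi>. h \<xi> - truncated_fourier n v \<xi>)) \<longlonglongrightarrow> 0" by simp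
  have "(\<lambda>n. l2 (\<lambda>\<xi>. (?a * g \<xi> + ?b * h \<xi>) - truncated_fourier n ?w \<xi>)) \<longlonglongrightarrow> 0"
    by (rule tendsto_sandwich[OF _ _ tendsto_const[of 0] lim]) (use le in simp_all)
  then show "is_fourier ?w (\<lambda>\<xi>. ?a * g \<xi> + ?b * h \<xi>)"
    unfolding is_fourier_iff[OF w] by (intro conjI sq_int_add(1) sq_int_scale(1) gs hs)
qed

lemma fourier_lin:
  assumes u: "L2_fun u" and v: "L2_fun v"
  shows "AE \<xi> in lborel. fourier (\<lambda>x. a * u x + b * v x) \<xi> = complex_of_real a * fourier u \<xi> + complex_of_real b * fourier v \<xi>"
  using is_fourier_unique[OF is_fourier_lin(1)[OF u v is_fourier_exists[OF u] is_fourier_exists[OF v]]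
      is_fourier_exists[OF is_fourier_lin(1)[OF u v is_fourier_exists[OF u] is_fourier_exists[OF v]]]
      is_fourier_lin(2)[OF u v is_fourier_exists[OF u] is_fourier_exists[OF v]]] .

lemma fourier_cong_AE:
  assumes [measurable]: "u \<in> borel_measurable borel" "v \<in> borel_measurable borel"
    and "AE x in lborel. u x = v x"
  shows "fourier u = fourier v"
proof -
  have "truncated_fourier n u \<xi> = truncated_fourier n v \<xi>" for n \<xi>
    unfolding truncated_fourier_eq
    using assms(3) by (intro ft_cong_AE) (auto simp: trunc_def[abs_def])
  then have "is_fourier u = is_fourier v" by (simp add: is_fourier_def[abs_def])
  then show ?thesis by (simp add: fourier_def)
qed

lemma sq_int_fourier: "L2_fun u \<Longrightarrow> sq_int (fourier u)"
  using is_fourier_exists is_fourier_iff by blast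

text \<open>Both sides have the same integral over every interval: the truncated transforms are
  paired with the transform of an indicator, where \<open>interval_Parseval\<close> applies, and the
  \<open>L^2\<close> limit is taken.\<close>

lemma fourier_inversion:
  assumes u: "L2_fun u" and i: "integrable lborel (fourier u)"
  shows "AE x in lborel. complex_of_real (u x) = ft (fourier u) x / (2 * pi)"
proof -
  let ?g = "fourier u"
  have gs: "sq_int ?g" and gl: "(\<lambda>n. l2 (\<lambda>\<xi>. ?g \<xi> - truncated_fourier n u \<xi>)) \<longlonglongrightarrow> 0"
    using is_fourier_exists[OF u] by (auto simp: is_fourier_iff[OF u])
  have uc: "sq_int (\<lambda>x. complex_of_real (u x))" and [measurable]: "u \<in> borel_measurable borel"
    using u by (auto simp: L2_fun_sq_int)
  have [measurable]: "ft ?g \<in> borel_measurable borel" using i by measurable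
  have key: "(LINT x|lborel. ind a b x * ft ?g x) = 2 * pi * (LINT x|lborel. ind a b x * u x)" for a b
  proof -
    let ?k = "ft (ind a b)"
    have ks: "sq_int ?k" by (rule Plancherel_le(1)[OF integrable_ind sq_int_ind])
    have 1: "(LINT x|lborel. ?k x * truncated_fourier n u x) = 2 * pi * (LINT y|lborel. ind a b y * trunc n u y)" for n
    proof -
      have "(LINT x|lborel. ?k x * truncated_fourier n u x) = (LINT x|lborel. cnj (?k x) * ft (trunc n u) x)"
      proof -
        have "?k (- x) = cnj (?k x)" for x
          unfolding ft_cnj_reflect[of "ind a b", symmetric] unfolding ft_def
          by (subst lborel_integral_real_affine[of "-1" _ 0]) (simp_all add: ind_def)
        then show ?thesis unfolding truncated_fourier_eq
          by (subst lborel_integral_real_affine[of "-1" _ 0]) simp_all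
      qed
      then show ?thesis using interval_Parseval[OF trunc_int[OF u]] by simp
    qed
    have "(\<lambda>n. LINT x|lborel. ?k x * truncated_fourier n u x) \<longlonglongrightarrow> (LINT x|lborel. ?k x * ?g x)"
    proof (rule Lim_transform2[OF tendsto_const], rule tendsto_norm_zero_cancel, rule tendsto_sandwich[OF _ _ tendsto_const[of 0]])
      have "cmod ((LINT x|lborel. ?k x * ?g x) - (LINT x|lborel. ?k x * truncated_fourier n u x))
          \<le> l2 ?k * l2 (\<lambda>\<xi>. ?g \<xi> - truncated_fourier n u \<xi>)" for n
      proof -
        have "(LINT x|lborel. ?k x * ?g x) - (LINT x|lborel. ?k x * truncated_fourier n u x)
            = (LINT x|lborel. ?k x * (?g x - truncated_fourier n u x))"
          unfolding right_diff_distrib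
          by (rule Bochner_Integration.integral_diff[symmetric]) (intro sq_int_mult ks gs sq_int_truncated_fourier u)+
        then show ?thesis using Cauchy_Schwarz_norm[OF ks sq_int_diff(1)[OF gs sq_int_truncated_fourier[OF u, of n]]] by simp
      qed
      then show "\<forall>\<^sub>F n in sequentially. cmod ((LINT x|lborel. ?k x * ?g x) - (LINT x|lborel. ?k x * truncated_fourier n u x))
          \<le> l2 ?k * l2 (\<lambda>\<xi>. ?g \<xi> - truncated_fourier n u \<xi>)" by simp
      show "(\<lambda>n. l2 ?k * l2 (\<lambda>\<xi>. ?g \<xi> - truncated_fourier n u \<xi>)) \<longlonglongrightarrow> 0"
        using tendsto_mult[OF tendsto_const gl] by simp
    qed simp
    \<comment> \<open>As soon as \<open>{- real n..real n}\<close> contains \<open>{a..b}\<close>,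
      the truncation is invisible to the indicator and the sequence is constant.\<close>
    moreover have "(\<lambda>n. LINT x|lborel. ?k x * truncated_fourier n u x) \<longlonglongrightarrow> 2 * pi * (LINT x|lborel. ind a b x * u x)"
    proof (rule tendsto_eventually)
      obtain N where N: "max \<bar>a\<bar> \<bar>b\<bar> \<le> real N" using real_arch_simple by blast
      show "\<forall>\<^sub>F n in sequentially. (LINT x|lborel. ?k x * truncated_fourier n u x) = 2 * pi * (LINT x|lborel. ind a b x * u x)"
      proof (rule eventually_sequentiallyI[of N])
        fix n assume "N \<le> n"
        then have eq: "ind a b y * trunc n u y = ind a b y * u y" for y
          using N by (auto simp: trunc_def ind_def indicator_def)
        show "(LINT x|lborel. ?k x * truncated_fourier n u x) = 2 * pi * (LINT x|lborel. ind a b x * u x)"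
          by (simp only: 1 eq)
      qed
    qed
    ultimately have "(LINT x|lborel. ?k x * ?g x) = 2 * pi * (LINT x|lborel. ind a b x * u x)"
      by (rule LIMSEQ_unique)
    then show ?thesis using ft_multiplication[OF integrable_ind i, of a b] by simp
  qed
  \<comment> \<open>Neither \<open>u\<close> nor \<open>ft ?g\<close> has to be integrable on the
    line, so the two are compared on one bounded interval at a time.\<close>
  have "AE x in lborel. \<forall>n::nat. ind (- real n) (real n) x * (ft ?g x / (2 * pi) - u x) = 0"
    unfolding AE_all_countable
  proof
    fix n :: nat
    let ?f = "\<lambda>x. ind (- real n) (real n) x * (ft ?g x / (2 * pi) - u x)"
    have i1: "integrable lborel (\<lambda>x. ind a b x * ft ?g x)" for a b
    proof (rule Bochner_Integration.integrable_bound)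
      show "integrable lborel (\<lambda>x. l1 ?g * cmod (ind a b x))" using integrable_norm[OF integrable_ind] by simp
      show "AE x in lborel. norm (ind a b x * ft ?g x) \<le> norm (l1 ?g * cmod (ind a b x))"
        by (intro AE_I2) (auto simp: norm_mult abs_mult mult.commute intro!: mult_right_mono cmod_ft_le[OF i])
    qed measurable
    have i2: "integrable lborel (\<lambda>x. ind a b x * u x)" for a b by (rule ind_mult_sq_int(1)[OF uc])
    have dist: "ind a b x * (ft ?g x / (2 * pi) - u x) = ind a b x * ft ?g x / (2 * pi) - ind a b x * u x" for a b x
      by (simp add: right_diff_distrib)
    show "AE x in lborel. ?f x = 0"
    proof (rule AE_zero_of_intervals)
      show "integrable lborel ?f" unfolding dist using i1 i2 by (intro Bochner_Integration.integrable_diff integrable_divide)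
      fix a b :: real
      let ?c = "max a (- real n)" and ?d = "min b (real n)"
      have "ind a b y * ?f y = ind ?c ?d y * (ft ?g y / (2 * pi) - u y)" for y
        by (auto simp: ind_def indicator_def)
      then have "(LINT y|lborel. ind a b y * ?f y) = (LINT y|lborel. ind ?c ?d y * ft ?g y / (2 * pi) - ind ?c ?d y * u y)"
        by (simp only: dist)
      also have "\<dots> = (LINT y|lborel. ind ?c ?d y * ft ?g y) / (2 * pi) - (LINT y|lborel. ind ?c ?d y * u y)"
        using i1 i2 by (subst Bochner_Integration.integral_diff) auto
      also have "\<dots> = 0" by (simp add: key)
      finally show "(LINT y|lborel. ind a b y * ?f y) = 0" .
    qed
  qed
  then show ?thesis
  proof eventually_elim
    case (elim x)
    obtain n where "\<bar>x\<bar> \<le> real n" using real_arch_simple by blast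
    then have "ind (- real n) (real n) x = 1" by (auto simp: ind_def indicator_def)
    then show ?case using elim[rule_format, of n] by simp
  qed
qed

subsection \<open>Weights\<close>

text \<open>The symbol of the Bessel potential \<Lambda>^\<sigma>. Half the exponent makes it a
  weight for amplitudes; its square is the weight in \<open>H_norm\<close>.\<close>

definition wt :: "real \<Rightarrow> real \<Rightarrow> real" where
  "wt \<sigma> \<xi> = (1 + \<xi>\<^sup>2) powr (\<sigma> / 2)"

lemma one_plus_square_pos: "0 < 1 + (\<xi>::real)\<^sup>2" by (rule add_pos_nonneg) auto

lemma wt_pos [simp]: "0 < wt \<sigma> \<xi>"
  using one_plus_square_pos[of \<xi>] by (simp add: wt_def)

lemma wt_nonneg [simp]: "0 \<le> wt \<sigma> \<xi>" by (simp add: wt_def)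

lemma wt_add: "wt (\<sigma> + \<tau>) \<xi> = wt \<sigma> \<xi> * wt \<tau> \<xi>"
  by (simp add: wt_def add_divide_distrib powr_add)

lemma wt_0 [simp]: "wt 0 \<xi> = 1"
  using one_plus_square_pos[of \<xi>] by (simp add: wt_def)

lemma wt_mono: "\<sigma> \<le> \<tau> \<Longrightarrow> wt \<sigma> \<xi> \<le> wt \<tau> \<xi>"
  unfolding wt_def by (intro powr_mono) auto

lemma wt_ge_1: "0 \<le> \<sigma> \<Longrightarrow> 1 \<le> wt \<sigma> \<xi>"
  using wt_mono[of 0 \<sigma> \<xi>] by simp

lemma wt_square: "(wt \<sigma> \<xi>)\<^sup>2 = (1 + \<xi>\<^sup>2) powr \<sigma>"
  by (simp add: wt_def power2_eq_square powr_add[symmetric])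

lemma wt_measurable [measurable]: "wt \<sigma> \<in> borel_measurable borel"
  unfolding wt_def by measurable

lemma wt_1: "wt 1 \<xi> = sqrt (1 + \<xi>\<^sup>2)"
  using one_plus_square_pos[of \<xi>] by (simp add: wt_def powr_half_sqrt)

lemma abs_le_wt_1: "\<bar>\<xi>\<bar> \<le> wt 1 \<xi>"
  unfolding wt_1 by (rule real_le_rsqrt) simp

lemma wt_1_power: "(wt 1 \<xi>) ^ n = wt (real n) \<xi>"
  by (induction n) (simp_all add: wt_add[symmetric] add.commute)

lemma wt_powr: "wt \<sigma> \<xi> = (wt 1 \<xi>) powr \<sigma>"
  using one_plus_square_pos[of \<xi>] by (simp add: wt_def powr_powr)

lemma wt_abs_mono:
  assumes "0 \<le> \<sigma>" "\<bar>\<xi>\<bar> \<le> \<bar>\<eta>\<bar>" shows "wt \<sigma> \<xi> \<le> wt \<sigma> \<eta>"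
  unfolding wt_def using assms by (intro powr_mono2) (auto simp: abs_le_square_iff)

text \<open>\<open>wt 1\<close> obeys the triangle inequality, hence is at most twice the larger of
  its two values; raising this to the power \<sigma> gives the factor
  \<open>2 powr \<sigma>\<close>. In a product this lets the weight fall on one factor only.\<close>

lemma wt_subadditive: "0 \<le> \<sigma> \<Longrightarrow> wt \<sigma> \<xi> \<le> 2 powr \<sigma> * (wt \<sigma> (\<xi> - \<eta>) + wt \<sigma> \<eta>)"
proof -
  assume \<sigma>: "0 \<le> \<sigma>"
  let ?m = "max (wt 1 (\<xi> - \<eta>)) (wt 1 \<eta>)"
  have m: "0 \<le> ?m" by (simp add: le_max_iff_disj)
  have "wt 1 \<xi> \<le> wt 1 (\<xi> - \<eta>) + wt 1 \<eta>"
    unfolding wt_1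
  proof (rule real_le_lsqrt)
    let ?a = "sqrt (1 + (\<xi> - \<eta>)\<^sup>2)" and ?b = "sqrt (1 + \<eta>\<^sup>2)"
    show "0 \<le> ?a + ?b" by simp
    have "\<bar>\<xi> - \<eta>\<bar> * \<bar>\<eta>\<bar> \<le> ?a * ?b"
      using abs_le_wt_1 by (intro mult_mono) (simp_all add: wt_1[symmetric])
    then have "(\<xi> - \<eta>) * \<eta> \<le> ?a * ?b" by (metis abs_le_D1 abs_mult)
    then have "1 + \<xi>\<^sup>2 \<le> (1 + (\<xi> - \<eta>)\<^sup>2) + 2 * (?a * ?b) + (1 + \<eta>\<^sup>2)"
      by (simp add: power2_eq_square algebra_simps)
    also have "\<dots> = (?a + ?b)\<^sup>2" by (simp add: power2_sum)
    finally show "1 + \<xi>\<^sup>2 \<le> (?a + ?b)\<^sup>2" .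
  qed
  then have "wt 1 \<xi> \<le> 2 * ?m" by linarith
  then have "wt \<sigma> \<xi> \<le> (2 * ?m) powr \<sigma>"
    unfolding wt_powr[of \<sigma> \<xi>] using \<sigma> by (intro powr_mono2) auto
  also have "\<dots> = 2 powr \<sigma> * ?m powr \<sigma>" using m by (simp add: powr_mult)
  also have "?m powr \<sigma> \<le> wt \<sigma> (\<xi> - \<eta>) + wt \<sigma> \<eta>"
    unfolding wt_powr[of \<sigma> "\<xi> - \<eta>"] wt_powr[of \<sigma> \<eta>] by (auto simp: max_def)
  finally show ?thesis by simp
qed

text \<open>Mean value theorem with \<open>|wt s'| <= s * wt (s - 1)\<close>. The intermediate point
  is no larger in modulus than one of the end points, and for \<open>s >= 1\<close> the weight
  \<open>wt (s - 1)\<close> increases with the modulus.\<close>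

lemma wt_diff_le:
  assumes s: "1 \<le> s"
  shows "\<bar>wt s \<xi> - wt s \<eta>\<bar> \<le> s * \<bar>\<xi> - \<eta>\<bar> * (wt (s - 1) \<xi> + wt (s - 1) \<eta>)"
proof -
  have der: "((wt s) has_real_derivative (s * z * (1 + z\<^sup>2) powr (s / 2 - 1))) (at z)" for z
    unfolding wt_def[abs_def] by (auto intro!: derivative_eq_intros simp: one_plus_square_pos)
  have bound: "\<bar>s * z * (1 + z\<^sup>2) powr (s / 2 - 1)\<bar> \<le> s * wt (s - 1) z" for z
  proof -
    have "\<bar>z\<bar> * (1 + z\<^sup>2) powr (s / 2 - 1) \<le> wt 1 z * (1 + z\<^sup>2) powr (s / 2 - 1)"
      by (intro mult_right_mono abs_le_wt_1) simp
    also have "\<dots> = wt (s - 1) z"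
      unfolding wt_def powr_add[symmetric] by (simp add: field_simps)
    finally show ?thesis using s by (simp add: abs_mult mult.assoc)
  qed
  have main: "\<bar>wt s b - wt s a\<bar> \<le> s * \<bar>b - a\<bar> * (wt (s - 1) b + wt (s - 1) a)" if ab: "a < b" for a b
  proof -
    obtain z where z: "a < z" "z < b" and eq: "wt s b - wt s a = (b - a) * (s * z * (1 + z\<^sup>2) powr (s / 2 - 1))"
      using MVT2[OF ab, of "wt s" "\<lambda>z. s * z * (1 + z\<^sup>2) powr (s / 2 - 1)"] der by blast
    have "\<bar>z\<bar> \<le> \<bar>a\<bar> \<or> \<bar>z\<bar> \<le> \<bar>b\<bar>" using z by linarith
    then have "wt (s - 1) z \<le> wt (s - 1) a \<or> wt (s - 1) z \<le> wt (s - 1) b"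
      using wt_abs_mono[of "s - 1" z] s by fastforce
    then have "wt (s - 1) z \<le> wt (s - 1) b + wt (s - 1) a"
      using wt_nonneg[of "s - 1" a] wt_nonneg[of "s - 1" b] by linarith
    then have "s * wt (s - 1) z \<le> s * (wt (s - 1) b + wt (s - 1) a)" using s by simp
    then have "\<bar>s * z * (1 + z\<^sup>2) powr (s / 2 - 1)\<bar> \<le> s * (wt (s - 1) b + wt (s - 1) a)"
      using bound[of z] by linarith
    then have "\<bar>b - a\<bar> * \<bar>s * z * (1 + z\<^sup>2) powr (s / 2 - 1)\<bar> \<le> \<bar>b - a\<bar> * (s * (wt (s - 1) b + wt (s - 1) a))"
      by (rule mult_left_mono) simp
    then show ?thesis unfolding eq abs_mult[of "b - a"] by (simp only: mult_ac)
  qed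
  consider "\<xi> < \<eta>" | "\<xi> = \<eta>" | "\<eta> < \<xi>" by linarith
  then show ?thesis
    using main[of \<xi> \<eta>] main[of \<eta> \<xi>]
    by cases (simp_all add: abs_minus_commute add.commute)
qed

text \<open>The first summand comes from the difference of weights, with
  \<open>2 powr (s - 1) + 1\<close> from trading \<open>wt (s - 1) \<xi>\<close> for the weights at
  \<xi> - \<eta> and \<eta>; the final 1 comes from the shift of the derivative from \<xi> to
  \<eta>.\<close>

definition commutator_const :: "real \<Rightarrow> real" where
  "commutator_const s = s * (2 powr (s - 1) + 1) + 1"

text \<open>A Kato-Ponce type estimate. Writing the symbol as \<open>(wt s \<xi> - wt s \<eta>) *
  \<eta> + (\<eta> - \<xi>) * wt s \<eta>\<close> shows a factor \<xi> - \<eta> in each part: of the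
  s + 1 derivatives at least one falls on the coefficient, and never all of them on the other
  function.\<close>

lemma commutator_symbol:
  assumes s: "1 \<le> s"
  shows "\<bar>wt s \<xi> * \<eta> - \<xi> * wt s \<eta>\<bar>
    \<le> commutator_const s * (wt s (\<xi> - \<eta>) * wt 1 \<eta> + wt 1 (\<xi> - \<eta>) * wt s \<eta>)"
proof -
  let ?d = "\<xi> - \<eta>" and ?c = "2 powr (s - 1) + 1"
  have c: "1 \<le> ?c" by simp
  have "wt (s - 1) \<xi> + wt (s - 1) \<eta> \<le> 2 powr (s - 1) * (wt (s - 1) ?d + wt (s - 1) \<eta>) + (wt (s - 1) ?d + wt (s - 1) \<eta>)"
    using wt_subadditive[of "s - 1" \<xi> \<eta>] wt_nonneg[of "s - 1" ?d] s by linarith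
  then have 1: "wt (s - 1) \<xi> + wt (s - 1) \<eta> \<le> ?c * (wt (s - 1) ?d + wt (s - 1) \<eta>)"
    by (simp add: distrib_right)
  have "\<bar>(wt s \<xi> - wt s \<eta>) * \<eta>\<bar> \<le> (s * \<bar>?d\<bar> * (wt (s - 1) \<xi> + wt (s - 1) \<eta>)) * \<bar>\<eta>\<bar>"
    unfolding abs_mult by (intro mult_right_mono wt_diff_le s) auto
  also have "\<dots> = (s * (wt (s - 1) \<xi> + wt (s - 1) \<eta>)) * (\<bar>?d\<bar> * \<bar>\<eta>\<bar>)" by (simp only: mult_ac)
  also have "\<dots> \<le> (s * (?c * (wt (s - 1) ?d + wt (s - 1) \<eta>))) * (wt 1 ?d * wt 1 \<eta>)"
    using 1 s by (intro mult_mono mult_left_mono abs_le_wt_1 mult_nonneg_nonneg add_nonneg_nonneg) auto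
  also have "\<dots> = s * ?c * ((wt (s - 1) ?d * wt 1 ?d) * wt 1 \<eta> + wt 1 ?d * (wt (s - 1) \<eta> * wt 1 \<eta>))"
    by (simp add: algebra_simps)
  also have "\<dots> = s * ?c * (wt s ?d * wt 1 \<eta> + wt 1 ?d * wt s \<eta>)"
    by (simp add: wt_add[symmetric])
  finally have A: "\<bar>(wt s \<xi> - wt s \<eta>) * \<eta>\<bar> \<le> s * ?c * (wt s ?d * wt 1 \<eta> + wt 1 ?d * wt s \<eta>)" .
  have "\<bar>(\<eta> - \<xi>) * wt s \<eta>\<bar> \<le> wt 1 ?d * wt s \<eta>"
    using abs_le_wt_1[of ?d] by (simp add: abs_mult abs_minus_commute mult_right_mono)
  also have "\<dots> \<le> wt s ?d * wt 1 \<eta> + wt 1 ?d * wt s \<eta>" by simp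
  finally have B: "\<bar>(\<eta> - \<xi>) * wt s \<eta>\<bar> \<le> wt s ?d * wt 1 \<eta> + wt 1 ?d * wt s \<eta>" .
  have "wt s \<xi> * \<eta> - \<xi> * wt s \<eta> = (wt s \<xi> - wt s \<eta>) * \<eta> + (\<eta> - \<xi>) * wt s \<eta>" by (simp add: algebra_simps)
  then have "\<bar>wt s \<xi> * \<eta> - \<xi> * wt s \<eta>\<bar> \<le> \<bar>(wt s \<xi> - wt s \<eta>) * \<eta>\<bar> + \<bar>(\<eta> - \<xi>) * wt s \<eta>\<bar>"
    by (metis abs_triangle_ineq)
  with A B show ?thesis unfolding commutator_const_def by (simp add: distrib_right)
qed

definition wtc :: "real \<Rightarrow> real \<Rightarrow> complex" where "wtc \<sigma> \<xi> = complex_of_real (wt \<sigma> \<xi>)"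

lemma wtc_measurable [measurable]: "wtc \<sigma> \<in> borel_measurable borel" unfolding wtc_def by measurable

lemma norm_wtc [simp]: "cmod (wtc \<sigma> \<xi>) = wt \<sigma> \<xi>" by (simp add: wtc_def)

lemma wtc_add: "wtc (\<sigma> + \<tau>) \<xi> = wtc \<sigma> \<xi> * wtc \<tau> \<xi>" by (simp add: wtc_def wt_add)

text \<open>Since \<open>(1 + x)^2 / 2 <= 1 + x^2\<close>, the squared weight is dominated on the
  half-line by a multiple of \<open>(1 + x) powr (- 2 * \<sigma>)\<close>, whose primitive is
  explicit and tends to 0 at infinity for \<sigma> > 1/2. The other half-line follows by
  reflection.\<close>

lemma sq_int_wt:
  assumes \<sigma>: "\<sigma> > 1 / 2" shows "sq_int (wtc (- \<sigma>))"
proof -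
  define f where "f x = 2 powr \<sigma> * (1 + x) powr (- 2 * \<sigma>)" for x :: real
  define g where "g x = (2 powr \<sigma> / (1 - 2 * \<sigma>)) * (1 + x) powr (1 - 2 * \<sigma>)" for x :: real
  have [measurable]: "f \<in> borel_measurable borel" unfolding f_def by measurable
  have "(\<integral>\<^sup>+x. ennreal (f x) * indicator {0..} x \<partial>lborel) = ennreal (0 - g 0)"
  proof (rule nn_integral_FTC_atLeast)
    show "f \<in> borel_measurable borel" by simp
    show "(g has_real_derivative f x) (at x)" if "0 \<le> x" for x
    proof -
      have "((\<lambda>x. (1 + x) powr (1 - 2 * \<sigma>)) has_real_derivative (1 - 2 * \<sigma>) * (1 + x) powr (- 2 * \<sigma>)) (at x)"
        using that by (auto intro!: derivative_eq_intros)
      from DERIV_cmult[OF this, of "2 powr \<sigma> / (1 - 2 * \<sigma>)"] show ?thesis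
        unfolding g_def f_def using \<sigma> by simp
    qed
    show "0 \<le> f x" for x by (simp add: f_def)
    have "((\<lambda>x. (2 powr \<sigma> / (1 - 2 * \<sigma>)) * (1 + x) powr (1 - 2 * \<sigma>)) \<longlongrightarrow> (2 powr \<sigma> / (1 - 2 * \<sigma>)) * 0) at_top"
      by (intro tendsto_mult tendsto_const tendsto_neg_powr filterlim_tendsto_add_at_top[OF tendsto_const] filterlim_ident) (use \<sigma> in auto)
    then show "(g \<longlongrightarrow> 0) at_top" by (simp add: g_def[abs_def])
  qed
  then have fin: "(\<integral>\<^sup>+x. ennreal (f x) * indicator {0..} x \<partial>lborel) < \<infinity>" by simp
  have le: "(1 + x\<^sup>2) powr (- \<sigma>) \<le> f x" if "0 \<le> x" for x :: real
  proof -
    have "(1 + x)\<^sup>2 / 2 \<le> 1 + x\<^sup>2"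
      using zero_le_power2[of "1 - x"] by (simp add: power2_eq_square algebra_simps)
    then have "(1 + x\<^sup>2) powr (- \<sigma>) \<le> ((1 + x)\<^sup>2 / 2) powr (- \<sigma>)"
      using that \<sigma> by (intro powr_mono2') auto
    also have "\<dots> = ((1 + x)\<^sup>2) powr (- \<sigma>) / 2 powr (- \<sigma>)" using that by (subst powr_divide) auto
    also have "\<dots> = f x"
      using that by (simp add: f_def powr_minus_divide powr_powr powr_realpow[symmetric] flip: powr_numeral)
    finally show ?thesis .
  qed
  have "(\<integral>\<^sup>+x. (ennreal (cmod (wtc (- \<sigma>) x)))\<^sup>2 \<partial>lborel)
      \<le> (\<integral>\<^sup>+x. ennreal (f x) * indicator {0..} x + ennreal (f (0 - x)) * indicator {0..} (0 - x) \<partial>lborel)"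
  proof (intro nn_integral_mono)
    fix x :: real
    have "(ennreal (cmod (wtc (- \<sigma>) x)))\<^sup>2 = ennreal ((1 + x\<^sup>2) powr (- \<sigma>))"
      by (simp add: ennreal_power wt_square)
    also have "\<dots> \<le> ennreal (f x) * indicator {0..} x + ennreal (f (0 - x)) * indicator {0..} (0 - x)"
    proof (cases "0 \<le> x")
      case True
      then have "ennreal ((1 + x\<^sup>2) powr (- \<sigma>)) \<le> ennreal (f x) * indicator {0..} x"
        using le[OF True] by (simp add: ennreal_leI)
      then show ?thesis by (rule add_increasing2[rotated]) simp
    next
      case False
      then have "ennreal ((1 + x\<^sup>2) powr (- \<sigma>)) \<le> ennreal (f (0 - x)) * indicator {0..} (0 - x)"
        using le[of "- x"] by (simp add: ennreal_leI)
      then show ?thesis by (rule add_increasing[rotated]) simp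
    qed
    finally show "(ennreal (cmod (wtc (- \<sigma>) x)))\<^sup>2 \<le> ennreal (f x) * indicator {0..} x + ennreal (f (0 - x)) * indicator {0..} (0 - x)" .
  qed
  also have "\<dots> = (\<integral>\<^sup>+x. ennreal (f x) * indicator {0..} x \<partial>lborel) + (\<integral>\<^sup>+x. ennreal (f x) * indicator {0..} x \<partial>lborel)"
  proof -
    define h where "h x = ennreal (f x) * indicator {0..} x" for x
    have h [measurable]: "h \<in> borel_measurable borel" unfolding h_def by measurable
    have "(\<integral>\<^sup>+x. h x + h (0 - x) \<partial>lborel) = (\<integral>\<^sup>+x. h x \<partial>lborel) + (\<integral>\<^sup>+x. h (0 - x) \<partial>lborel)"
      by (rule nn_integral_add) measurable
    also have "(\<integral>\<^sup>+x. h (0 - x) \<partial>lborel) = (\<integral>\<^sup>+x. h x \<partial>lborel)"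
      by (rule nn_integral_reflect_shift(2)[OF h])
    finally show ?thesis unfolding h_def .
  qed
  also have "\<dots> < \<infinity>" using fin by (simp add: ennreal_add_eq_top less_top)
  finally show ?thesis by (simp add: sq_int_iff_nn)
qed

subsection \<open>Weighted $L^2$ spaces\<close>

definition Hs :: "real \<Rightarrow> (real \<Rightarrow> complex) \<Rightarrow> bool" where
  "Hs \<sigma> F \<longleftrightarrow> F \<in> borel_measurable borel \<and> sq_int (\<lambda>\<xi>. wtc \<sigma> \<xi> * F \<xi>)"

definition hs :: "real \<Rightarrow> (real \<Rightarrow> complex) \<Rightarrow> real" where
  "hs \<sigma> F = l2 (\<lambda>\<xi>. wtc \<sigma> \<xi> * F \<xi>)"

definition emb_const :: "real \<Rightarrow> real" where "emb_const \<sigma> = l2 (wtc (- \<sigma>))"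

lemma hs_nonneg [simp]: "0 \<le> hs \<sigma> F" and emb_const_nonneg [simp]: "0 \<le> emb_const \<sigma>"
  by (simp_all add: hs_def emb_const_def)

lemma Hs_measurable: "Hs \<sigma> F \<Longrightarrow> F \<in> borel_measurable borel" by (simp add: Hs_def)

lemma Hs_sq: "Hs \<sigma> F \<Longrightarrow> sq_int (\<lambda>\<xi>. wtc \<sigma> \<xi> * F \<xi>)" by (simp add: Hs_def)

lemma Hs_bound:
  assumes F: "Hs \<tau> F" and G: "G \<in> borel_measurable borel" and c: "0 \<le> c"
    and le: "AE \<xi> in lborel. wt \<sigma> \<xi> * cmod (G \<xi>) \<le> c * (wt \<tau> \<xi> * cmod (F \<xi>))"
  shows "Hs \<sigma> G" "hs \<sigma> G \<le> c * hs \<tau> F"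
proof -
  have m: "(\<lambda>\<xi>. wtc \<sigma> \<xi> * G \<xi>) \<in> borel_measurable borel" using G by measurable
  have le': "AE \<xi> in lborel. cmod (wtc \<sigma> \<xi> * G \<xi>) \<le> c * cmod (wtc \<tau> \<xi> * F \<xi>)"
    using le by (simp add: norm_mult)
  show "Hs \<sigma> G" "hs \<sigma> G \<le> c * hs \<tau> F"
    using sq_int_bound[OF Hs_sq[OF F] m le' c] G by (simp_all add: Hs_def hs_def)
qed

lemma Hs_mono:
  assumes F: "Hs \<tau> F" and "\<sigma> \<le> \<tau>" shows "Hs \<sigma> F" "hs \<sigma> F \<le> hs \<tau> F"
  using Hs_bound[OF F Hs_measurable[OF F], of 1 \<sigma>] wt_mono[OF assms(2)] by (simp_all add: mult_right_mono)

lemma Hs_0: "Hs 0 F \<longleftrightarrow> sq_int F" "hs 0 F = l2 F"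
  by (auto simp: Hs_def hs_def wtc_def)

lemma Hs_wt:
  assumes "Hs (\<sigma> + \<tau>) F" shows "Hs \<sigma> (\<lambda>\<xi>. wtc \<tau> \<xi> * F \<xi>)" "hs \<sigma> (\<lambda>\<xi>. wtc \<tau> \<xi> * F \<xi>) = hs (\<sigma> + \<tau>) F"
proof -
  have [measurable]: "F \<in> borel_measurable borel" using assms by (rule Hs_measurable)
  have "(\<lambda>\<xi>. wtc \<tau> \<xi> * F \<xi>) \<in> borel_measurable borel" by measurable
  then show "Hs \<sigma> (\<lambda>\<xi>. wtc \<tau> \<xi> * F \<xi>)" "hs \<sigma> (\<lambda>\<xi>. wtc \<tau> \<xi> * F \<xi>) = hs (\<sigma> + \<tau>) F"
    using assms by (simp_all add: Hs_def hs_def wtc_add mult.assoc)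
qed

lemma Hs_cong_AE:
  assumes F: "Hs \<sigma> F" and G: "G \<in> borel_measurable borel" and AE: "AE \<xi> in lborel. G \<xi> = F \<xi>"
  shows "Hs \<sigma> G" "hs \<sigma> G = hs \<sigma> F"
proof -
  have AE': "AE \<xi> in lborel. wtc \<sigma> \<xi> * G \<xi> = wtc \<sigma> \<xi> * F \<xi>" using AE by eventually_elim simp
  show "Hs \<sigma> G" "hs \<sigma> G = hs \<sigma> F"
    using sq_int_cong_AE[OF Hs_sq[OF F] _ AE'] G by (simp_all add: Hs_def hs_def)
qed

lemma Hs_add:
  assumes "Hs \<sigma> F" "Hs \<sigma> G"
  shows "Hs \<sigma> (\<lambda>\<xi>. F \<xi> + G \<xi>)" "hs \<sigma> (\<lambda>\<xi>. F \<xi> + G \<xi>) \<le> hs \<sigma> F + hs \<sigma> G"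
  using sq_int_add[OF Hs_sq[OF assms(1)] Hs_sq[OF assms(2)]] assms
  by (auto simp: Hs_def hs_def distrib_left)

lemma Hs_scale:
  assumes "Hs \<sigma> F" shows "Hs \<sigma> (\<lambda>\<xi>. c * F \<xi>)" "hs \<sigma> (\<lambda>\<xi>. c * F \<xi>) = cmod c * hs \<sigma> F"
  using sq_int_scale[OF Hs_sq[OF assms], of c] assms
  by (auto simp: Hs_def hs_def mult.left_commute)

lemma Hs_diff:
  assumes F: "Hs \<sigma> F" and G: "Hs \<sigma> G"
  shows "Hs \<sigma> (\<lambda>\<xi>. F \<xi> - G \<xi>)" "hs \<sigma> (\<lambda>\<xi>. F \<xi> - G \<xi>) \<le> hs \<sigma> F + hs \<sigma> G"
  using Hs_add[OF F Hs_scale(1)[OF G, of "-1"]] Hs_scale(2)[OF G, of "-1"] by simp_all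

text \<open>Cauchy-Schwarz against \<open>wtc (- \<sigma>)\<close>. This is the Sobolev embedding on
  the frequency side; throughout, \<open>l1\<close> of the transform takes the place of the sup
  norm.\<close>

lemma Hs_integrable:
  assumes F: "Hs \<sigma> F" and \<sigma>: "\<sigma> > 1 / 2"
  shows "integrable lborel F" "l1 F \<le> emb_const \<sigma> * hs \<sigma> F"
proof -
  have eq: "wtc (- \<sigma>) \<xi> * (wtc \<sigma> \<xi> * F \<xi>) = F \<xi>" for \<xi>
    using wtc_add[of "- \<sigma>" \<sigma> \<xi>] by (simp add: wtc_def mult.assoc[symmetric])
  show "integrable lborel F" using sq_int_mult[OF sq_int_wt[OF \<sigma>] Hs_sq[OF F]] by (simp add: eq)
  have "l1 F = (LINT \<xi>|lborel. cmod (wtc (- \<sigma>) \<xi>) * cmod (wtc \<sigma> \<xi> * F \<xi>))"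
    unfolding l1_def norm_mult[symmetric] eq ..
  then show "l1 F \<le> emb_const \<sigma> * hs \<sigma> F"
    using Cauchy_Schwarz_l2[OF sq_int_wt[OF \<sigma>] Hs_sq[OF F]] by (simp add: emb_const_def hs_def)
qed

text \<open>The 4 is the 2 of \<open>Young_kernel\<close> times the two symmetric terms of the
  product estimate; \<open>2 powr \<sigma>\<close> comes from \<open>wt_subadditive\<close>.\<close>

definition alg_const :: "real \<Rightarrow> real" where "alg_const \<sigma> = 4 * 2 powr \<sigma> * emb_const \<sigma>"

lemma alg_const_nonneg [simp]: "0 \<le> alg_const \<sigma>" by (simp add: alg_const_def)

text \<open>The algebra property of Sobolev spaces above 1/2: the weight falls on one factor, and
  the other one is integrable by the embedding.\<close>

lemma Hs_cconv:
  assumes F: "Hs \<sigma> F" and G: "Hs \<sigma> G" and \<sigma>: "\<sigma> > 1 / 2"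
  shows "Hs \<sigma> (cconv F G)" "hs \<sigma> (cconv F G) \<le> alg_const \<sigma> * hs \<sigma> F * hs \<sigma> G"
proof -
  have [measurable]: "F \<in> borel_measurable borel" "G \<in> borel_measurable borel"
    using F G by (auto simp: Hs_def)
  note iF = Hs_integrable[OF F \<sigma>] and iG = Hs_integrable[OF G \<sigma>]
  have m: "(\<lambda>(\<xi>, \<eta>). wtc \<sigma> \<xi> * (F (\<xi> - \<eta>) * G \<eta>)) \<in> borel_measurable (borel \<Otimes>\<^sub>M borel)" by measurable
  have le: "cmod (wtc \<sigma> \<xi> * (F (\<xi> - \<eta>) * G \<eta>)) \<le> 2 powr \<sigma> *
      (cmod (wtc \<sigma> (\<xi> - \<eta>) * F (\<xi> - \<eta>)) * cmod (G \<eta>) + cmod (F (\<xi> - \<eta>)) * cmod (wtc \<sigma> \<eta> * G \<eta>))" for \<xi> \<eta>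
    using mult_right_mono[OF wt_subadditive[of \<sigma> \<xi> \<eta>], of "cmod (F (\<xi> - \<eta>)) * cmod (G \<eta>)"] \<sigma>
    by (simp add: norm_mult algebra_simps)
  note Y = Young_kernel[OF m Hs_sq[OF F] iG(1) iF(1) Hs_sq[OF G] le powr_ge_zero]
  have eq: "(\<lambda>\<xi>. LINT \<eta>|lborel. wtc \<sigma> \<xi> * (F (\<xi> - \<eta>) * G \<eta>)) = (\<lambda>\<xi>. wtc \<sigma> \<xi> * cconv F G \<xi>)"
    by (simp add: cconv_def)
  show "Hs \<sigma> (cconv F G)" using Y(1) unfolding eq Hs_def by simp
  have "hs \<sigma> (cconv F G) \<le> 2 * 2 powr \<sigma> * (hs \<sigma> F * l1 G + l1 F * hs \<sigma> G)"
    using Y(2) unfolding eq hs_def .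
  also have "\<dots> \<le> 2 * 2 powr \<sigma> * (hs \<sigma> F * (emb_const \<sigma> * hs \<sigma> G) + (emb_const \<sigma> * hs \<sigma> F) * hs \<sigma> G)"
    by (intro mult_left_mono add_mono mult_right_mono iF iG) auto
  finally show "hs \<sigma> (cconv F G) \<le> alg_const \<sigma> * hs \<sigma> F * hs \<sigma> G"
    by (simp add: alg_const_def algebra_simps)
qed

text \<open>By \<open>commutator_symbol\<close> one factor carries the full weight
  \<open>wt s\<close> and the other only \<open>wt 1\<close>. The latter has to be integrable, which
  asks for s - 1 > 1/2.\<close>

lemma commutator_bound:
  assumes Q: "Hs s Q" and Z: "Hs s Z" and s: "s > 3 / 2"
  shows "sq_int (\<lambda>\<xi>. wtc s \<xi> * cconv Q (\<lambda>\<eta>. \<i> * \<eta> * Z \<eta>) \<xi> - \<i> * \<xi> * cconv Q (\<lambda>\<eta>. wtc s \<eta> * Z \<eta>) \<xi>)" (is "sq_int ?C")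
    and "l2 (\<lambda>\<xi>. wtc s \<xi> * cconv Q (\<lambda>\<eta>. \<i> * \<eta> * Z \<eta>) \<xi> - \<i> * \<xi> * cconv Q (\<lambda>\<eta>. wtc s \<eta> * Z \<eta>) \<xi>)
      \<le> 4 * commutator_const s * emb_const (s - 1) * hs s Q * hs s Z"
proof -
  have [measurable]: "Q \<in> borel_measurable borel" "Z \<in> borel_measurable borel"
    using Q Z by (auto simp: Hs_def)
  have Q0: "sq_int Q" and Z0: "sq_int Z" using Hs_mono(1)[OF Q, of 0] Hs_mono(1)[OF Z, of 0] s by (auto simp: Hs_0)
  have "Hs 0 (\<lambda>\<eta>. \<i> * \<eta> * Z \<eta>)"
  proof (rule Hs_bound(1)[OF Z, where c = 1])
    show "AE \<xi> in lborel. wt 0 \<xi> * cmod (\<i> * \<xi> * Z \<xi>) \<le> 1 * (wt s \<xi> * cmod (Z \<xi>))"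
      using s order_trans[OF abs_le_wt_1 wt_mono[of 1 s]]
      by (auto simp: norm_mult intro!: mult_right_mono)
  qed auto
  then have Z1: "sq_int (\<lambda>\<eta>. \<i> * \<eta> * Z \<eta>)" by (simp add: Hs_0)
  have Qs: "Hs (s - 1 + 1) Q" and Zs: "Hs (s - 1 + 1) Z" using Q Z by simp_all
  have s1: "s - 1 > 1 / 2" using s by simp
  note iQ = Hs_integrable[OF Hs_wt(1)[OF Qs] s1, unfolded Hs_wt(2)[OF Qs]]
  note iZ = Hs_integrable[OF Hs_wt(1)[OF Zs] s1, unfolded Hs_wt(2)[OF Zs]]
  have c0: "0 \<le> commutator_const s" using s by (simp add: commutator_const_def)
  let ?K = "\<lambda>\<xi> \<eta>. \<i> * (Q (\<xi> - \<eta>) * Z \<eta>) * complex_of_real (wt s \<xi> * \<eta> - \<xi> * wt s \<eta>)"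
  have m: "(\<lambda>(\<xi>, \<eta>). ?K \<xi> \<eta>) \<in> borel_measurable (borel \<Otimes>\<^sub>M borel)" by measurable
  have le: "cmod (?K \<xi> \<eta>) \<le> commutator_const s * (cmod (wtc s (\<xi> - \<eta>) * Q (\<xi> - \<eta>)) * cmod (wtc 1 \<eta> * Z \<eta>)
      + cmod (wtc 1 (\<xi> - \<eta>) * Q (\<xi> - \<eta>)) * cmod (wtc s \<eta> * Z \<eta>))" for \<xi> \<eta>
  proof -
    have "cmod (?K \<xi> \<eta>) = cmod (Q (\<xi> - \<eta>)) * cmod (Z \<eta>) * \<bar>wt s \<xi> * \<eta> - \<xi> * wt s \<eta>\<bar>"
      by (simp only: norm_mult norm_of_real norm_ii mult_1)
    also have "\<dots> \<le> cmod (Q (\<xi> - \<eta>)) * cmod (Z \<eta>) * (commutator_const s * (wt s (\<xi> - \<eta>) * wt 1 \<eta> + wt 1 (\<xi> - \<eta>) * wt s \<eta>))"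
      by (intro mult_left_mono commutator_symbol) (use s in auto)
    finally show ?thesis by (simp add: norm_mult algebra_simps)
  qed
  note Y = Young_kernel[OF m Hs_sq[OF Q] iZ(1) iQ(1) Hs_sq[OF Z] le c0]
  have eq: "(\<lambda>\<xi>. LINT \<eta>|lborel. ?K \<xi> \<eta>) = ?C"
  proof
    fix \<xi>
    have "wtc s \<xi> * cconv Q (\<lambda>\<eta>. \<i> * \<eta> * Z \<eta>) \<xi> - \<i> * \<xi> * cconv Q (\<lambda>\<eta>. wtc s \<eta> * Z \<eta>) \<xi>
      = (LINT \<eta>|lborel. wtc s \<xi> * (Q (\<xi> - \<eta>) * (\<i> * \<eta> * Z \<eta>)) - \<i> * \<xi> * (Q (\<xi> - \<eta>) * (wtc s \<eta> * Z \<eta>)))"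
      unfolding cconv_def
      using cconv_integrand[OF Q0 Z1, of \<xi>] cconv_integrand[OF Q0 Hs_sq[OF Z], of \<xi>]
      by (subst Bochner_Integration.integral_diff) auto
    also have "\<dots> = (LINT \<eta>|lborel. ?K \<xi> \<eta>)"
      by (intro Bochner_Integration.integral_cong refl) (simp add: wtc_def algebra_simps)
    finally show "(LINT \<eta>|lborel. ?K \<xi> \<eta>) = ?C \<xi>" by simp
  qed
  show "sq_int ?C" using Y(1) unfolding eq .
  have "l2 ?C \<le> 2 * commutator_const s * (hs s Q * l1 (\<lambda>\<eta>. wtc 1 \<eta> * Z \<eta>) + l1 (\<lambda>\<eta>. wtc 1 \<eta> * Q \<eta>) * hs s Z)"
    using Y(2) unfolding eq hs_def .
  also have "\<dots> \<le> 2 * commutator_const s * (hs s Q * (emb_const (s - 1) * hs s Z) + (emb_const (s - 1) * hs s Q) * hs s Z)"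
    using iQ(2) iZ(2) c0 by (intro mult_left_mono add_mono mult_right_mono) auto
  finally show "l2 ?C \<le> 4 * commutator_const s * emb_const (s - 1) * hs s Q * hs s Z"
    by (simp add: algebra_simps)
qed

subsection \<open>Sobolev spaces of continuous functions\<close>

text \<open>The choice is immaterial up to a null set by \<open>ft_inj_eq\<close>. As
  \<open>ft\<close> carries no normalising constant, \<open>hat\<close> is the usual transform
  divided by 2\<pi>.\<close>

definition hat :: "(real \<Rightarrow> complex) \<Rightarrow> real \<Rightarrow> complex" where
  "hat f = (SOME F. integrable lborel F \<and> f = ft F)"

text \<open>Members are actual continuous functions rather than classes, so that products, powers
  and classical derivatives have pointwise meaning; the integrable frequency function guarantees
  continuity for every \<sigma>.\<close>

definition Sob :: "real \<Rightarrow> (real \<Rightarrow> complex) \<Rightarrow> bool" where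
  "Sob \<sigma> f \<longleftrightarrow> (\<exists>F. integrable lborel F \<and> Hs \<sigma> F \<and> f = ft F)"

definition Sob_norm :: "real \<Rightarrow> (real \<Rightarrow> complex) \<Rightarrow> real" where
  "Sob_norm \<sigma> f = hs \<sigma> (hat f)"

lemma Sob_norm_nonneg [simp]: "0 \<le> Sob_norm \<sigma> f" by (simp add: Sob_norm_def)

lemma hat_ft:
  assumes F: "integrable lborel F"
  shows "integrable lborel (hat (ft F))" "ft (hat (ft F)) = ft F" "AE \<xi> in lborel. hat (ft F) \<xi> = F \<xi>"
proof -
  have *: "integrable lborel (hat (ft F)) \<and> ft F = ft (hat (ft F))"
    unfolding hat_def by (rule someI[of "\<lambda>G. integrable lborel G \<and> ft F = ft G" F]) (use F in simp)
  then show 1: "integrable lborel (hat (ft F))" and 2: "ft (hat (ft F)) = ft F" by auto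
  show "AE \<xi> in lborel. hat (ft F) \<xi> = F \<xi>" by (rule ft_inj_eq[OF 1 F]) (simp add: 2)
qed

lemma Sob_ft:
  assumes F: "integrable lborel F" and H: "Hs \<sigma> F"
  shows "Sob \<sigma> (ft F)" "Sob_norm \<sigma> (ft F) = hs \<sigma> F"
proof -
  show "Sob \<sigma> (ft F)" using assms by (auto simp: Sob_def)
  show "Sob_norm \<sigma> (ft F) = hs \<sigma> F"
    unfolding Sob_norm_def by (rule Hs_cong_AE(2)[OF H integrable_lborel_measurable[OF hat_ft(1)[OF F]] hat_ft(3)[OF F]])
qed

lemma Sob_hat:
  assumes "Sob \<sigma> f" shows "integrable lborel (hat f)" "Hs \<sigma> (hat f)" "ft (hat f) = f"
proof -
  obtain F where F: "integrable lborel F" "Hs \<sigma> F" "f = ft F" using assms by (auto simp: Sob_def)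
  show i: "integrable lborel (hat f)" and "ft (hat f) = f" using hat_ft[OF F(1)] F(3) by auto
  show "Hs \<sigma> (hat f)"
    unfolding F(3) by (rule Hs_cong_AE(1)[OF F(2) integrable_lborel_measurable[OF hat_ft(1)[OF F(1)]] hat_ft(3)[OF F(1)]])
qed

lemma Sob_measurable_hat: "Sob \<sigma> f \<Longrightarrow> hat f \<in> borel_measurable borel"
  using Sob_hat(2) Hs_measurable by blast

lemma Sob_mono:
  assumes f: "Sob \<tau> f" and "\<sigma> \<le> \<tau>" shows "Sob \<sigma> f" "Sob_norm \<sigma> f \<le> Sob_norm \<tau> f"
  using Sob_ft(1)[OF Sob_hat(1)[OF f] Hs_mono(1)[OF Sob_hat(2)[OF f] assms(2)]] Hs_mono(2)[OF Sob_hat(2)[OF f] assms(2)]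
  by (simp_all add: Sob_hat(3)[OF f] Sob_norm_def)

text \<open>The common device for the closure properties below: exhibit a frequency function with
  the right bounds, and uniqueness identifies it with \<open>hat f\<close>.\<close>

lemma Sob_transfer:
  assumes i: "integrable lborel F" and H: "Hs \<sigma> F" and eq: "\<And>x. ft F x = f x"
  shows "Sob \<sigma> f" "Sob_norm \<sigma> f = hs \<sigma> F" "AE \<xi> in lborel. hat f \<xi> = F \<xi>"
proof -
  have f: "f = ft F" using eq by auto
  show "Sob \<sigma> f" "Sob_norm \<sigma> f = hs \<sigma> F" "AE \<xi> in lborel. hat f \<xi> = F \<xi>"
    unfolding f by (rule Sob_ft[OF i H] hat_ft(3)[OF i])+
qed

lemma Sob_add:
  assumes f: "Sob \<sigma> f" and g: "Sob \<sigma> g"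
  shows "Sob \<sigma> (\<lambda>x. f x + g x)" "Sob_norm \<sigma> (\<lambda>x. f x + g x) \<le> Sob_norm \<sigma> f + Sob_norm \<sigma> g"
    "AE \<xi> in lborel. hat (\<lambda>x. f x + g x) \<xi> = hat f \<xi> + hat g \<xi>"
proof -
  have i: "integrable lborel (\<lambda>\<xi>. hat f \<xi> + hat g \<xi>)" using Sob_hat(1) f g by auto
  have eq: "ft (\<lambda>\<xi>. hat f \<xi> + hat g \<xi>) x = f x + g x" for x
    by (simp add: ft_add Sob_hat(1)[OF f] Sob_hat(1)[OF g] Sob_hat(3)[OF f] Sob_hat(3)[OF g])
  note H = Hs_add[OF Sob_hat(2)[OF f] Sob_hat(2)[OF g]]
  note T = Sob_transfer[OF i H(1), of "\<lambda>x. f x + g x", OF eq]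
  show "Sob \<sigma> (\<lambda>x. f x + g x)" "AE \<xi> in lborel. hat (\<lambda>x. f x + g x) \<xi> = hat f \<xi> + hat g \<xi>" by (rule T)+
  show "Sob_norm \<sigma> (\<lambda>x. f x + g x) \<le> Sob_norm \<sigma> f + Sob_norm \<sigma> g" using T(2) H(2) by (simp add: Sob_norm_def)
qed

lemma Sob_scale:
  assumes f: "Sob \<sigma> f"
  shows "Sob \<sigma> (\<lambda>x. c * f x)" "Sob_norm \<sigma> (\<lambda>x. c * f x) = cmod c * Sob_norm \<sigma> f"
    "AE \<xi> in lborel. hat (\<lambda>x. c * f x) \<xi> = c * hat f \<xi>"
proof -
  have i: "integrable lborel (\<lambda>\<xi>. c * hat f \<xi>)" using Sob_hat(1)[OF f] by auto
  have eq: "ft (\<lambda>\<xi>. c * hat f \<xi>) x = c * f x" for x by (simp add: ft_scale Sob_hat(3)[OF f])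
  note H = Hs_scale[OF Sob_hat(2)[OF f], of c]
  note T = Sob_transfer[OF i H(1), of "\<lambda>x. c * f x", OF eq]
  show "Sob \<sigma> (\<lambda>x. c * f x)" "AE \<xi> in lborel. hat (\<lambda>x. c * f x) \<xi> = c * hat f \<xi>" by (rule T)+
  show "Sob_norm \<sigma> (\<lambda>x. c * f x) = cmod c * Sob_norm \<sigma> f" using T(2) H(2) by (simp add: Sob_norm_def)
qed

lemma Sob_diff:
  assumes f: "Sob \<sigma> f" and g: "Sob \<sigma> g"
  shows "Sob \<sigma> (\<lambda>x. f x - g x)" "Sob_norm \<sigma> (\<lambda>x. f x - g x) \<le> Sob_norm \<sigma> f + Sob_norm \<sigma> g"
    "AE \<xi> in lborel. hat (\<lambda>x. f x - g x) \<xi> = hat f \<xi> - hat g \<xi>"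
proof -
  note A = Sob_add[OF f Sob_scale(1)[OF g, of "-1"]] and S = Sob_scale(2,3)[OF g, of "-1"]
  show "Sob \<sigma> (\<lambda>x. f x - g x)" using A(1) by simp
  show "Sob_norm \<sigma> (\<lambda>x. f x - g x) \<le> Sob_norm \<sigma> f + Sob_norm \<sigma> g" using A(2) S(1) by simp
  show "AE \<xi> in lborel. hat (\<lambda>x. f x - g x) \<xi> = hat f \<xi> - hat g \<xi>"
    using A(3) S(2) by eventually_elim simp
qed

lemma Sob_norm_minus_commute:
  assumes f: "Sob \<sigma> f" and g: "Sob \<sigma> g" shows "Sob_norm \<sigma> (\<lambda>x. f x - g x) = Sob_norm \<sigma> (\<lambda>x. g x - f x)"
  using Sob_scale(2)[OF Sob_diff(1)[OF f g], of "-1"] by simp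

lemma Sob_norm_triangle:
  assumes f: "Sob \<sigma> f" and g: "Sob \<sigma> g" shows "Sob_norm \<sigma> f \<le> Sob_norm \<sigma> g + Sob_norm \<sigma> (\<lambda>x. f x - g x)"
  using Sob_add(2)[OF g Sob_diff(1)[OF f g]] by simp

lemma Sob_mult:
  assumes f: "Sob \<sigma> f" and g: "Sob \<sigma> g" and \<sigma>: "\<sigma> > 1 / 2"
  shows "Sob \<sigma> (\<lambda>x. f x * g x)" "Sob_norm \<sigma> (\<lambda>x. f x * g x) \<le> alg_const \<sigma> * Sob_norm \<sigma> f * Sob_norm \<sigma> g"
    "AE \<xi> in lborel. hat (\<lambda>x. f x * g x) \<xi> = cconv (hat f) (hat g) \<xi>"
proof -
  note c = ft_cconv[OF Sob_hat(1)[OF f] Sob_hat(1)[OF g]]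
  have eq: "ft (cconv (hat f) (hat g)) x = f x * g x" for x
    by (simp add: c(2) Sob_hat(3)[OF f] Sob_hat(3)[OF g])
  note H = Hs_cconv[OF Sob_hat(2)[OF f] Sob_hat(2)[OF g] \<sigma>]
  note T = Sob_transfer[OF c(1) H(1), of "\<lambda>x. f x * g x", OF eq]
  show "Sob \<sigma> (\<lambda>x. f x * g x)" "AE \<xi> in lborel. hat (\<lambda>x. f x * g x) \<xi> = cconv (hat f) (hat g) \<xi>" by (rule T)+
  show "Sob_norm \<sigma> (\<lambda>x. f x * g x) \<le> alg_const \<sigma> * Sob_norm \<sigma> f * Sob_norm \<sigma> g" using T(2) H(2) by (simp add: Sob_norm_def)
qed

lemma Sob_power:
  assumes f: "Sob \<sigma> f" and \<sigma>: "\<sigma> > 1 / 2" and n: "n \<ge> 1"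
  shows "Sob \<sigma> (\<lambda>x. f x ^ n) \<and> Sob_norm \<sigma> (\<lambda>x. f x ^ n) \<le> alg_const \<sigma> ^ (n - 1) * Sob_norm \<sigma> f ^ n"
  using n
proof (induction n rule: nat_induct_at_least)
  case base show ?case using f by simp
next
  case (Suc n)
  then have IH: "Sob \<sigma> (\<lambda>x. f x ^ n)" "Sob_norm \<sigma> (\<lambda>x. f x ^ n) \<le> alg_const \<sigma> ^ (n - 1) * Sob_norm \<sigma> f ^ n" by auto
  note M = Sob_mult[OF f IH(1) \<sigma>]
  have "Sob_norm \<sigma> (\<lambda>x. f x * f x ^ n) \<le> alg_const \<sigma> * Sob_norm \<sigma> f * (alg_const \<sigma> ^ (n - 1) * Sob_norm \<sigma> f ^ n)"
    by (rule order_trans[OF M(2)]) (intro mult_left_mono IH mult_nonneg_nonneg; simp)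
  also have "\<dots> = (alg_const \<sigma> * alg_const \<sigma> ^ (n - 1)) * Sob_norm \<sigma> f ^ Suc n" by simp
  also have "alg_const \<sigma> * alg_const \<sigma> ^ (n - 1) = alg_const \<sigma> ^ (Suc n - 1)" using Suc(1) by (cases n) auto
  finally show ?case using M(1) by simp
qed

text \<open>Induction on the splitting \<open>f * (f ^ n - g ^ n) + (f - g) * g ^ n\<close>. Each
  multiplication costs one \<open>alg_const \<sigma>\<close>, and one factor is always the
  difference, hence the exponents \<open>n - 1\<close>.\<close>

lemma Sob_power_diff:
  assumes f: "Sob \<sigma> f" and g: "Sob \<sigma> g" and \<sigma>: "\<sigma> > 1 / 2" and n: "n \<ge> 1"
    and fM: "Sob_norm \<sigma> f \<le> M" and gM: "Sob_norm \<sigma> g \<le> M"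
  shows "Sob_norm \<sigma> (\<lambda>x. f x ^ n - g x ^ n) \<le> real n * alg_const \<sigma> ^ (n - 1) * M ^ (n - 1) * Sob_norm \<sigma> (\<lambda>x. f x - g x)"
  using n
proof (induction n rule: nat_induct_at_least)
  case base show ?case by simp
next
  case (Suc n)
  have M: "0 \<le> M" using fM Sob_norm_nonneg[of \<sigma> f] by linarith
  let ?d = "Sob_norm \<sigma> (\<lambda>x. f x - g x)"
  have fn: "Sob \<sigma> (\<lambda>x. f x ^ n)" and gn: "Sob \<sigma> (\<lambda>x. g x ^ n)"
    and gnM: "Sob_norm \<sigma> (\<lambda>x. g x ^ n) \<le> alg_const \<sigma> ^ (n - 1) * Sob_norm \<sigma> g ^ n"
    using Sob_power[OF f \<sigma> Suc(1)] Sob_power[OF g \<sigma> Suc(1)] by auto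
  have gnM': "Sob_norm \<sigma> (\<lambda>x. g x ^ n) \<le> alg_const \<sigma> ^ (n - 1) * M ^ n"
    by (rule order_trans[OF gnM]) (intro mult_left_mono power_mono gM; simp)
  note A = Sob_mult[OF f Sob_diff(1)[OF fn gn] \<sigma>] and B = Sob_mult[OF Sob_diff(1)[OF f g] gn \<sigma>]
  have "Sob_norm \<sigma> (\<lambda>x. f x ^ Suc n - g x ^ Suc n) = Sob_norm \<sigma> (\<lambda>x. f x * (f x ^ n - g x ^ n) + (f x - g x) * g x ^ n)"
    by (simp add: algebra_simps)
  also have "\<dots> \<le> Sob_norm \<sigma> (\<lambda>x. f x * (f x ^ n - g x ^ n)) + Sob_norm \<sigma> (\<lambda>x. (f x - g x) * g x ^ n)"
    by (rule Sob_add(2)[OF A(1) B(1)])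
  also have "\<dots> \<le> alg_const \<sigma> * M * (real n * alg_const \<sigma> ^ (n - 1) * M ^ (n - 1) * ?d) + alg_const \<sigma> * ?d * (alg_const \<sigma> ^ (n - 1) * M ^ n)"
    by (intro add_mono order_trans[OF A(2)] order_trans[OF B(2)] mult_mono mult_left_mono mult_nonneg_nonneg zero_le_power fM Suc(2) gnM' M) auto
  also have "\<dots> = real n * (alg_const \<sigma> * alg_const \<sigma> ^ (n - 1)) * (M * M ^ (n - 1)) * ?d + (alg_const \<sigma> * alg_const \<sigma> ^ (n - 1)) * M ^ n * ?d"
    by (simp add: algebra_simps)
  also have "alg_const \<sigma> * alg_const \<sigma> ^ (n - 1) = alg_const \<sigma> ^ n" using Suc(1) by (cases n) auto
  also have "M * M ^ (n - 1) = M ^ n" using Suc(1) by (cases n) auto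
  finally show ?case by (simp add: algebra_simps)
qed

section \<open>Spatial derivatives\<close>

definition dx :: "(real \<Rightarrow> complex) \<Rightarrow> real \<Rightarrow> complex" where
  "dx f = ft (\<lambda>\<xi>. \<i> * \<xi> * hat f \<xi>)"

lemma Hs_deriv:
  assumes F: "Hs (\<sigma> + 1) F"
  shows "Hs \<sigma> (\<lambda>\<xi>. \<i> * \<xi> * F \<xi>)" "hs \<sigma> (\<lambda>\<xi>. \<i> * \<xi> * F \<xi>) \<le> hs (\<sigma> + 1) F"
proof -
  have [measurable]: "F \<in> borel_measurable borel" using F by (rule Hs_measurable)
  have le: "wt \<sigma> \<xi> * cmod (\<i> * \<xi> * F \<xi>) \<le> 1 * (wt (\<sigma> + 1) \<xi> * cmod (F \<xi>))" for \<xi>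
    using abs_le_wt_1[of \<xi>] by (auto simp: norm_mult wt_add intro!: mult_mono)
  show "Hs \<sigma> (\<lambda>\<xi>. \<i> * \<xi> * F \<xi>)" "hs \<sigma> (\<lambda>\<xi>. \<i> * \<xi> * F \<xi>) \<le> hs (\<sigma> + 1) F"
    using Hs_bound[OF F _ _ AE_I2[OF le]] by simp_all
qed

lemma Sob_dx:
  assumes f: "Sob (\<sigma> + 1) f" and \<sigma>: "\<sigma> > 1 / 2"
  shows "Sob \<sigma> (dx f)" "Sob_norm \<sigma> (dx f) \<le> Sob_norm (\<sigma> + 1) f" "AE \<xi> in lborel. hat (dx f) \<xi> = \<i> * \<xi> * hat f \<xi>"
proof -
  note H = Hs_deriv[OF Sob_hat(2)[OF f]]
  note i = Hs_integrable(1)[OF H(1) \<sigma>]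
  note T = Sob_transfer[OF i H(1), of "dx f"]
  show "Sob \<sigma> (dx f)" "AE \<xi> in lborel. hat (dx f) \<xi> = \<i> * \<xi> * hat f \<xi>"
    using T by (simp_all add: dx_def)
  show "Sob_norm \<sigma> (dx f) \<le> Sob_norm (\<sigma> + 1) f" using T(2) H(2) by (simp add: dx_def Sob_norm_def)
qed

lemma has_vector_derivative_iff_quotient:
  fixes f :: "real \<Rightarrow> 'a::real_normed_vector"
  shows "(f has_vector_derivative D) (at x) \<longleftrightarrow> ((\<lambda>h. (f (x + h) - f x) /\<^sub>R h) \<longlongrightarrow> D) (at 0)"
proof -
  have "norm (f (x + h) - f x - h *\<^sub>R D) / norm h = norm ((f (x + h) - f x) /\<^sub>R h - D)" if "h \<noteq> 0" for h
  proof -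
    have "(f (x + h) - f x) /\<^sub>R h - D = (f (x + h) - f x - h *\<^sub>R D) /\<^sub>R h"
      using that by (simp add: scaleR_diff_right)
    then show ?thesis by (simp add: divide_inverse mult.commute)
  qed
  then have "((\<lambda>h. norm (f (x + h) - f x - h *\<^sub>R D) / norm h) \<longlongrightarrow> 0) (at 0)
      \<longleftrightarrow> ((\<lambda>h. norm ((f (x + h) - f x) /\<^sub>R h - D)) \<longlongrightarrow> 0) (at 0)"
    by (intro filterlim_cong refl) (simp add: eventually_at_filter)
  then show ?thesis
    by (simp only: has_vector_derivative_def has_derivative_at bounded_linear_scaleR_left simp_thms
        tendsto_norm_zero_iff LIM_zero_iff)
qed

text \<open>Differentiation under the integral sign: the difference quotient of the exponential is
  bounded by |\<xi>|, and the extra order of regularity makes |\<xi>| times the transform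
  integrable. This links \<open>dx\<close> to the classical derivatives in the notion of
  solution.\<close>

lemma dx_has_vector_derivative:
  assumes f: "Sob (\<sigma> + 1) f" and \<sigma>: "\<sigma> > 1 / 2"
  shows "(f has_vector_derivative dx f x) (at x)"
proof -
  let ?F = "hat f"
  have F: "integrable lborel ?F" by (rule Sob_hat(1)[OF f])
  have [measurable]: "?F \<in> borel_measurable borel" by (rule Sob_measurable_hat[OF f])
  have iF: "integrable lborel (\<lambda>\<xi>. \<i> * \<xi> * ?F \<xi>)"
    by (rule Hs_integrable(1)[OF Hs_deriv(1)[OF Sob_hat(2)[OF f]] \<sigma>])
  have lim: "((\<lambda>h. (f (x + h) - f x) /\<^sub>R h) \<longlongrightarrow> dx f x) (at 0)"
    unfolding tendsto_at_iff_sequentially comp_def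
  proof (intro allI impI)
    fix h :: "nat \<Rightarrow> real"
    assume "\<forall>i. h i \<in> UNIV - {0}" and h0: "h \<longlonglongrightarrow> 0"
    then have hn: "h i \<noteq> 0" for i by auto
    have eq: "(f (x + h i) - f x) /\<^sub>R h i = (LINT \<xi>|lborel. ?F \<xi> * iexp (x * \<xi>) * ((iexp (h i * \<xi>) - 1) /\<^sub>R h i))" for i
    proof -
      have d: "f (x + h i) - f x = (LINT \<xi>|lborel. ?F \<xi> * iexp ((x + h i) * \<xi>) - ?F \<xi> * iexp (x * \<xi>))"
        unfolding Bochner_Integration.integral_diff[OF ft_integrand[OF F] ft_integrand[OF F]] ft_def[symmetric] Sob_hat(3)[OF f] ..
      have "(f (x + h i) - f x) /\<^sub>R h i = (LINT \<xi>|lborel. (?F \<xi> * iexp ((x + h i) * \<xi>) - ?F \<xi> * iexp (x * \<xi>)) /\<^sub>R h i)"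
        unfolding d by (rule integral_scaleR_right[symmetric])
      also have "\<dots> = (LINT \<xi>|lborel. ?F \<xi> * iexp (x * \<xi>) * ((iexp (h i * \<xi>) - 1) /\<^sub>R h i))"
        by (intro Bochner_Integration.integral_cong refl)
          (simp add: distrib_left distrib_right exp_add scaleR_conv_of_real algebra_simps)
      finally show ?thesis .
    qed
    have bound: "cmod ((iexp (h i * \<xi>) - 1) /\<^sub>R h i) \<le> \<bar>\<xi>\<bar>" for i \<xi>
      using iexp_approx1[of "h i * \<xi>" 0] hn[of i] by (simp add: divide_simps abs_mult mult.commute)
    have "(\<lambda>i. LINT \<xi>|lborel. ?F \<xi> * iexp (x * \<xi>) * ((iexp (h i * \<xi>) - 1) /\<^sub>R h i))
        \<longlonglongrightarrow> (LINT \<xi>|lborel. ?F \<xi> * iexp (x * \<xi>) * (\<i> * \<xi>))"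
    proof (rule integral_dominated_convergence[where w = "\<lambda>\<xi>. cmod (\<i> * \<xi> * ?F \<xi>)"])
      show "integrable lborel (\<lambda>\<xi>. cmod (\<i> * \<xi> * ?F \<xi>))" by (rule integrable_norm[OF iF])
      show "AE \<xi> in lborel. (\<lambda>i. ?F \<xi> * iexp (x * \<xi>) * ((iexp (h i * \<xi>) - 1) /\<^sub>R h i)) \<longlonglongrightarrow> ?F \<xi> * iexp (x * \<xi>) * (\<i> * \<xi>)"
      proof (intro AE_I2 tendsto_mult tendsto_const)
        fix \<xi> :: real
        have "((\<lambda>y. y * \<xi>) has_vector_derivative \<xi>) (at 0)" by (auto intro!: derivative_eq_intros)
        from vector_diff_chain_at[OF this has_vector_derivative_iexp]
        have "((\<lambda>y. iexp (y * \<xi>)) has_vector_derivative (\<i> * \<xi>)) (at 0)"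
          by (simp add: comp_def scaleR_conv_of_real mult.commute)
        then have "((\<lambda>h. (iexp (h * \<xi>) - 1) /\<^sub>R h) \<longlongrightarrow> \<i> * \<xi>) (at 0)"
          unfolding has_vector_derivative_iff_quotient by simp
        then show "(\<lambda>i. (iexp (h i * \<xi>) - 1) /\<^sub>R h i) \<longlonglongrightarrow> \<i> * \<xi>"
          using h0 hn unfolding tendsto_at_iff_sequentially comp_def by auto
      qed
      show "AE \<xi> in lborel. cmod (?F \<xi> * iexp (x * \<xi>) * ((iexp (h i * \<xi>) - 1) /\<^sub>R h i)) \<le> cmod (\<i> * \<xi> * ?F \<xi>)" for i
      proof (rule AE_I2)
        fix \<xi>
        show "cmod (?F \<xi> * iexp (x * \<xi>) * ((iexp (h i * \<xi>) - 1) /\<^sub>R h i)) \<le> cmod (\<i> * \<xi> * ?F \<xi>)"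
          using mult_left_mono[OF bound[of i \<xi>], of "cmod (?F \<xi>)"] by (simp add: norm_mult mult_ac)
      qed
    qed measurable
    moreover have "(LINT \<xi>|lborel. ?F \<xi> * iexp (x * \<xi>) * (\<i> * \<xi>)) = dx f x"
      unfolding dx_def ft_def by (intro Bochner_Integration.integral_cong refl) (simp add: mult_ac)
    ultimately show "(\<lambda>i. (f (x + h i) - f x) /\<^sub>R h i) \<longlonglongrightarrow> dx f x" unfolding eq by simp
  qed
  then show ?thesis unfolding has_vector_derivative_iff_quotient .
qed

text \<open>Uniqueness of derivatives transfers the classical calculus rules to \<open>dx\<close>,
  so that no product rule has to be proved for convolutions.\<close>

lemma dx_eqI:
  assumes f: "Sob (\<sigma> + 1) f" and \<sigma>: "\<sigma> > 1 / 2"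
    and d: "\<And>x. (f has_vector_derivative g x) (at x)"
  shows "dx f = g"
  using vector_derivative_unique_at[OF dx_has_vector_derivative[OF f \<sigma>] d] by auto

lemma dx_diff:
  assumes f: "Sob (\<sigma> + 1) f" and g: "Sob (\<sigma> + 1) g" and \<sigma>: "\<sigma> > 1 / 2"
  shows "dx (\<lambda>x. f x - g x) = (\<lambda>x. dx f x - dx g x)"
  by (intro dx_eqI[OF Sob_diff(1)[OF f g] \<sigma>] has_vector_derivative_diff dx_has_vector_derivative[OF _ \<sigma>] f g)

lemma dx_add:
  assumes f: "Sob (\<sigma> + 1) f" and g: "Sob (\<sigma> + 1) g" and \<sigma>: "\<sigma> > 1 / 2"
  shows "dx (\<lambda>x. f x + g x) = (\<lambda>x. dx f x + dx g x)"
  by (intro dx_eqI[OF Sob_add(1)[OF f g] \<sigma>] has_vector_derivative_add dx_has_vector_derivative[OF _ \<sigma>] f g)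

lemma dx_power:
  assumes f: "Sob (\<sigma> + 1) f" and \<sigma>: "\<sigma> > 1 / 2"
  shows "dx (\<lambda>x. f x ^ Suc n) = (\<lambda>x. of_nat (Suc n) * f x ^ n * dx f x)"
proof -
  have \<sigma>1: "\<sigma> + 1 > 1 / 2" using \<sigma> by simp
  have D: "((\<lambda>x. f x ^ Suc n) has_vector_derivative of_nat (Suc n) * f x ^ n * dx f x) (at x)" for x
  proof (induction n)
    case 0 then show ?case using dx_has_vector_derivative[OF f \<sigma>] by simp
  next
    case (Suc n)
    from has_vector_derivative_mult[OF dx_has_vector_derivative[OF f \<sigma>, of x] Suc]
    show ?case by (simp add: algebra_simps)
  qed
  have "Sob (\<sigma> + 1) (\<lambda>x. f x ^ Suc n)" using Sob_power[OF f \<sigma>1, of "Suc n"] by simp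
  from dx_eqI[OF this \<sigma> D] show ?thesis .
qed

section \<open>Fourier multipliers and the symmetry of real functions\<close>

definition fmult :: "(real \<Rightarrow> real) \<Rightarrow> (real \<Rightarrow> complex) \<Rightarrow> real \<Rightarrow> complex" where
  "fmult m f = ft (\<lambda>\<xi>. m \<xi> * hat f \<xi>)"

lemma Sob_fmult:
  assumes f: "Sob \<sigma> f" and [measurable]: "m \<in> borel_measurable borel" and m: "\<And>\<xi>. \<bar>m \<xi>\<bar> \<le> A"
  shows "Sob \<sigma> (fmult m f)" "Sob_norm \<sigma> (fmult m f) \<le> A * Sob_norm \<sigma> f" "AE \<xi> in lborel. hat (fmult m f) \<xi> = m \<xi> * hat f \<xi>"
proof -
  have A: "0 \<le> A" using m[of 0] by linarith
  have [measurable]: "hat f \<in> borel_measurable borel" by (rule Sob_measurable_hat[OF f])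
  have le: "cmod (m \<xi> * hat f \<xi>) \<le> A * cmod (hat f \<xi>)" for \<xi>
    using mult_right_mono[OF m] by (simp add: norm_mult)
  have i: "integrable lborel (\<lambda>\<xi>. m \<xi> * hat f \<xi>)"
  proof (rule Bochner_Integration.integrable_bound)
    show "integrable lborel (\<lambda>\<xi>. A * cmod (hat f \<xi>))" using integrable_norm[OF Sob_hat(1)[OF f]] by simp
    show "AE \<xi> in lborel. norm (m \<xi> * hat f \<xi>) \<le> norm (A * cmod (hat f \<xi>))"
      using le by (intro AE_I2) (auto intro: order_trans abs_ge_self)
  qed measurable
  have le': "wt \<sigma> \<xi> * cmod (m \<xi> * hat f \<xi>) \<le> A * (wt \<sigma> \<xi> * cmod (hat f \<xi>))" for \<xi>
    using mult_left_mono[OF le, of "wt \<sigma> \<xi>" \<xi>] by (simp add: mult_ac)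
  have "(\<lambda>\<xi>. m \<xi> * hat f \<xi>) \<in> borel_measurable borel" by measurable
  note H = Hs_bound[OF Sob_hat(2)[OF f] this A AE_I2[OF le']]
  note T = Sob_transfer[OF i H(1), of "fmult m f"]
  show "Sob \<sigma> (fmult m f)" "AE \<xi> in lborel. hat (fmult m f) \<xi> = m \<xi> * hat f \<xi>"
    using T by (simp_all add: fmult_def)
  show "Sob_norm \<sigma> (fmult m f) \<le> A * Sob_norm \<sigma> f" using T(2) H(2) by (simp add: fmult_def Sob_norm_def)
qed

text \<open>Reflecting and conjugating a frequency function conjugates its transform; for a real
  function injectivity then gives the symmetry, which \<open>cconv_symmetric_form\<close> requires
  of the coefficient.\<close>

lemma hat_hermitian:
  assumes f: "Sob \<sigma> f" and r: "\<And>x. cnj (f x) = f x"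
  shows "AE \<xi> in lborel. hat f (- \<xi>) = cnj (hat f \<xi>)"
proof -
  have i: "integrable lborel (\<lambda>\<xi>. cnj (hat f (- \<xi>)))"
    using Sob_hat(1)[OF f] lborel_integrable_real_affine_iff[of "-1" "hat f" 0] by simp
  have "AE \<xi> in lborel. cnj (hat f (- \<xi>)) = hat f \<xi>"
    by (rule ft_inj_eq[OF i Sob_hat(1)[OF f]]) (simp only: ft_cnj_reflect Sob_hat(3)[OF f] r)
  then show ?thesis by eventually_elim (metis complex_cnj_cnj)
qed

subsection \<open>The energy inequality at a fixed time\<close>

definition flux :: "nat \<Rightarrow> (real \<Rightarrow> complex) \<Rightarrow> real \<Rightarrow> complex" where
  "flux p f x = f x + f x ^ (p + 1)"

lemma Sob_flux:
  assumes f: "Sob \<sigma> f" and \<sigma>: "\<sigma> > 1 / 2"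
  shows "Sob \<sigma> (flux p f)" "Sob_norm \<sigma> (flux p f) \<le> Sob_norm \<sigma> f + alg_const \<sigma> ^ p * Sob_norm \<sigma> f ^ (p + 1)"
  using Sob_power[OF f \<sigma>, of "p + 1"] Sob_add(1,2)[OF f, of "\<lambda>x. f x ^ (p + 1)"]
  by (fastforce simp: flux_def[abs_def])+

lemma dx_flux:
  assumes f: "Sob (\<sigma> + 1) f" and \<sigma>: "\<sigma> > 1 / 2"
  shows "dx (flux p f) = (\<lambda>x. dx f x + of_nat (p + 1) * f x ^ p * dx f x)"
proof -
  have "Sob (\<sigma> + 1) (\<lambda>x. f x ^ Suc p)" using Sob_power[OF f _, of "Suc p"] \<sigma> by simp
  from dx_add[OF f this \<sigma>] dx_power[OF f \<sigma>, of p] show ?thesis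
    by (simp add: flux_def[abs_def])
qed

text \<open>With $g(y) = y + y^{p+1}$, this is the transform of $g'(v) - 1$.\<close>

definition wave_coeff :: "nat \<Rightarrow> (real \<Rightarrow> complex) \<Rightarrow> real \<Rightarrow> complex" where
  "wave_coeff p v \<xi> = of_nat (p + 1) * hat (\<lambda>x. v x ^ p) \<xi>"

lemma wave_coeff:
  assumes v: "Sob \<sigma> v" and \<sigma>: "\<sigma> > 1 / 2" and p: "p \<ge> 1"
  shows "integrable lborel (wave_coeff p v)" "Hs \<sigma> (wave_coeff p v)"
    "hs \<sigma> (wave_coeff p v) \<le> real (p + 1) * (alg_const \<sigma> ^ (p - 1) * Sob_norm \<sigma> v ^ p)"
    "l1 (wave_coeff p v) \<le> emb_const \<sigma> * (real (p + 1) * (alg_const \<sigma> ^ (p - 1) * Sob_norm \<sigma> v ^ p))"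
proof -
  note P = Sob_power[OF v \<sigma> p]
  have Xp: "Sob \<sigma> (\<lambda>x. v x ^ p)" using P by simp
  have eq: "wave_coeff p v = (\<lambda>\<xi>. of_nat (p + 1) * hat (\<lambda>x. v x ^ p) \<xi>)" by (rule ext) (rule wave_coeff_def)
  note H = Hs_scale[OF Sob_hat(2)[OF Xp], of "of_nat (p + 1)"]
  show h: "Hs \<sigma> (wave_coeff p v)" unfolding eq by (rule H(1))
  show "integrable lborel (wave_coeff p v)" by (rule Hs_integrable(1)[OF h \<sigma>])
  have "hs \<sigma> (wave_coeff p v) = real (p + 1) * Sob_norm \<sigma> (\<lambda>x. v x ^ p)"
    unfolding eq H(2) Sob_norm_def norm_of_nat ..
  also have "\<dots> \<le> real (p + 1) * (alg_const \<sigma> ^ (p - 1) * Sob_norm \<sigma> v ^ p)"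
    using P by (intro mult_left_mono) auto
  finally show le: "hs \<sigma> (wave_coeff p v) \<le> real (p + 1) * (alg_const \<sigma> ^ (p - 1) * Sob_norm \<sigma> v ^ p)" .
  show "l1 (wave_coeff p v) \<le> emb_const \<sigma> * (real (p + 1) * (alg_const \<sigma> ^ (p - 1) * Sob_norm \<sigma> v ^ p))"
    by (rule order_trans[OF Hs_integrable(2)[OF h \<sigma>] mult_left_mono[OF le]]) simp
qed

text \<open>The value which the two equations prescribe for the time derivative of \<Lambda>^s E, on
  the Fourier side.\<close>

abbreviation weighted_rhs :: "real \<Rightarrow> (real \<Rightarrow> real) \<Rightarrow> nat \<Rightarrow> (real \<Rightarrow> complex) \<Rightarrow> (real \<Rightarrow> complex) \<Rightarrow> real \<Rightarrow> complex" where
  "weighted_rhs s m p v u \<equiv> \<lambda>\<xi>. - (wtc s \<xi> * (m \<xi> * hat (dx (flux p v)) \<xi> - hat (dx (flux p u)) \<xi>))"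

text \<open>The point of the lemma is that the contribution \<open>\<i> * \<xi> * Se \<xi>\<close> of highest order drops out
  of \<open>Re (Se \<xi> * cnj (D \<xi>))\<close>, because the multiplier \<open>m\<close> is real.\<close>

lemma energy_inequality:
  fixes s A M N d :: real and p :: nat and v u :: "real \<Rightarrow> complex" and m :: "real \<Rightarrow> real"
  defines "q0 \<equiv> real (p + 1) * (alg_const s ^ (p - 1) * M ^ p)"
  defines "r2 \<equiv> real (p + 1) * (alg_const s * (real p * alg_const s ^ (p - 1) * M ^ (p - 1)) * N)"
  defines "K \<equiv> (1 + 2 * (emb_const s * q0)) * (A * (4 * commutator_const s * emb_const (s - 1) * q0 + r2) + 1)"
  defines "e \<equiv> \<lambda>\<xi>. wtc s \<xi> * (hat v \<xi> - hat u \<xi>)"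
  defines "Se \<equiv> \<lambda>\<xi>. e \<xi> + cconv (wave_coeff p v) e \<xi>"
  defines "D \<equiv> weighted_rhs s m p v u"
  assumes s: "s > 3 / 2" and p: "p \<ge> 1" and v: "Sob (s + 1) v" and u: "Sob (s + 1) u"
    and vM: "Sob_norm s v \<le> M" and uM: "Sob_norm s u \<le> M" and uN: "Sob_norm (s + 1) u \<le> N"
    and m [measurable]: "m \<in> borel_measurable borel" and mA: "\<And>\<xi>. \<bar>m \<xi>\<bar> \<le> A"
    and d: "hs s (\<lambda>\<xi>. complex_of_real (m \<xi> - 1) * hat (dx (flux p u)) \<xi>) \<le> d"
  shows "sq_int D" "sq_int Se" "Re (LINT \<xi>|lborel. Se \<xi> * cnj (D \<xi>)) \<le> K * l2 e * (l2 e + d)"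
proof -
  have s1: "s > 1 / 2" using s by simp
  have s2: "s + 1 > 1 / 2" using s by simp
  have A: "0 \<le> A" using mA[of 0] by linarith
  have M: "0 \<le> M" using vM Sob_norm_nonneg[of s v] by linarith
  have N: "0 \<le> N" using uN Sob_norm_nonneg[of "s + 1" u] by linarith
  have vs: "Sob s v" and us: "Sob s u" using Sob_mono(1)[OF v, of s] Sob_mono(1)[OF u, of s] by auto
  have d0: "0 \<le> d" using d hs_nonneg order_trans by blast
  define E where "E x = v x - u x" for x
  define Z where "Z \<xi> = hat v \<xi> - hat u \<xi>" for \<xi>
  define Q where "Q = wave_coeff p v"
  \<comment> \<open>The part of the flux difference in which the coefficients differ. It contains no
    derivative of \<open>E\<close>, but a derivative of \<open>u\<close>, and so costs the norm of
    \<open>u\<close> of order s + 1.\<close>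
  define W where "W x = of_nat (p + 1) * ((v x ^ p - u x ^ p) * dx u x)" for x
  have [measurable]: "hat v \<in> borel_measurable borel" "hat u \<in> borel_measurable borel"
    using Sob_measurable_hat v u by auto
  have E1: "Sob (s + 1) E" and EZ: "AE \<xi> in lborel. hat E \<xi> = Z \<xi>"
    using Sob_diff[OF v u] by (auto simp: E_def[abs_def] Z_def)
  have ZH: "Hs s Z" unfolding Z_def by (rule Hs_diff(1)[OF Sob_hat(2)[OF vs] Sob_hat(2)[OF us]])
  have Zm [measurable]: "Z \<in> borel_measurable borel" by (rule Hs_measurable[OF ZH])
  have e_eq: "e = (\<lambda>\<xi>. wtc s \<xi> * Z \<xi>)" by (simp add: e_def Z_def)
  have es: "sq_int e" and el: "l2 e = hs s Z" unfolding e_eq using Hs_sq[OF ZH] by (auto simp: hs_def)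
  have nmE: "Sob_norm s (\<lambda>x. v x - u x) = l2 e"
    unfolding el Sob_norm_def using Hs_cong_AE(2)[OF ZH Sob_measurable_hat[OF E1] EZ] by (simp add: E_def[abs_def])
  note Qi = wave_coeff(1,2)[OF vs s1 p, folded Q_def]
  have q0: "real (p + 1) * (alg_const s ^ (p - 1) * Sob_norm s v ^ p) \<le> q0"
    unfolding q0_def by (intro mult_left_mono power_mono vM) auto
  have Qh: "hs s Q \<le> q0" using order_trans[OF wave_coeff(3)[OF vs s1 p] q0] by (simp add: Q_def)
  have Ql: "l1 Q \<le> emb_const s * q0"
    using order_trans[OF wave_coeff(4)[OF vs s1 p] mult_left_mono[OF q0 emb_const_nonneg]] by (simp add: Q_def)
  have Qs: "sq_int Q" using Hs_mono(1)[OF Qi(2), of 0] s by (simp add: Hs_0)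
  note Ce = sq_int_cconv[OF Qi(1) es]
  show Ses: "sq_int Se" unfolding Se_def Q_def[symmetric] by (rule sq_int_add(1)[OF es Ce(1)])
  have "l2 Se \<le> l2 e + 2 * l1 Q * l2 e"
    unfolding Se_def Q_def[symmetric] using sq_int_add(2)[OF es Ce(1)] Ce(2) by linarith
  also have "\<dots> \<le> l2 e + 2 * (emb_const s * q0) * l2 e"
    by (intro add_left_mono mult_right_mono mult_left_mono Ql) auto
  finally have Sel: "l2 Se \<le> (1 + 2 * (emb_const s * q0)) * l2 e" by (simp add: algebra_simps)

  have vp: "Sob s (\<lambda>x. v x ^ p)" and up: "Sob s (\<lambda>x. u x ^ p)" using Sob_power[OF vs s1 p] Sob_power[OF us s1 p] by auto
  note dE = Sob_dx[OF E1 s1] and du = Sob_dx[OF u s1]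
  note P1 = Sob_mult[OF vp dE(1) s1]
  note W1 = Sob_mult[OF Sob_diff(1)[OF vp up] du(1) s1]
  have WX: "Sob s W" and Wn: "Sob_norm s W \<le> r2 * l2 e"
  proof -
    note Sc = Sob_scale(1,2)[OF W1(1), of "of_nat (p + 1)"]
    show "Sob s W" using Sc(1) by (simp add: W_def[abs_def])
    have "Sob_norm s W = real (p + 1) * Sob_norm s (\<lambda>x. (v x ^ p - u x ^ p) * dx u x)"
      using Sc(2) unfolding W_def[abs_def] norm_of_nat .
    also have "\<dots> \<le> real (p + 1) * (alg_const s * (real p * alg_const s ^ (p - 1) * M ^ (p - 1) * l2 e) * N)"
    proof (intro mult_left_mono order_trans[OF W1(2)] mult_mono)
      show "Sob_norm s (\<lambda>x. v x ^ p - u x ^ p) \<le> real p * alg_const s ^ (p - 1) * M ^ (p - 1) * l2 e"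
        using Sob_power_diff[OF vs us s1 p vM uM] nmE by simp
      show "Sob_norm s (dx u) \<le> N" using du(2) uN by linarith
    qed (use M in auto)
    also have "\<dots> = r2 * l2 e" by (simp add: r2_def)
    finally show "Sob_norm s W \<le> r2 * l2 e" .
  qed

  \<comment> \<open>The derivative of \<open>E\<close> is given the coefficient built from
    \<open>v\<close>, and the remainder the derivative of \<open>u\<close>. With this choice no norm
    of \<open>v\<close> above order s enters the constants.\<close>
  have phys: "dx (flux p v) x - dx (flux p u) x = (dx E x + of_nat (p + 1) * (v x ^ p * dx E x)) + W x" for x
  proof -
    have "dx v x = dx E x + dx u x" using dx_diff[OF v u s1] by (simp add: E_def[abs_def])
    then show ?thesis
      unfolding dx_flux[OF v s1] dx_flux[OF u s1] W_def by (simp add: algebra_simps)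
  qed
  have fv: "Sob (s + 1) (flux p v)" and fu: "Sob (s + 1) (flux p u)" using Sob_flux(1) v u s2 by auto
  note dfv = Sob_dx[OF fv s1] and dfu = Sob_dx[OF fu s1]
  note P2 = Sob_scale[OF P1(1), of "of_nat (p + 1)"]
  note P3 = Sob_add[OF dE(1) P2(1)]
  note P4 = Sob_add[OF P3(1) WX]
  define iZ where "iZ \<eta> = \<i> * \<eta> * Z \<eta>" for \<eta> :: real
  have iZm [measurable]: "iZ \<in> borel_measurable borel" unfolding iZ_def by measurable
  have conv_eq: "of_nat (p + 1) * cconv (hat (\<lambda>x. v x ^ p)) (hat (dx E)) \<xi> = cconv Q iZ \<xi>" for \<xi>
  proof -
    have m1: "hat (dx E) \<in> borel_measurable borel" "hat (\<lambda>x. v x ^ p) \<in> borel_measurable borel"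
      using Sob_measurable_hat[OF dE(1)] Sob_measurable_hat[OF vp] by auto
    note [measurable] = m1
    have "AE \<eta> in lborel. hat (dx E) \<eta> = iZ \<eta>"
      using dE(3) EZ by eventually_elim (simp add: iZ_def)
    then have "cconv (hat (\<lambda>x. v x ^ p)) (hat (dx E)) \<xi> = cconv (hat (\<lambda>x. v x ^ p)) iZ \<xi>"
      unfolding cconv_def by (intro integral_cong_AE) (measurable, auto)
    moreover have "of_nat (p + 1) * cconv (hat (\<lambda>x. v x ^ p)) iZ \<xi> = cconv Q iZ \<xi>"
      unfolding cconv_def Q_def wave_coeff_def integral_mult_right_zero[symmetric] by (simp only: mult.assoc)
    ultimately show ?thesis by simp
  qed
  have four: "AE \<xi> in lborel. hat (dx (flux p v)) \<xi> - hat (dx (flux p u)) \<xi> = iZ \<xi> + cconv Q iZ \<xi> + hat W \<xi>"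
  proof -
    have eqf: "(\<lambda>x. dx (flux p v) x - dx (flux p u) x) = (\<lambda>x. (dx E x + of_nat (p + 1) * (v x ^ p * dx E x)) + W x)"
      using phys by auto
    show ?thesis
      using Sob_diff(3)[OF dfv(1) dfu(1), unfolded eqf] P4(3) P3(3) P2(3) P1(3) dE(3) EZ
      by eventually_elim (simp add: conv_eq[unfolded Suc_eq_plus1[symmetric]] iZ_def del: of_nat_add of_nat_Suc)
  qed
  \<comment> \<open>The commutator of \<Lambda>^s with the coefficient in divergence form: the outer
    factor \<xi> acts on the whole convolution, as the antisymmetric term needs it.\<close>
  define R1 where "R1 \<xi> = wtc s \<xi> * cconv Q iZ \<xi> - \<i> * \<xi> * cconv Q e \<xi>" for \<xi> :: real
  note comm = commutator_bound[OF Qi(2) ZH s]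
  have R1s: "sq_int R1" and R1l: "l2 R1 \<le> 4 * commutator_const s * emb_const (s - 1) * q0 * l2 e"
  proof -
    have R1eq: "R1 = (\<lambda>\<xi>. wtc s \<xi> * cconv Q (\<lambda>\<eta>. \<i> * \<eta> * Z \<eta>) \<xi> - \<i> * \<xi> * cconv Q (\<lambda>\<eta>. wtc s \<eta> * Z \<eta>) \<xi>)"
      by (simp add: R1_def[abs_def] iZ_def[abs_def] e_eq)
    show "sq_int R1" unfolding R1eq by (rule comm(1))
    have "0 \<le> commutator_const s" using s by (simp add: commutator_const_def)
    then show "l2 R1 \<le> 4 * commutator_const s * emb_const (s - 1) * q0 * l2 e"
      unfolding R1eq el by (intro order_trans[OF comm(2)] mult_right_mono mult_left_mono Qh) auto
  qed
  define R2 where "R2 \<xi> = wtc s \<xi> * hat W \<xi>" for \<xi>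
  have R2s: "sq_int R2" unfolding R2_def by (rule Hs_sq[OF Sob_hat(2)[OF WX]])
  have R2l: "l2 R2 \<le> r2 * l2 e" using Wn by (simp add: R2_def[abs_def] Sob_norm_def hs_def)
  \<comment> \<open>The consistency error: the nonlocal operator minus the identity, applied to the
    flux of the reference solution.\<close>
  define F where "F \<xi> = wtc s \<xi> * (complex_of_real (m \<xi> - 1) * hat (dx (flux p u)) \<xi>)" for \<xi>
  have [measurable]: "hat (dx (flux p u)) \<in> borel_measurable borel" "hat (dx (flux p v)) \<in> borel_measurable borel"
    using Sob_measurable_hat[OF dfu(1)] Sob_measurable_hat[OF dfv(1)] by auto
  have m1: "\<bar>m \<xi> - 1\<bar> \<le> A + 1" for \<xi> using mA[of \<xi>] by linarith
  have Fs: "sq_int F"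
  proof (rule sq_int_bound(1)[OF Hs_sq[OF Sob_hat(2)[OF dfu(1)]]])
    show "F \<in> borel_measurable borel" unfolding F_def by measurable
    show "AE \<xi> in lborel. cmod (F \<xi>) \<le> (A + 1) * cmod (wtc s \<xi> * hat (dx (flux p u)) \<xi>)"
    proof (rule AE_I2)
      fix \<xi>
      have "cmod (F \<xi>) = \<bar>m \<xi> - 1\<bar> * cmod (wtc s \<xi> * hat (dx (flux p u)) \<xi>)"
        unfolding F_def norm_mult norm_of_real by simp
      then show "cmod (F \<xi>) \<le> (A + 1) * cmod (wtc s \<xi> * hat (dx (flux p u)) \<xi>)"
        using mult_right_mono[OF m1] by simp
    qed
  qed (use A in simp)
  have Fl: "l2 F \<le> d" using d by (simp add: F_def[abs_def] hs_def)
  show Ds: "sq_int D"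
  proof -
    have a: "sq_int (\<lambda>\<xi>. m \<xi> * (wtc s \<xi> * hat (dx (flux p v)) \<xi>))"
    proof (rule sq_int_bound(1)[OF Hs_sq[OF Sob_hat(2)[OF dfv(1)]] _ _ A])
      show "AE \<xi> in lborel. cmod (m \<xi> * (wtc s \<xi> * hat (dx (flux p v)) \<xi>)) \<le> A * cmod (wtc s \<xi> * hat (dx (flux p v)) \<xi>)"
        unfolding norm_mult norm_of_real by (intro AE_I2 mult_right_mono mA) simp
    qed measurable
    have "D = (\<lambda>\<xi>. wtc s \<xi> * hat (dx (flux p u)) \<xi> - m \<xi> * (wtc s \<xi> * hat (dx (flux p v)) \<xi>))"
      by (auto simp: D_def algebra_simps)
    then show ?thesis using sq_int_diff(1)[OF Hs_sq[OF Sob_hat(2)[OF dfu(1)]] a] by simp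
  qed
  define B where "B \<xi> = m \<xi> * (R1 \<xi> + R2 \<xi>) + F \<xi>" for \<xi>
  have [measurable]: "R1 \<in> borel_measurable borel" "R2 \<in> borel_measurable borel" "Se \<in> borel_measurable borel"
     "D \<in> borel_measurable borel" "F \<in> borel_measurable borel"
    using R1s R2s Ses Ds Fs by auto
  have mR: "sq_int (\<lambda>\<xi>. m \<xi> * (R1 \<xi> + R2 \<xi>))" "l2 (\<lambda>\<xi>. m \<xi> * (R1 \<xi> + R2 \<xi>)) \<le> A * l2 (\<lambda>\<xi>. R1 \<xi> + R2 \<xi>)"
  proof -
    have "AE \<xi> in lborel. cmod (m \<xi> * (R1 \<xi> + R2 \<xi>)) \<le> A * cmod (R1 \<xi> + R2 \<xi>)"
      unfolding norm_mult norm_of_real by (intro AE_I2 mult_right_mono mA) simp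
    moreover have "(\<lambda>\<xi>. m \<xi> * (R1 \<xi> + R2 \<xi>)) \<in> borel_measurable borel" by measurable
    ultimately show "sq_int (\<lambda>\<xi>. m \<xi> * (R1 \<xi> + R2 \<xi>))" "l2 (\<lambda>\<xi>. m \<xi> * (R1 \<xi> + R2 \<xi>)) \<le> A * l2 (\<lambda>\<xi>. R1 \<xi> + R2 \<xi>)"
      using sq_int_bound[OF sq_int_add(1)[OF R1s R2s] _ _ A] by blast+
  qed
  have Bs: "sq_int B" unfolding B_def by (rule sq_int_add(1)[OF mR(1) Fs])
  have "l2 B \<le> A * (l2 R1 + l2 R2) + d"
    using sq_int_add(2)[OF mR(1) Fs] mR(2) Fl mult_left_mono[OF sq_int_add(2)[OF R1s R2s] A]
    unfolding B_def by linarith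
  also have "\<dots> \<le> A * (4 * commutator_const s * emb_const (s - 1) * q0 * l2 e + r2 * l2 e) + d"
    by (intro add_right_mono mult_left_mono add_mono R1l R2l A)
  also have "\<dots> \<le> (A * (4 * commutator_const s * emb_const (s - 1) * q0 + r2) + 1) * (l2 e + d)"
  proof -
    have "0 \<le> 4 * commutator_const s * emb_const (s - 1) * q0 + r2"
      using s M N by (auto simp: commutator_const_def q0_def r2_def intro!: add_nonneg_nonneg mult_nonneg_nonneg)
    then have "0 \<le> A * (4 * commutator_const s * emb_const (s - 1) * q0 + r2) * d" using A d0 by simp
    then show ?thesis using l2_nonneg[of e] by (simp add: algebra_simps)
  qed
  finally have Bl: "l2 B \<le> (A * (4 * commutator_const s * emb_const (s - 1) * q0 + r2) + 1) * (l2 e + d)" .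
  have "Re (LINT \<xi>|lborel. Se \<xi> * cnj (D \<xi>)) = (LINT \<xi>|lborel. Re (Se \<xi> * cnj (D \<xi>)))"
    by (rule integral_Re[symmetric]) (rule sq_int_mult[OF Ses sq_int_cnj[OF Ds]])
  also have "\<dots> = (LINT \<xi>|lborel. Re (Se \<xi> * cnj (- B \<xi>)))"
  proof (rule integral_cong_AE)
    have [measurable]: "B \<in> borel_measurable borel" using Bs by auto
    show "(\<lambda>\<xi>. Re (Se \<xi> * cnj (D \<xi>))) \<in> borel_measurable lborel" "(\<lambda>\<xi>. Re (Se \<xi> * cnj (- B \<xi>))) \<in> borel_measurable lborel"
      by measurable
    show "AE \<xi> in lborel. Re (Se \<xi> * cnj (D \<xi>)) = Re (Se \<xi> * cnj (- B \<xi>))"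
      using four
    proof eventually_elim
      case (elim \<xi>)
      \<comment> \<open>The constant part and the variable part of \<open>q\<close> combine, so that
        the top order is exactly \<open>\<i> * \<xi> * Se \<xi>\<close>, with \<open>Se\<close> the
        transform of q \<Lambda>^s E.\<close>
      have a: "wtc s \<xi> * (iZ \<xi> + cconv Q iZ \<xi> + hat W \<xi>) = \<i> * \<xi> * Se \<xi> + R1 \<xi> + R2 \<xi>"
        unfolding R1_def R2_def Se_def Q_def[symmetric] by (simp add: e_eq iZ_def algebra_simps)
      have b: "D \<xi> = - (m \<xi> * (wtc s \<xi> * (hat (dx (flux p v)) \<xi> - hat (dx (flux p u)) \<xi>))) - F \<xi>"
        by (simp add: D_def F_def algebra_simps)
      have "D \<xi> = - (m \<xi> * (\<i> * \<xi> * Se \<xi>)) - B \<xi>"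
        using b unfolding elim a by (simp only: B_def distrib_left) simp
      moreover have "Re (Se \<xi> * cnj (m \<xi> * (\<i> * \<xi> * Se \<xi>))) = 0"
        by (simp add: algebra_simps)
      ultimately show ?case by (simp add: right_diff_distrib)
    qed
  qed
  also have "\<dots> = Re (LINT \<xi>|lborel. Se \<xi> * cnj (- B \<xi>))"
    by (rule integral_Re) (rule sq_int_mult[OF Ses sq_int_cnj], use sq_int_scale(1)[OF Bs, of "-1"] in simp)
  also have "\<dots> \<le> cmod (LINT \<xi>|lborel. Se \<xi> * cnj (- B \<xi>))" by (rule complex_Re_le_cmod)
  also have "\<dots> \<le> l2 Se * l2 B"
    using Cauchy_Schwarz_norm[OF Ses sq_int_cnj[OF sq_int_scale(1)[OF Bs, of "-1"]]] sq_int_scale(2)[OF Bs, of "-1"]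
    by (simp add: l2_cnj[of "\<lambda>x. - B x", simplified])
  also have "\<dots> \<le> ((1 + 2 * (emb_const s * q0)) * l2 e) * ((A * (4 * commutator_const s * emb_const (s - 1) * q0 + r2) + 1) * (l2 e + d))"
    by (rule mult_mono[OF Sel Bl]) (use order_trans[OF l2_nonneg Sel] in auto)
  also have "\<dots> = K * l2 e * (l2 e + d)" by (simp add: K_def)
  finally show "Re (LINT \<xi>|lborel. Se \<xi> * cnj (D \<xi>)) \<le> K * l2 e * (l2 e + d)" .
qed

subsection \<open>The energy form\<close>

text \<open>The real part of the pairing of q e with f, where \<open>Q\<close> is the transform of q
  - 1. The constant 1 has no integrable transform and is therefore kept apart from the
  convolution.\<close>

definition eform :: "(real \<Rightarrow> complex) \<Rightarrow> (real \<Rightarrow> complex) \<Rightarrow> (real \<Rightarrow> complex) \<Rightarrow> real" where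
  "eform Q e f = Re (LINT \<xi>|lborel. (e \<xi> + cconv Q e \<xi>) * cnj (f \<xi>))"

lemma eform_sq:
  assumes "integrable lborel Q" "sq_int e"
  shows "sq_int (\<lambda>\<xi>. e \<xi> + cconv Q e \<xi>)" "l2 (\<lambda>\<xi>. e \<xi> + cconv Q e \<xi>) \<le> (1 + 2 * l1 Q) * l2 e"
  using sq_int_add[OF assms(2) sq_int_cconv(1)[OF assms]] sq_int_cconv(2)[OF assms]
  by (auto simp: algebra_simps)

lemma eform_bound:
  assumes Q: "integrable lborel Q" and e: "sq_int e" and f: "sq_int f"
  shows "\<bar>eform Q e f\<bar> \<le> (1 + 2 * l1 Q) * l2 e * l2 f"
proof -
  have "\<bar>eform Q e f\<bar> \<le> cmod (LINT \<xi>|lborel. (e \<xi> + cconv Q e \<xi>) * cnj (f \<xi>))"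
    unfolding eform_def by (rule abs_Re_le_cmod)
  also have "\<dots> \<le> l2 (\<lambda>\<xi>. e \<xi> + cconv Q e \<xi>) * l2 f"
    using Cauchy_Schwarz_norm[OF eform_sq(1)[OF Q e] sq_int_cnj[OF f]] by (simp add: l2_cnj)
  also have "\<dots> \<le> (1 + 2 * l1 Q) * l2 e * l2 f"
    by (intro mult_right_mono eform_sq(2)[OF Q e]) simp
  finally show ?thesis .
qed

lemma eform_add_right:
  assumes "integrable lborel Q" "sq_int e" "sq_int f" "sq_int g"
  shows "eform Q e (\<lambda>\<xi>. f \<xi> + g \<xi>) = eform Q e f + eform Q e g"
  unfolding eform_def complex_cnj_add distrib_left
  by (subst Bochner_Integration.integral_add[OF sq_int_mult[OF eform_sq(1)[OF assms(1,2)] sq_int_cnj[OF assms(3)]]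
        sq_int_mult[OF eform_sq(1)[OF assms(1,2)] sq_int_cnj[OF assms(4)]]]) simp

lemma eform_scale_right:
  "eform Q e (\<lambda>\<xi>. complex_of_real c * f \<xi>) = c * eform Q e f"
proof -
  have "(LINT \<xi>|lborel. (e \<xi> + cconv Q e \<xi>) * cnj (complex_of_real c * f \<xi>))
      = complex_of_real c * (LINT \<xi>|lborel. (e \<xi> + cconv Q e \<xi>) * cnj (f \<xi>))"
    unfolding integral_mult_right_zero[symmetric] by (simp add: mult.left_commute)
  then show ?thesis by (simp add: eform_def)
qed

lemma eform_add_left:
  assumes "integrable lborel Q" "sq_int Q" "sq_int e" "sq_int f" "sq_int g"
  shows "eform Q (\<lambda>\<xi>. e \<xi> + f \<xi>) g = eform Q e g + eform Q f g"
proof -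
  have "(LINT \<xi>|lborel. ((e \<xi> + f \<xi>) + cconv Q (\<lambda>\<xi>. e \<xi> + f \<xi>) \<xi>) * cnj (g \<xi>))
    = (LINT \<xi>|lborel. (e \<xi> + cconv Q e \<xi>) * cnj (g \<xi>) + (f \<xi> + cconv Q f \<xi>) * cnj (g \<xi>))"
    by (simp add: cconv_add_right[OF assms(2,3,4)] algebra_simps)
  also have "\<dots> = (LINT \<xi>|lborel. (e \<xi> + cconv Q e \<xi>) * cnj (g \<xi>)) + (LINT \<xi>|lborel. (f \<xi> + cconv Q f \<xi>) * cnj (g \<xi>))"
    by (rule Bochner_Integration.integral_add)
      (rule sq_int_mult[OF eform_sq(1)[OF assms(1)] sq_int_cnj[OF assms(5)]], fact)+
  finally show ?thesis by (simp add: eform_def)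
qed

lemma eform_sym:
  assumes Q: "integrable lborel Q" and e: "sq_int e" and f: "sq_int f"
    and herm: "AE x in lborel. Q (- x) = cnj (Q x)"
  shows "eform Q e f = eform Q f e"
proof -
  have split: "eform Q e f = Re (LINT \<xi>|lborel. e \<xi> * cnj (f \<xi>)) + Re (LINT \<xi>|lborel. cconv Q e \<xi> * cnj (f \<xi>))"
    if e: "sq_int e" and f: "sq_int f" for e f
    unfolding eform_def distrib_right
    by (subst Bochner_Integration.integral_add[OF sq_int_mult[OF e sq_int_cnj[OF f]]
        sq_int_mult[OF sq_int_cconv(1)[OF Q e] sq_int_cnj[OF f]]]) simp
  have "(LINT \<xi>|lborel. e \<xi> * cnj (f \<xi>)) = (LINT \<xi>|lborel. cnj (f \<xi> * cnj (e \<xi>)))" by (simp add: mult.commute)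
  then have 1: "Re (LINT \<xi>|lborel. e \<xi> * cnj (f \<xi>)) = Re (LINT \<xi>|lborel. f \<xi> * cnj (e \<xi>))"
    unfolding Bochner_Integration.integral_cnj by simp
  have 2: "Re (LINT \<xi>|lborel. cconv Q e \<xi> * cnj (f \<xi>)) = Re (LINT \<xi>|lborel. cconv Q f \<xi> * cnj (e \<xi>))"
    unfolding cconv_symmetric_form[OF Q e f herm] by simp
  show ?thesis unfolding split[OF e f] split[OF f e] 1 2 ..
qed

lemma eform_change:
  assumes Q: "integrable lborel Q" "sq_int Q" and P: "integrable lborel P" "sq_int P" and e: "sq_int e" and f: "sq_int f"
  shows "\<bar>eform P e f - eform Q e f\<bar> \<le> 2 * l1 (\<lambda>\<xi>. P \<xi> - Q \<xi>) * l2 e * l2 f"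
proof -
  have i: "integrable lborel (\<lambda>\<xi>. P \<xi> - Q \<xi>)" using P Q by simp
  have "(LINT \<xi>|lborel. (e \<xi> + cconv P e \<xi>) * cnj (f \<xi>)) - (LINT \<xi>|lborel. (e \<xi> + cconv Q e \<xi>) * cnj (f \<xi>))
     = (LINT \<xi>|lborel. (e \<xi> + cconv P e \<xi>) * cnj (f \<xi>) - (e \<xi> + cconv Q e \<xi>) * cnj (f \<xi>))"
    by (rule Bochner_Integration.integral_diff[symmetric])
      (rule sq_int_mult[OF eform_sq(1)[OF _ e] sq_int_cnj[OF f]], fact)+
  also have "\<dots> = (LINT \<xi>|lborel. cconv (\<lambda>\<xi>. P \<xi> - Q \<xi>) e \<xi> * cnj (f \<xi>))"
    by (simp add: cconv_diff_left[OF P(2) Q(2) e] algebra_simps)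
  finally have "\<bar>eform P e f - eform Q e f\<bar> \<le> cmod (LINT \<xi>|lborel. cconv (\<lambda>\<xi>. P \<xi> - Q \<xi>) e \<xi> * cnj (f \<xi>))"
    unfolding eform_def minus_complex.sel(1)[symmetric] by (simp add: abs_Re_le_cmod)
  also have "\<dots> \<le> l2 (cconv (\<lambda>\<xi>. P \<xi> - Q \<xi>) e) * l2 f"
    using Cauchy_Schwarz_norm[OF sq_int_cconv(1)[OF i e] sq_int_cnj[OF f]] by (simp add: l2_cnj)
  also have "\<dots> \<le> 2 * l1 (\<lambda>\<xi>. P \<xi> - Q \<xi>) * l2 e * l2 f"
    by (intro mult_right_mono sq_int_cconv(2)[OF i e]) simp
  finally show ?thesis .
qed

text \<open>A product rule for finite increments: by symmetry the two mixed terms coincide, which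
  leaves the form of the increment with itself and the change of the coefficient. It substitutes for
  differentiating the energy.\<close>

lemma eform_increment:
  assumes Q: "integrable lborel Q" "sq_int Q" and P: "integrable lborel P" "sq_int P" and e: "sq_int e" and f: "sq_int f"
    and herm: "AE x in lborel. Q (- x) = cnj (Q x)"
  shows "\<bar>eform P f f - eform Q e e - 2 * eform Q e (\<lambda>\<xi>. f \<xi> - e \<xi>)\<bar>
    \<le> (1 + 2 * l1 Q) * (l2 (\<lambda>\<xi>. f \<xi> - e \<xi>))\<^sup>2 + 2 * l1 (\<lambda>\<xi>. P \<xi> - Q \<xi>) * (l2 f)\<^sup>2"
proof -
  let ?a = "\<lambda>\<xi>. f \<xi> - e \<xi>"
  have a: "sq_int ?a" by (rule sq_int_diff(1)[OF f e])
  have fe: "(\<lambda>\<xi>. e \<xi> + ?a \<xi>) = f" by (rule ext) simp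
  have "eform Q f f = eform Q e f + eform Q ?a f"
    using eform_add_left[OF Q e a f] unfolding fe .
  moreover have "eform Q e f = eform Q e e + eform Q e ?a"
    using eform_add_right[OF Q(1) e e a] unfolding fe .
  moreover have "eform Q ?a f = eform Q ?a e + eform Q ?a ?a"
    using eform_add_right[OF Q(1) a e a] unfolding fe .
  moreover have "eform Q ?a e = eform Q e ?a" by (rule eform_sym[OF Q(1) a e herm])
  ultimately have "eform P f f - eform Q e e - 2 * eform Q e ?a = eform Q ?a ?a + (eform P f f - eform Q f f)"
    by linarith
  then show ?thesis
    using eform_bound[OF Q(1) a a] eform_change[OF Q P f f] by (simp add: power2_eq_square mult.assoc)
qed

subsection \<open>Two continuation arguments\<close>

text \<open>A local upper bound to the right of each time, with arbitrarily small slack, replaces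
  the derivative. For fixed \<eta> take the supremum of the times up to which the linear bound
  holds: it persists there by continuity, and before \<open>T\<close> the local bound would carry it
  further. Then \<eta> tends to 0.\<close>

lemma Dini_upper_bound:
  fixes f :: "real \<Rightarrow> real"
  assumes T: "0 \<le> T" and cont: "continuous_on {0..T} f"
    and D: "\<And>t \<eta>. 0 \<le> t \<Longrightarrow> t < T \<Longrightarrow> \<eta> > 0 \<Longrightarrow>
      eventually (\<lambda>\<tau>. t < \<tau> \<longrightarrow> f \<tau> \<le> f t + (\<tau> - t) * (m + \<eta>)) (at t within {0..T})"
  shows "f T \<le> f 0 + T * m"
proof -
  have main: "f T \<le> f 0 + T * (m + \<eta>)" if \<eta>: "\<eta> > 0" for \<eta>
  proof -
    let ?P = "\<lambda>t. f t \<le> f 0 + t * (m + \<eta>)"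
    define S where "S = {t \<in> {0..T}. \<forall>t'\<in>{0..t}. ?P t'}"
    have S0: "0 \<in> S" using T by (simp add: S_def)
    have bdd: "bdd_above S" unfolding S_def by (rule bdd_aboveI[of _ T]) auto
    define z where "z = Sup S"
    have z: "0 \<le> z" "z \<le> T"
    proof -
      show "0 \<le> z" unfolding z_def by (rule cSup_upper[OF S0 bdd])
      have "S \<noteq> {}" using S0 by blast
      then show "z \<le> T" unfolding z_def by (rule cSup_least) (simp add: S_def)
    qed
    have below: "?P t" if "0 \<le> t" "t < z" for t
    proof -
      have "S \<noteq> {}" using S0 by blast
      then have "\<exists>y\<in>S. t < y" using that(2) less_cSup_iff[OF _ bdd, of t] unfolding z_def by simp
      then show ?thesis using that(1) by (auto simp: S_def)
    qed
    have Pz: "?P z"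
    proof (cases "z = 0")
      case True then show ?thesis by simp
    next
      case False
      define g where "g t = f t - (f 0 + t * (m + \<eta>))" for t
      have gc: "continuous_on {0..T} g" unfolding g_def by (intro continuous_intros cont)
      have "closed ({0..T} \<inter> g -` {..0})" by (rule continuous_closed_preimage[OF gc]) auto
      moreover have "z \<in> closure ({0..T} \<inter> g -` {..0})"
        unfolding closure_approachable
      proof (intro allI impI)
        fix e :: real assume "e > 0"
        define y where "y = max 0 (z - e / 2)"
        have "0 \<le> y" "y < z" "dist y z < e" using False z \<open>e > 0\<close> by (auto simp: y_def dist_real_def)
        then show "\<exists>y\<in>{0..T} \<inter> g -` {..0}. dist y z < e"
          using below[of y] z by (intro bexI[of _ y]) (auto simp: g_def)
      qed
      ultimately have "z \<in> {0..T} \<inter> g -` {..0}" by (simp add: closure_closed)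
      then show ?thesis by (simp add: g_def)
    qed
    have "z = T"
    proof (rule ccontr)
      assume "z \<noteq> T"
      then have zT: "z < T" using z by simp
      from D[OF z(1) zT \<eta>] obtain d where d: "d > 0"
        and dd: "\<And>\<tau>. \<tau> \<in> {0..T} \<Longrightarrow> \<tau> \<noteq> z \<Longrightarrow> dist \<tau> z < d \<Longrightarrow> z < \<tau> \<longrightarrow> f \<tau> \<le> f z + (\<tau> - z) * (m + \<eta>)"
        unfolding eventually_at by blast
      define y where "y = min T (z + d / 2)"
      have y: "z < y" "y \<le> T" "y - z < d" using zT d by (auto simp: y_def)
      have "?P t" if "t \<in> {0..y}" for t
      proof (cases "t < z")
        case True then show ?thesis using below that by simp
      next
        case False
        show ?thesis
        proof (cases "t = z")
          case True then show ?thesis using Pz by simp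
        next
          case ne: False
          then have "f t \<le> f z + (t - z) * (m + \<eta>)"
            using dd[of t] False that y z by (auto simp: dist_real_def)
          then show ?thesis using Pz by (simp add: algebra_simps)
        qed
      qed
      then have "y \<in> S" using y z by (auto simp: S_def)
      then have "y \<le> z" unfolding z_def by (rule cSup_upper[OF _ bdd])
      then show False using y by simp
    qed
    then show ?thesis using Pz by simp
  qed
  show ?thesis
  proof (rule field_le_epsilon)
    fix e :: real assume e: "e > 0"
    \<comment> \<open>The slack \<open>e / (T + 1)\<close> costs at most \<open>e\<close> over the
      interval; the 1 admits \<open>T = 0\<close>.\<close>
    have "T * (m + e / (T + 1)) \<le> T * m + e"
      using T e by (simp add: field_simps)
    then show "f T \<le> f 0 + T * m + e" using main[of "e / (T + 1)"] T e by simp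
  qed
qed

text \<open>Consider the first time at which \<open>y\<close> reaches \<epsilon>. By the
  intermediate value theorem it equals \<epsilon> there, so the weak bound holds up to and including
  this time, and \<open>step\<close> improves it to a strict one: a contradiction.\<close>

lemma bootstrap_bound:
  fixes y :: "real \<Rightarrow> real"
  assumes cont: "continuous_on {0..T} y" and y0: "y 0 < \<epsilon>"
    and step: "\<And>\<tau>. 0 \<le> \<tau> \<Longrightarrow> \<tau> \<le> T \<Longrightarrow> (\<And>t. 0 \<le> t \<Longrightarrow> t \<le> \<tau> \<Longrightarrow> y t \<le> \<epsilon>) \<Longrightarrow> y \<tau> < \<epsilon>"
    and t: "0 \<le> t" "t \<le> T"
  shows "y t \<le> \<epsilon>"
proof (rule ccontr)
  assume "\<not> y t \<le> \<epsilon>"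
  define Z where "Z = {0..T} \<inter> y -` {\<epsilon>..}"
  have tZ: "t \<in> Z" using t \<open>\<not> y t \<le> \<epsilon>\<close> by (auto simp: Z_def)
  have cl: "closed Z" unfolding Z_def by (rule continuous_closed_preimage[OF cont]) auto
  have bdd: "bdd_below Z" unfolding Z_def by (rule bdd_belowI[of _ 0]) auto
  define z where "z = Inf Z"
  have zZ: "z \<in> Z" unfolding z_def by (rule closed_contains_Inf[OF _ bdd cl]) (use tZ in auto)
  then have z: "0 \<le> z" "z \<le> T" "\<epsilon> \<le> y z" by (auto simp: Z_def)
  have "continuous_on {0..z} y" by (rule continuous_on_subset[OF cont]) (use z in auto)
  then obtain x where x: "0 \<le> x" "x \<le> z" "y x = \<epsilon>"
    using IVT'[of y 0 \<epsilon> z] y0 z by auto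
  then have "x \<in> Z" using z by (auto simp: Z_def)
  then have "z \<le> x" unfolding z_def by (rule cInf_lower[OF _ bdd])
  then have yz: "y z = \<epsilon>" using x by simp
  have "y \<tau> \<le> \<epsilon>" if "0 \<le> \<tau>" "\<tau> \<le> z" for \<tau>
  proof (cases "\<tau> = z")
    case False
    have "\<tau> \<notin> Z" using cInf_lower[OF _ bdd, of \<tau>] that False unfolding z_def by force
    then show ?thesis using that z by (auto simp: Z_def)
  qed (use yz in simp)
  from step[OF z(1,2) this] yz show False by simp
qed

subsection \<open>Evolution of the energy\<close>

text \<open>\<open>m\<close> is the symbol of the convolution operator; \<open>m = 1\<close> gives the local equation.\<close>

definition wave_solution ::
  "(real \<Rightarrow> real) \<Rightarrow> nat \<Rightarrow> real \<Rightarrow> real \<Rightarrow> (real \<Rightarrow> real \<Rightarrow> complex) \<Rightarrow> (real \<Rightarrow> real \<Rightarrow> complex) \<Rightarrow> bool" where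
  "wave_solution m p s T v v' \<longleftrightarrow> (\<forall>t\<in>{0..T}.
     Sob (s + 1) (v t) \<and> Sob s (v' t) \<and> (\<forall>x. cnj (v t x) = v t x) \<and>
     (AE \<xi> in lborel. hat (v' t) \<xi> = - (m \<xi> * hat (dx (flux p (v t))) \<xi>)) \<and>
     ((\<lambda>\<tau>. Sob_norm s (\<lambda>x. v \<tau> x - v t x)) \<longlongrightarrow> 0) (at t within {0..T}) \<and>
     ((\<lambda>\<tau>. Sob_norm s (\<lambda>x. (v \<tau> x - v t x) / complex_of_real (\<tau> - t) - v' t x)) \<longlongrightarrow> 0) (at t within {0..T}))"

definition err :: "real \<Rightarrow> (real \<Rightarrow> complex) \<Rightarrow> (real \<Rightarrow> complex) \<Rightarrow> real \<Rightarrow> complex" where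
  "err s v u \<xi> = wtc s \<xi> * (hat v \<xi> - hat u \<xi>)"

lemma err:
  assumes v: "Sob s v" and u: "Sob s u"
  shows "sq_int (err s v u)" "l2 (err s v u) = Sob_norm s (\<lambda>x. v x - u x)"
proof -
  have H: "Hs s (\<lambda>\<xi>. hat v \<xi> - hat u \<xi>)" by (rule Hs_diff(1)[OF Sob_hat(2)[OF v] Sob_hat(2)[OF u]])
  show "sq_int (err s v u)" unfolding err_def using Hs_sq[OF H] .
  show "l2 (err s v u) = Sob_norm s (\<lambda>x. v x - u x)"
    using Hs_cong_AE(2)[OF H Sob_measurable_hat[OF Sob_diff(1)[OF v u]] Sob_diff(3)[OF v u]]
    by (simp add: err_def[abs_def] Sob_norm_def hs_def)
qed

lemma Sob_quotient:
  assumes f: "Sob \<sigma> f" and g: "Sob \<sigma> g" and h: "Sob \<sigma> h"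
  shows "Sob \<sigma> (\<lambda>x. (f x - g x) / c - h x)"
    "AE \<xi> in lborel. hat (\<lambda>x. (f x - g x) / c - h x) \<xi> = (hat f \<xi> - hat g \<xi>) / c - hat h \<xi>"
proof -
  note D = Sob_diff[OF f g]
  note S = Sob_scale[OF D(1), of "1 / c"]
  note E = Sob_diff[OF S(1) h]
  show "Sob \<sigma> (\<lambda>x. (f x - g x) / c - h x)" using E(1) by simp
  show "AE \<xi> in lborel. hat (\<lambda>x. (f x - g x) / c - h x) \<xi> = (hat f \<xi> - hat g \<xi>) / c - hat h \<xi>"
    using E(3) S(3) D(3) by eventually_elim simp
qed

lemma Sob_norm_quotient_bound:
  assumes f: "Sob \<sigma> f" and g: "Sob \<sigma> g" and h: "Sob \<sigma> h" and c: "c \<noteq> 0"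
  shows "Sob_norm \<sigma> (\<lambda>x. f x - g x) \<le> \<bar>c\<bar> * (Sob_norm \<sigma> h + Sob_norm \<sigma> (\<lambda>x. (f x - g x) / complex_of_real c - h x))"
proof -
  let ?q = "\<lambda>x. (f x - g x) / complex_of_real c - h x"
  note Q = Sob_quotient(1)[OF f g h, of "complex_of_real c"]
  note A = Sob_add[OF h Q]
  have "(\<lambda>x. f x - g x) = (\<lambda>x. complex_of_real c * (h x + ?q x))" using c by auto
  then have "Sob_norm \<sigma> (\<lambda>x. f x - g x) = \<bar>c\<bar> * Sob_norm \<sigma> (\<lambda>x. h x + ?q x)"
    using Sob_scale(2)[OF A(1), of "complex_of_real c"] by simp
  also have "\<dots> \<le> \<bar>c\<bar> * (Sob_norm \<sigma> h + Sob_norm \<sigma> ?q)" by (intro mult_left_mono A(2)) simp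
  finally show ?thesis .
qed

lemma wave_coeff_hermitian:
  assumes v: "Sob \<sigma> v" and \<sigma>: "\<sigma> > 1 / 2" and p: "p \<ge> 1" and r: "\<And>x. cnj (v x) = v x"
  shows "AE \<xi> in lborel. wave_coeff p v (- \<xi>) = cnj (wave_coeff p v \<xi>)"
proof -
  have "Sob \<sigma> (\<lambda>x. v x ^ p)" using Sob_power[OF v \<sigma> p] by simp
  from hat_hermitian[OF this] r show ?thesis by (simp add: wave_coeff_def)
qed

lemma wave_coeff_Lipschitz:
  assumes v: "Sob \<sigma> v" and w: "Sob \<sigma> w" and \<sigma>: "\<sigma> > 1 / 2" and p: "p \<ge> 1" and M: "Sob_norm \<sigma> v \<le> M" "Sob_norm \<sigma> w \<le> M"
  shows "l1 (\<lambda>\<xi>. wave_coeff p w \<xi> - wave_coeff p v \<xi>)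
    \<le> emb_const \<sigma> * (real (p + 1) * (real p * alg_const \<sigma> ^ (p - 1) * M ^ (p - 1))) * Sob_norm \<sigma> (\<lambda>x. w x - v x)"
proof -
  have vp: "Sob \<sigma> (\<lambda>x. v x ^ p)" and wp: "Sob \<sigma> (\<lambda>x. w x ^ p)" using Sob_power[OF v \<sigma> p] Sob_power[OF w \<sigma> p] by auto
  note D = Sob_diff[OF wp vp]
  note H = Hs_scale[OF Sob_hat(2)[OF D(1)], of "of_nat (p + 1)"]
  let ?F = "\<lambda>\<xi>. of_nat (p + 1) * hat (\<lambda>x. w x ^ p - v x ^ p) \<xi>"
  have "l1 (\<lambda>\<xi>. wave_coeff p w \<xi> - wave_coeff p v \<xi>) = l1 ?F"
    unfolding l1_def
  proof (rule integral_cong_AE)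
    have [measurable]: "hat (\<lambda>x. w x ^ p) \<in> borel_measurable borel" "hat (\<lambda>x. v x ^ p) \<in> borel_measurable borel"
      "hat (\<lambda>x. w x ^ p - v x ^ p) \<in> borel_measurable borel"
      using Sob_measurable_hat vp wp D(1) by auto
    show "(\<lambda>\<xi>. cmod (wave_coeff p w \<xi> - wave_coeff p v \<xi>)) \<in> borel_measurable lborel" "(\<lambda>\<xi>. cmod (?F \<xi>)) \<in> borel_measurable lborel"
      unfolding wave_coeff_def by measurable
    show "AE \<xi> in lborel. cmod (wave_coeff p w \<xi> - wave_coeff p v \<xi>) = cmod (?F \<xi>)"
      using D(3) by eventually_elim (simp only: wave_coeff_def right_diff_distrib)
  qed
  also have "\<dots> \<le> emb_const \<sigma> * (real (p + 1) * Sob_norm \<sigma> (\<lambda>x. w x ^ p - v x ^ p))"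
    using Hs_integrable(2)[OF H(1) \<sigma>] unfolding H(2) Sob_norm_def norm_of_nat .
  also have "\<dots> \<le> emb_const \<sigma> * (real (p + 1) * (real p * alg_const \<sigma> ^ (p - 1) * M ^ (p - 1) * Sob_norm \<sigma> (\<lambda>x. w x - v x)))"
    by (intro mult_left_mono Sob_power_diff[OF w v \<sigma> p] M) auto
  finally show ?thesis by (simp add: mult_ac)
qed

definition energy :: "nat \<Rightarrow> real \<Rightarrow> (real \<Rightarrow> complex) \<Rightarrow> (real \<Rightarrow> complex) \<Rightarrow> real" where
  "energy p s v u = eform (wave_coeff p v) (err s v u) (err s v u)"

text \<open>The constant of \<open>wave_coeff_Lipschitz\<close> at order s - 1, the order at which
  the equation controls the time derivative of \<open>v\<close>. The base 2 is a bound for the norm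
  of \<open>v\<close> near a time at which it is at most 1.\<close>

definition lip_const :: "nat \<Rightarrow> real \<Rightarrow> real" where
  "lip_const p s = emb_const (s - 1) * (real (p + 1) * (real p * alg_const (s - 1) ^ (p - 1) * 2 ^ (p - 1)))"

lemma lip_const_nonneg: "0 \<le> lip_const p s" by (simp add: lip_const_def)

text \<open>Expansion of the energy to first order in the time step. The change of the error
  contributes \<open>2 * K\<close> through the equation, the change of the coefficient contributes
  \<open>2 * (lip_const p s * V) * x^2\<close>, and everything else is of higher order and is
  covered by \<eta>.\<close>

lemma energy_increment:
  fixes K d x V :: real
  assumes s: "s > 3 / 2" and p: "p \<ge> 1"
    and v: "wave_solution m p s T v v'" and u: "wave_solution (\<lambda>_. 1) p s T u u'" and t: "t \<in> {0..T}"
    and small: "l1 (wave_coeff p (v t)) \<le> 1 / 4" and vb: "Sob_norm s (v t) \<le> 1"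
    and V: "Sob_norm (s - 1) (v' t) \<le> V"
    and D_def: "D = (weighted_rhs s m p (v t) (u t))"
    and Ds: "sq_int D"
    and Dle: "eform (wave_coeff p (v t)) (err s (v t) (u t)) D \<le> K"
    and x_def: "x = Sob_norm s (\<lambda>y. v t y - u t y)"
  shows "((\<lambda>\<tau>. energy p s (v \<tau>) (u \<tau>)) \<longlongrightarrow> energy p s (v t) (u t)) (at t within {0..T})"
    and "\<eta> > 0 \<Longrightarrow> eventually (\<lambda>\<tau>. t < \<tau> \<longrightarrow> energy p s (v \<tau>) (u \<tau>) \<le> energy p s (v t) (u t)
      + (\<tau> - t) * ((2 * K + 2 * (lip_const p s * V) * x\<^sup>2) + \<eta>)) (at t within {0..T})"
proof -
  let ?F = "at t within {0..T}"
  have s1: "s > 1 / 2" "s - 1 > 1 / 2" using s by auto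
  have vX: "Sob s (v \<tau>)" and uX: "Sob s (u \<tau>)" if "\<tau> \<in> {0..T}" for \<tau>
    using v u that Sob_mono(1)[of "s + 1" _ s] by (auto simp: wave_solution_def)
  have v'Sob: "Sob s (v' t)" and u'Sob: "Sob s (u' t)" using v u t by (auto simp: wave_solution_def)
  have V0: "0 \<le> V" using V Sob_norm_nonneg order_trans by blast
  define qv where "qv \<tau> = Sob_norm s (\<lambda>x. (v \<tau> x - v t x) / complex_of_real (\<tau> - t) - v' t x)" for \<tau>
  define qu where "qu \<tau> = Sob_norm s (\<lambda>x. (u \<tau> x - u t x) / complex_of_real (\<tau> - t) - u' t x)" for \<tau>
  define \<rho> where "\<rho> \<tau> = qv \<tau> + qu \<tau>" for \<tau>
  have q0: "0 \<le> qv \<tau>" "0 \<le> qu \<tau>" "0 \<le> \<rho> \<tau>" for \<tau> by (simp_all add: qv_def qu_def \<rho>_def)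
  have "(qv \<longlongrightarrow> 0) ?F" "(qu \<longlongrightarrow> 0) ?F"
    using v u t by (auto simp: wave_solution_def qv_def[abs_def] qu_def[abs_def])
  then have \<rho>0: "(\<rho> \<longlongrightarrow> 0) ?F" unfolding \<rho>_def by (auto intro: tendsto_add_zero)
  define Q where "Q \<tau> = wave_coeff p (v \<tau>)" for \<tau>
  define e where "e \<tau> = err s (v \<tau>) (u \<tau>)" for \<tau>
  define a where "a \<tau> = l2 (\<lambda>\<xi>. e \<tau> \<xi> - e t \<xi>)" for \<tau>
  have es: "sq_int (e \<tau>)" if "\<tau> \<in> {0..T}" for \<tau> unfolding e_def by (rule err(1)[OF vX[OF that] uX[OF that]])
  have x: "x = l2 (e t)" unfolding x_def e_def err(2)[OF vX[OF t] uX[OF t]] ..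
  have x0: "0 \<le> x" by (simp add: x)
  have Qi: "integrable lborel (Q \<tau>)" "sq_int (Q \<tau>)" if "\<tau> \<in> {0..T}" for \<tau>
    unfolding Q_def using wave_coeff(1,2)[OF vX[OF that] s1(1) p] Hs_mono(1)[of s _ 0] s by (auto simp: Hs_0)
  have Q1: "1 + 2 * l1 (Q t) \<le> 3 / 2" using small by (simp add: Q_def)
  have herm: "AE \<xi> in lborel. Q t (- \<xi>) = cnj (Q t \<xi>)"
    unfolding Q_def by (rule wave_coeff_hermitian[OF vX[OF t] s1(1) p]) (use v t in \<open>auto simp: wave_solution_def\<close>)
  have v'h: "AE \<xi> in lborel. hat (v' t) \<xi> = - (m \<xi> * hat (dx (flux p (v t))) \<xi>)"
    and u'h: "AE \<xi> in lborel. hat (u' t) \<xi> = - (complex_of_real 1 * hat (dx (flux p (u t))) \<xi>)"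
    using v u t by (auto simp: wave_solution_def)
  \<comment> \<open>The difference quotient of \<Lambda>^s E approximates \<open>D\<close> in
    \<open>L^2\<close>, with the two errors from the definition of the time derivative added up in
    \<open>\<rho>\<close>.\<close>
  have r: "sq_int (\<lambda>\<xi>. complex_of_real (1 / (\<tau> - t)) * (e \<tau> \<xi> - e t \<xi>) - D \<xi>)"
      (is "sq_int ?r")
    "l2 (\<lambda>\<xi>. complex_of_real (1 / (\<tau> - t)) * (e \<tau> \<xi> - e t \<xi>) - D \<xi>) \<le> \<rho> \<tau>"
    if \<tau>: "\<tau> \<in> {0..T}" "\<tau> \<noteq> t" for \<tau>
  proof -
    let ?r = "\<lambda>\<xi>. complex_of_real (1 / (\<tau> - t)) * (e \<tau> \<xi> - e t \<xi>) - D \<xi>"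
    let ?c = "complex_of_real (\<tau> - t)"
    show rs: "sq_int ?r" by (intro sq_int_diff(1) sq_int_scale(1) es \<tau> t Ds)
    note Xv = Sob_quotient[OF vX[OF \<tau>(1)] vX[OF t] v'Sob, of ?c]
    note Xu = Sob_quotient[OF uX[OF \<tau>(1)] uX[OF t] u'Sob, of ?c]
    note E = err[OF Xv(1) Xu(1)]
    have "l2 ?r = l2 (err s (\<lambda>x. (v \<tau> x - v t x) / ?c - v' t x) (\<lambda>x. (u \<tau> x - u t x) / ?c - u' t x))"
    proof (rule l2_cong_AE)
      show "?r \<in> borel_measurable borel" using rs by auto
      show "err s (\<lambda>x. (v \<tau> x - v t x) / ?c - v' t x) (\<lambda>x. (u \<tau> x - u t x) / ?c - u' t x) \<in> borel_measurable borel"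
        using E(1) by auto
      show "AE \<xi> in lborel. ?r \<xi> = err s (\<lambda>x. (v \<tau> x - v t x) / ?c - v' t x) (\<lambda>x. (u \<tau> x - u t x) / ?c - u' t x) \<xi>"
        using Xv(2) Xu(2) v'h u'h
      proof eventually_elim
        case (elim \<xi>)
        show ?case
          unfolding err_def elim(1,2) unfolding elim(3,4) e_def err_def D_def
          by (simp add: algebra_simps diff_divide_distrib add_divide_distrib)
      qed
    qed
    also have "\<dots> \<le> \<rho> \<tau>"
      unfolding E(2) \<rho>_def qv_def qu_def by (rule Sob_diff(2)[OF Xv(1) Xu(1)])
    finally show "l2 ?r \<le> \<rho> \<tau>" .
  qed
  have decomp: "(\<lambda>\<xi>. e \<tau> \<xi> - e t \<xi>) = (\<lambda>\<xi>. complex_of_real (\<tau> - t) * (D \<xi> + (complex_of_real (1 / (\<tau> - t)) * (e \<tau> \<xi> - e t \<xi>) - D \<xi>)))"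
    if "\<tau> \<noteq> t" for \<tau>
    using that by (auto simp: field_simps)
  have a_le: "a \<tau> \<le> \<bar>\<tau> - t\<bar> * (l2 D + \<rho> \<tau>)" if \<tau>: "\<tau> \<in> {0..T}" "\<tau> \<noteq> t" for \<tau>
  proof -
    note S = sq_int_add[OF Ds r(1)[OF \<tau>]]
    have "a \<tau> = \<bar>\<tau> - t\<bar> * l2 (\<lambda>\<xi>. D \<xi> + (complex_of_real (1 / (\<tau> - t)) * (e \<tau> \<xi> - e t \<xi>) - D \<xi>))"
      unfolding a_def decomp[OF \<tau>(2)] sq_int_scale(2)[OF S(1)] norm_of_real ..
    also have "\<dots> \<le> \<bar>\<tau> - t\<bar> * (l2 D + \<rho> \<tau>)"
      using S(2) r(2)[OF \<tau>] by (intro mult_left_mono) auto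
    finally show ?thesis .
  qed
  have ef_le: "eform (Q t) (e t) (\<lambda>\<xi>. e \<tau> \<xi> - e t \<xi>) \<le> (\<tau> - t) * (K + 3 / 2 * x * \<rho> \<tau>)"
    if \<tau>: "\<tau> \<in> {0..T}" "t < \<tau>" for \<tau>
  proof -
    have ne: "\<tau> \<noteq> t" using \<tau> by simp
    have "eform (Q t) (e t) (\<lambda>\<xi>. e \<tau> \<xi> - e t \<xi>) = (\<tau> - t) * (eform (Q t) (e t) D
        + eform (Q t) (e t) (\<lambda>\<xi>. complex_of_real (1 / (\<tau> - t)) * (e \<tau> \<xi> - e t \<xi>) - D \<xi>))"
      by (subst decomp[OF ne])
        (simp only: eform_scale_right eform_add_right[OF Qi(1)[OF t] es[OF t] Ds r(1)[OF \<tau>(1) ne]])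
    also have "\<dots> \<le> (\<tau> - t) * (K + 3 / 2 * x * \<rho> \<tau>)"
    proof (intro mult_left_mono add_mono)
      show "eform (Q t) (e t) D \<le> K" using Dle by (simp add: Q_def e_def)
      have "eform (Q t) (e t) (\<lambda>\<xi>. complex_of_real (1 / (\<tau> - t)) * (e \<tau> \<xi> - e t \<xi>) - D \<xi>)
          \<le> (1 + 2 * l1 (Q t)) * l2 (e t) * l2 (\<lambda>\<xi>. complex_of_real (1 / (\<tau> - t)) * (e \<tau> \<xi> - e t \<xi>) - D \<xi>)"
        using eform_bound[OF Qi(1)[OF t] es[OF t] r(1)[OF \<tau>(1) ne]] by (rule order_trans[OF abs_ge_self])
      also have "\<dots> \<le> 3 / 2 * x * \<rho> \<tau>"
        unfolding x by (intro mult_mono Q1 r(2)[OF \<tau>(1) ne]) auto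
      finally show "eform (Q t) (e t) (\<lambda>\<xi>. complex_of_real (1 / (\<tau> - t)) * (e \<tau> \<xi> - e t \<xi>) - D \<xi>) \<le> 3 / 2 * x * \<rho> \<tau>" .
    qed (use \<tau> in auto)
    finally show ?thesis .
  qed
  have evT: "eventually (\<lambda>\<tau>. \<tau> \<in> {0..T} \<and> \<tau> \<noteq> t) ?F" by (auto simp: eventually_at_filter)
  have "((\<lambda>\<tau>. Sob_norm s (\<lambda>x. v \<tau> x - v t x)) \<longlongrightarrow> 0) ?F" using v t by (auto simp: wave_solution_def)
  then have "eventually (\<lambda>\<tau>. Sob_norm s (\<lambda>x. v \<tau> x - v t x) < 1) ?F" by (rule order_tendstoD) simp
  then have ev2: "eventually (\<lambda>\<tau>. Sob_norm s (v \<tau>) \<le> 2) ?F"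
    using evT
  proof eventually_elim
    case (elim \<tau>)
    then show ?case using Sob_norm_triangle[OF vX[of \<tau>] vX[OF t]] vb by linarith
  qed
  \<comment> \<open>The rate of change of the coefficient is measured at order s - 1, where
    \<open>V\<close> bounds the time derivative independently of higher norms of
    \<open>v\<close>.\<close>
  have Qd: "eventually (\<lambda>\<tau>. l1 (\<lambda>\<xi>. Q \<tau> \<xi> - Q t \<xi>) \<le> \<bar>\<tau> - t\<bar> * (lip_const p s * (V + \<rho> \<tau>))) ?F"
    using ev2 evT
  proof eventually_elim
    case (elim \<tau>)
    then have \<tau>: "\<tau> \<in> {0..T}" "\<tau> - t \<noteq> 0" by auto
    have w: "Sob (s - 1) (v \<tau>)" "Sob (s - 1) (v t)" "Sob (s - 1) (v' t)"
      using Sob_mono(1)[OF vX[OF \<tau>(1)], of "s - 1"] Sob_mono(1)[OF vX[OF t], of "s - 1"] Sob_mono(1)[OF v'Sob, of "s - 1"] by auto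
    have b: "Sob_norm (s - 1) (v \<tau>) \<le> 2" "Sob_norm (s - 1) (v t) \<le> 2"
      using Sob_mono(2)[OF vX[OF \<tau>(1)], of "s - 1"] Sob_mono(2)[OF vX[OF t], of "s - 1"] elim(1) vb by auto
    have "Sob_norm (s - 1) (\<lambda>x. (v \<tau> x - v t x) / complex_of_real (\<tau> - t) - v' t x) \<le> qv \<tau>"
      unfolding qv_def by (rule Sob_mono(2)[OF Sob_quotient(1)[OF vX[OF \<tau>(1)] vX[OF t] v'Sob]]) simp
    then have "Sob_norm (s - 1) (v' t) + Sob_norm (s - 1) (\<lambda>x. (v \<tau> x - v t x) / complex_of_real (\<tau> - t) - v' t x) \<le> V + \<rho> \<tau>"
      using V q0(2)[of \<tau>] by (simp add: \<rho>_def)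
    then have "Sob_norm (s - 1) (\<lambda>x. v \<tau> x - v t x) \<le> \<bar>\<tau> - t\<bar> * (V + \<rho> \<tau>)"
      by (rule order_trans[OF Sob_norm_quotient_bound[OF w \<tau>(2)] mult_left_mono]) simp
    then have "lip_const p s * Sob_norm (s - 1) (\<lambda>x. v \<tau> x - v t x) \<le> lip_const p s * (\<bar>\<tau> - t\<bar> * (V + \<rho> \<tau>))"
      by (rule mult_left_mono[OF _ lip_const_nonneg])
    then show ?case
      using wave_coeff_Lipschitz[OF w(2,1) s1(2) p b(2,1)] unfolding Q_def lip_const_def[symmetric]
      by (simp add: mult.left_commute)
  qed
  have h0: "((\<lambda>\<tau>. \<bar>\<tau> - t\<bar>) \<longlongrightarrow> 0) ?F"
    by (rule tendsto_eq_intros | simp)+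
  have a0: "(a \<longlongrightarrow> 0) ?F"
  proof (rule tendsto_sandwich[OF _ _ tendsto_const[of 0]])
    show "eventually (\<lambda>\<tau>. 0 \<le> a \<tau>) ?F" by (simp add: a_def)
    show "eventually (\<lambda>\<tau>. a \<tau> \<le> \<bar>\<tau> - t\<bar> * (l2 D + \<rho> \<tau>)) ?F"
      using evT by eventually_elim (use a_le in blast)
    show "((\<lambda>\<tau>. \<bar>\<tau> - t\<bar> * (l2 D + \<rho> \<tau>)) \<longlongrightarrow> 0) ?F"
      using tendsto_mult[OF h0 tendsto_add[OF tendsto_const \<rho>0]] by simp
  qed
  have el: "eventually (\<lambda>\<tau>. l2 (e \<tau>) \<le> x + a \<tau>) ?F"
    using evT
  proof eventually_elim
    case (elim \<tau>)
    then have "sq_int (\<lambda>\<xi>. e \<tau> \<xi> - e t \<xi>)" using sq_int_diff(1) es t by blast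
    from sq_int_add(2)[OF es[OF t] this] show ?case by (simp add: x a_def)
  qed
  \<comment> \<open>The remainder of \<open>eform_increment\<close> divided by the time step: the
    square of the increment still carries a factor that tends to 0, while the change of the
    coefficient survives in the limit.\<close>
  define R where "R \<tau> = 3 / 2 * (\<bar>\<tau> - t\<bar> * (l2 D + \<rho> \<tau>)\<^sup>2) + 2 * (lip_const p s * (V + \<rho> \<tau>)) * (x + a \<tau>)\<^sup>2" for \<tau>
  have inc: "eventually (\<lambda>\<tau>. \<bar>energy p s (v \<tau>) (u \<tau>) - energy p s (v t) (u t) - 2 * eform (Q t) (e t) (\<lambda>\<xi>. e \<tau> \<xi> - e t \<xi>)\<bar>
      \<le> \<bar>\<tau> - t\<bar> * R \<tau>) ?F"
    using evT Qd el
  proof eventually_elim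
    case (elim \<tau>)
    then have \<tau>: "\<tau> \<in> {0..T}" "\<tau> \<noteq> t" by auto
    have "\<bar>energy p s (v \<tau>) (u \<tau>) - energy p s (v t) (u t) - 2 * eform (Q t) (e t) (\<lambda>\<xi>. e \<tau> \<xi> - e t \<xi>)\<bar>
      \<le> (1 + 2 * l1 (Q t)) * (a \<tau>)\<^sup>2 + 2 * l1 (\<lambda>\<xi>. Q \<tau> \<xi> - Q t \<xi>) * (l2 (e \<tau>))\<^sup>2"
      using eform_increment[OF Qi[OF t] Qi[OF \<tau>(1)] es[OF t] es[OF \<tau>(1)] herm]
      by (simp add: energy_def Q_def e_def a_def)
    also have "\<dots> \<le> 3 / 2 * (\<bar>\<tau> - t\<bar> * (l2 D + \<rho> \<tau>))\<^sup>2 + 2 * (\<bar>\<tau> - t\<bar> * (lip_const p s * (V + \<rho> \<tau>))) * (x + a \<tau>)\<^sup>2"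
      using elim(2,3) by (intro add_mono mult_mono Q1 power_mono a_le \<tau> mult_left_mono) (auto simp: a_def lip_const_nonneg V0 q0 intro!: mult_nonneg_nonneg add_nonneg_nonneg)
    also have "\<dots> = \<bar>\<tau> - t\<bar> * R \<tau>"
    proof -
      have "3 / 2 * (h * b)\<^sup>2 + 2 * (h * c) * y = h * (3 / 2 * (h * b\<^sup>2) + 2 * c * y)" for h b c y :: real
        by (simp add: power2_eq_square algebra_simps)
      then show ?thesis unfolding R_def .
    qed
    finally show ?case .
  qed
  have R0: "(R \<longlongrightarrow> 2 * (lip_const p s * V) * x\<^sup>2) ?F"
  proof -
    have "(R \<longlongrightarrow> 3 / 2 * (0 * (l2 D + 0)\<^sup>2) + 2 * (lip_const p s * (V + 0)) * (x + 0)\<^sup>2) ?F"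
      unfolding R_def by (intro tendsto_add tendsto_mult tendsto_power tendsto_const h0 \<rho>0 a0)
    then show ?thesis by simp
  qed
  show "((\<lambda>\<tau>. energy p s (v \<tau>) (u \<tau>)) \<longlongrightarrow> energy p s (v t) (u t)) ?F"
  proof (rule LIM_zero_cancel, rule tendsto_rabs_zero_cancel, rule tendsto_sandwich[OF _ _ tendsto_const[of 0]])
    show "eventually (\<lambda>\<tau>. \<bar>energy p s (v \<tau>) (u \<tau>) - energy p s (v t) (u t)\<bar> \<le> 2 * (3 / 2 * x * a \<tau>) + \<bar>\<tau> - t\<bar> * R \<tau>) ?F"
      using inc evT
    proof eventually_elim
      case (elim \<tau>)
      then have "sq_int (\<lambda>\<xi>. e \<tau> \<xi> - e t \<xi>)" using sq_int_diff(1) es t by blast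
      from eform_bound[OF Qi(1)[OF t] es[OF t] this]
      have "\<bar>eform (Q t) (e t) (\<lambda>\<xi>. e \<tau> \<xi> - e t \<xi>)\<bar> \<le> (1 + 2 * l1 (Q t)) * x * a \<tau>" by (simp add: x a_def)
      also have "\<dots> \<le> 3 / 2 * x * a \<tau>" by (intro mult_right_mono Q1) (auto simp: x0 a_def)
      finally show ?case using elim(1) by linarith
    qed
    have "((\<lambda>\<tau>. 2 * (3 / 2 * x * a \<tau>) + \<bar>\<tau> - t\<bar> * R \<tau>) \<longlongrightarrow> 2 * (3 / 2 * x * 0) + 0 * (2 * (lip_const p s * V) * x\<^sup>2)) ?F"
      by (intro tendsto_add tendsto_mult tendsto_const h0 a0 R0)
    then show "((\<lambda>\<tau>. 2 * (3 / 2 * x * a \<tau>) + \<bar>\<tau> - t\<bar> * R \<tau>) \<longlongrightarrow> 0) ?F" by simp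
  qed simp
  assume \<eta>: "\<eta> > 0"
  have "((\<lambda>\<tau>. 2 * (K + 3 / 2 * x * \<rho> \<tau>) + R \<tau>) \<longlongrightarrow> 2 * (K + 3 / 2 * x * 0) + 2 * (lip_const p s * V) * x\<^sup>2) ?F"
    by (intro tendsto_add tendsto_mult tendsto_const \<rho>0 R0)
  then have "eventually (\<lambda>\<tau>. 2 * (K + 3 / 2 * x * \<rho> \<tau>) + R \<tau> < (2 * K + 2 * (lip_const p s * V) * x\<^sup>2) + \<eta>) ?F"
    by (rule order_tendstoD) (use \<eta> in simp)
  then show "eventually (\<lambda>\<tau>. t < \<tau> \<longrightarrow> energy p s (v \<tau>) (u \<tau>) \<le> energy p s (v t) (u t)
      + (\<tau> - t) * ((2 * K + 2 * (lip_const p s * V) * x\<^sup>2) + \<eta>)) ?F"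
    using inc evT
  proof eventually_elim
    case (elim \<tau>)
    show ?case
    proof
      assume tt: "t < \<tau>"
      have "energy p s (v \<tau>) (u \<tau>) \<le> energy p s (v t) (u t) + (\<tau> - t) * (2 * (K + 3 / 2 * x * \<rho> \<tau>) + R \<tau>)"
        using elim(2) ef_le[of \<tau>] elim(3) tt by (simp add: distrib_left)
      also have "\<dots> \<le> energy p s (v t) (u t) + (\<tau> - t) * ((2 * K + 2 * (lip_const p s * V) * x\<^sup>2) + \<eta>)"
        using elim(1) tt by (intro add_left_mono mult_left_mono) auto
      finally show "energy p s (v \<tau>) (u \<tau>) \<le> energy p s (v t) (u t) + (\<tau> - t) * ((2 * K + 2 * (lip_const p s * V) * x\<^sup>2) + \<eta>)" .
    qed
  qed
qed

subsection \<open>The uniform error estimate\<close>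

text \<open>The multiplier is quantified inside, so a \<open>K\<close> with this property depends on
  it through \<open>A\<close> alone. This is where independence of \<delta> begins.\<close>

abbreviation energy_estimate :: "nat \<Rightarrow> real \<Rightarrow> real \<Rightarrow> real \<Rightarrow> real \<Rightarrow> bool" where
  "energy_estimate p s A N K \<equiv> \<forall>m v u d. m \<in> borel_measurable borel \<longrightarrow> (\<forall>\<xi>. \<bar>m \<xi>\<bar> \<le> A) \<longrightarrow> Sob (s + 1) v \<longrightarrow> Sob (s + 1) u \<longrightarrow>
    Sob_norm s v \<le> 1 \<longrightarrow> Sob_norm s u \<le> 1 \<longrightarrow> Sob_norm (s + 1) u \<le> N \<longrightarrow>
    hs s (\<lambda>\<xi>. complex_of_real (m \<xi> - 1) * hat (dx (flux p u)) \<xi>) \<le> d \<longrightarrow>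
    sq_int (weighted_rhs s m p v u) \<and>
    eform (wave_coeff p v) (err s v u) (weighted_rhs s m p v u)
      \<le> K * Sob_norm s (\<lambda>x. v x - u x) * (Sob_norm s (\<lambda>x. v x - u x) + d)"

lemma energy_inequality_unit:
  assumes s: "s > 3 / 2" and p: "p \<ge> 1" and A: "0 \<le> A" and N: "0 \<le> N"
  shows "\<exists>K\<ge>0. energy_estimate p s A N K"
proof -
  define q0 where "q0 = real (p + 1) * (alg_const s ^ (p - 1) * 1 ^ p)"
  define r2 where "r2 = real (p + 1) * (alg_const s * (real p * alg_const s ^ (p - 1) * 1 ^ (p - 1)) * N)"
  define K where "K = (1 + 2 * (emb_const s * q0)) * (A * (4 * commutator_const s * emb_const (s - 1) * q0 + r2) + 1)"
  have "0 \<le> q0" "0 \<le> r2" using N by (simp_all add: q0_def r2_def)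
  moreover have "0 \<le> commutator_const s" using s by (simp add: commutator_const_def)
  ultimately have K: "0 \<le> K" unfolding K_def using A
    by (intro mult_nonneg_nonneg add_nonneg_nonneg) auto
  show ?thesis
  proof (intro exI[of _ K] conjI K allI impI)
    fix m :: "real \<Rightarrow> real" and v u d
    assume H: "m \<in> borel_measurable borel" "\<forall>\<xi>. \<bar>m \<xi>\<bar> \<le> A" "Sob (s + 1) v" "Sob (s + 1) u"
      "Sob_norm s v \<le> 1" "Sob_norm s u \<le> 1" "Sob_norm (s + 1) u \<le> N"
      "hs s (\<lambda>\<xi>. complex_of_real (m \<xi> - 1) * hat (dx (flux p u)) \<xi>) \<le> d"
    note E = energy_inequality[OF s p H(3-7,1) H(2)[rule_format] H(8)]
    show "sq_int (weighted_rhs s m p v u)" by (rule E(1))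
    have Sob: "Sob s v" "Sob s u" using Sob_mono(1)[OF H(3), of s] Sob_mono(1)[OF H(4), of s] by auto
    have e: "err s v u = (\<lambda>\<xi>. wtc s \<xi> * (hat v \<xi> - hat u \<xi>))" by (rule ext) (rule err_def)
    show "eform (wave_coeff p v) (err s v u) (weighted_rhs s m p v u)
      \<le> K * Sob_norm s (\<lambda>x. v x - u x) * (Sob_norm s (\<lambda>x. v x - u x) + d)"
      unfolding err(2)[OF Sob, symmetric] eform_def e K_def q0_def r2_def by (rule E(3))
  qed
qed

text \<open>Comparison with \<open>Q = 0\<close>, for which the form is the squared norm: the
  deviation is at most the fraction \<open>2 * l1 Q <= 1/2\<close> of it. Hence the threshold
  1/4.\<close>

lemma energy_lower_bound:
  assumes v: "Sob s v" and u: "Sob s u" and s: "s > 1 / 2" and p: "p \<ge> 1" and small: "l1 (wave_coeff p v) \<le> 1 / 4"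
  shows "(Sob_norm s (\<lambda>x. v x - u x))\<^sup>2 / 2 \<le> energy p s v u"
proof -
  let ?Q = "wave_coeff p v" and ?e = "err s v u"
  note e = err[OF v u]
  have Q: "integrable lborel ?Q" "sq_int ?Q"
    using wave_coeff(1,2)[OF v s p] Hs_mono(1)[of s _ 0] s by (auto simp: Hs_0)
  have z: "integrable lborel (\<lambda>x::real. 0::complex)" "sq_int (\<lambda>x. 0)" using sq_int_zero by auto
  have "(LINT \<xi>|lborel. ?e \<xi> * cnj (?e \<xi>)) = (LINT \<xi>|lborel. complex_of_real ((cmod (?e \<xi>))\<^sup>2))"
    unfolding complex_norm_square ..
  also have "\<dots> = complex_of_real ((l2 ?e)\<^sup>2)" unfolding l2_power2 by (rule integral_complex_of_real)
  finally have "eform (\<lambda>x. 0) ?e ?e = (l2 ?e)\<^sup>2" by (simp add: eform_def cconv_def)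
  then have "\<bar>energy p s v u - (l2 ?e)\<^sup>2\<bar> \<le> 2 * l1 ?Q * l2 ?e * l2 ?e"
    using eform_change[OF z Q e(1) e(1)] by (simp add: energy_def)
  also have "\<dots> \<le> 2 * (1 / 4) * l2 ?e * l2 ?e" by (intro mult_right_mono mult_left_mono small) auto
  also have "\<dots> = (l2 ?e)\<^sup>2 / 2" by (simp add: power2_eq_square)
  finally show ?thesis unfolding e(2)[symmetric] by linarith
qed

text \<open>The 2k extra derivatives of \<open>f\<close> absorb the power of \<xi>. The bound by
  \<open>d\<close> gives the order of convergence; the bound by \<open>A + 1\<close> stays finite
  however large \<open>d\<close> is, so that the time of existence can be chosen for all \<delta> at
  once.\<close>

lemma multiplier_error:
  assumes f: "Sob (s + 2 * real k) f" and [measurable]: "m \<in> borel_measurable borel" and A: "0 \<le> A" and d: "0 \<le> d"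
    and mA: "\<And>\<xi>. \<bar>m \<xi>\<bar> \<le> A" and md: "\<And>\<xi>. \<bar>m \<xi> - 1\<bar> \<le> d * \<bar>\<xi>\<bar> ^ (2 * k)"
  shows "hs s (\<lambda>\<xi>. complex_of_real (m \<xi> - 1) * hat f \<xi>) \<le> min d (A + 1) * Sob_norm (s + 2 * real k) f"
  unfolding Sob_norm_def
proof (rule Hs_bound(2)[OF Sob_hat(2)[OF f]])
  have [measurable]: "hat f \<in> borel_measurable borel" by (rule Sob_measurable_hat[OF f])
  show "(\<lambda>\<xi>. complex_of_real (m \<xi> - 1) * hat f \<xi>) \<in> borel_measurable borel" by measurable
  show "0 \<le> min d (A + 1)" using A d by simp
  show "AE \<xi> in lborel. wt s \<xi> * cmod (complex_of_real (m \<xi> - 1) * hat f \<xi>) \<le> min d (A + 1) * (wt (s + 2 * real k) \<xi> * cmod (hat f \<xi>))"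
  proof (rule AE_I2)
    fix \<xi>
    have "\<bar>\<xi>\<bar> ^ (2 * k) \<le> wt (2 * real k) \<xi>"
      using power_mono[OF abs_le_wt_1[of \<xi>], of "2 * k"] wt_1_power[of \<xi> "2 * k"] by simp
    then have "\<bar>m \<xi> - 1\<bar> \<le> d * wt (2 * real k) \<xi>"
      using md[of \<xi>] d mult_left_mono order_trans by blast
    moreover have "\<bar>m \<xi> - 1\<bar> \<le> (A + 1) * wt (2 * real k) \<xi>"
    proof -
      have "\<bar>m \<xi> - 1\<bar> \<le> A + 1" using mA[of \<xi>] by linarith
      moreover have "(A + 1) * 1 \<le> (A + 1) * wt (2 * real k) \<xi>" using A by (intro mult_left_mono wt_ge_1) auto
      ultimately show ?thesis by simp
    qed
    ultimately have "\<bar>m \<xi> - 1\<bar> \<le> min d (A + 1) * wt (2 * real k) \<xi>" by (simp add: min_def)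
    then have "(wt s \<xi> * cmod (hat f \<xi>)) * \<bar>m \<xi> - 1\<bar> \<le> (wt s \<xi> * cmod (hat f \<xi>)) * (min d (A + 1) * wt (2 * real k) \<xi>)"
      by (rule mult_left_mono) simp
    moreover have "wt s \<xi> * cmod (complex_of_real (m \<xi> - 1) * hat f \<xi>) = (wt s \<xi> * cmod (hat f \<xi>)) * \<bar>m \<xi> - 1\<bar>"
      unfolding norm_mult norm_of_real by (simp only: mult_ac)
    moreover have "(wt s \<xi> * cmod (hat f \<xi>)) * (min d (A + 1) * wt (2 * real k) \<xi>) = min d (A + 1) * (wt (s + 2 * real k) \<xi> * cmod (hat f \<xi>))"
      unfolding wt_add by (simp only: mult_ac)
    ultimately show "wt s \<xi> * cmod (complex_of_real (m \<xi> - 1) * hat f \<xi>) \<le> min d (A + 1) * (wt (s + 2 * real k) \<xi> * cmod (hat f \<xi>))"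
      by (simp only:)
  qed
qed

lemma wave_solution_mono:
  assumes "wave_solution m p s T v v'" "T' \<le> T" shows "wave_solution m p s T' v v'"
  unfolding wave_solution_def
proof
  fix t assume t: "t \<in> {0..T'}"
  then have tT: "t \<in> {0..T}" and sub: "{0..T'} \<subseteq> {0..T}" using assms(2) by auto
  have lim: "(f \<longlongrightarrow> 0) (at t within {0..T'})" if "(f \<longlongrightarrow> 0) (at t within {0..T})" for f :: "real \<Rightarrow> real"
    by (rule tendsto_within_subset[OF that sub])
  show "Sob (s + 1) (v t) \<and> Sob s (v' t) \<and> (\<forall>x. cnj (v t x) = v t x) \<and>
     (AE \<xi> in lborel. hat (v' t) \<xi> = - (m \<xi> * hat (dx (flux p (v t))) \<xi>)) \<and>
     ((\<lambda>\<tau>. Sob_norm s (\<lambda>x. v \<tau> x - v t x)) \<longlongrightarrow> 0) (at t within {0..T'}) \<and>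
     ((\<lambda>\<tau>. Sob_norm s (\<lambda>x. (v \<tau> x - v t x) / complex_of_real (\<tau> - t) - v' t x)) \<longlongrightarrow> 0) (at t within {0..T'})"
    using assms(1) tT by (auto simp: wave_solution_def intro!: lim)
qed

lemma wave_solution_X:
  assumes "wave_solution m p s T v v'" "t \<in> {0..T}"
  shows "Sob (s + 1) (v t)" "Sob s (v t)" "Sob s (v' t)"
  using assms Sob_mono(1)[of "s + 1" "v t" s] by (auto simp: wave_solution_def)

lemma wave_solution_diff_continuous:
  assumes v: "wave_solution m p s T v v'" and u: "wave_solution m' p s T u u'"
  shows "continuous_on {0..T} (\<lambda>t. Sob_norm s (\<lambda>x. v t x - u t x))"
  unfolding continuous_on_def
proof
  fix t assume t: "t \<in> {0..T}"
  let ?F = "at t within {0..T}" and ?y = "\<lambda>t. Sob_norm s (\<lambda>x. v t x - u t x)"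
  show "(?y \<longlongrightarrow> ?y t) ?F"
  proof (rule LIM_zero_cancel, rule tendsto_rabs_zero_cancel, rule tendsto_sandwich[OF _ _ tendsto_const[of 0]])
    show "((\<lambda>\<tau>. Sob_norm s (\<lambda>x. v \<tau> x - v t x) + Sob_norm s (\<lambda>x. u \<tau> x - u t x)) \<longlongrightarrow> 0) ?F"
      using v u t by (auto simp: wave_solution_def intro: tendsto_add_zero)
    have "\<bar>?y \<tau> - ?y t\<bar> \<le> Sob_norm s (\<lambda>x. v \<tau> x - v t x) + Sob_norm s (\<lambda>x. u \<tau> x - u t x)" if \<tau>: "\<tau> \<in> {0..T}" for \<tau>
    proof -
      note Xs = wave_solution_X(2)[OF v t] wave_solution_X(2)[OF u t] wave_solution_X(2)[OF v \<tau>] wave_solution_X(2)[OF u \<tau>]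
      note D = Sob_diff(1)[OF Xs(3,4)] Sob_diff(1)[OF Xs(1,2)]
      have eq: "(\<lambda>x. (v \<tau> x - u \<tau> x) - (v t x - u t x)) = (\<lambda>x. (v \<tau> x - v t x) - (u \<tau> x - u t x))"
        by (rule ext) simp
      have "Sob_norm s (\<lambda>x. (v \<tau> x - u \<tau> x) - (v t x - u t x)) \<le> Sob_norm s (\<lambda>x. v \<tau> x - v t x) + Sob_norm s (\<lambda>x. u \<tau> x - u t x)"
        unfolding eq by (rule Sob_diff(2)[OF Sob_diff(1)[OF Xs(3,1)] Sob_diff(1)[OF Xs(4,2)]])
      then show ?thesis
        using Sob_norm_triangle[OF D] Sob_norm_triangle[OF D(2,1)] Sob_norm_minus_commute[OF D] by linarith
    qed
    then show "\<forall>\<^sub>F \<tau> in ?F. \<bar>?y \<tau> - ?y t\<bar> \<le> Sob_norm s (\<lambda>x. v \<tau> x - v t x) + Sob_norm s (\<lambda>x. u \<tau> x - u t x)"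
      by (simp add: eventually_at_filter)
  qed simp
qed

text \<open>With \<open>B\<close> bounding the error on the whole interval, the growth rate of the
  energy is a constant and \<open>Dini_upper_bound\<close> applies. Equal initial data start the
  energy at 0, and \<open>energy_lower_bound\<close> returns to the norm.\<close>

lemma energy_growth:
  assumes s: "s > 3 / 2" and p: "p \<ge> 1" and A: "0 \<le> A" and K0: "0 \<le> K"
    and K: "\<And>t. t \<in> {0..T} \<Longrightarrow>
      sq_int (weighted_rhs s m p (v t) (u t)) \<and>
      eform (wave_coeff p (v t)) (err s (v t) (u t)) (weighted_rhs s m p (v t) (u t))
      \<le> K * Sob_norm s (\<lambda>x. v t x - u t x) * (Sob_norm s (\<lambda>x. v t x - u t x) + d)"
    and d: "0 \<le> d" and T: "0 \<le> T"
    and v: "wave_solution m p s T v v'" and u: "wave_solution (\<lambda>_. 1) p s T u u'" and init: "v 0 = u 0"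
    and mm [measurable]: "m \<in> borel_measurable borel" and mA: "\<And>\<xi>. \<bar>m \<xi>\<bar> \<le> A"
    and small: "\<And>t. t \<in> {0..T} \<Longrightarrow> l1 (wave_coeff p (v t)) \<le> 1 / 4" and vb: "\<And>t. t \<in> {0..T} \<Longrightarrow> Sob_norm s (v t) \<le> 1"
    and B: "\<And>t. t \<in> {0..T} \<Longrightarrow> Sob_norm s (\<lambda>x. v t x - u t x) \<le> B"
  shows "(Sob_norm s (\<lambda>x. v T x - u T x))\<^sup>2 / 2
    \<le> T * (2 * (K * B * (B + d)) + 2 * (lip_const p s * (A * (1 + alg_const s ^ p))) * B\<^sup>2)"
proof -
  let ?V = "A * (1 + alg_const s ^ p)"
  let ?m = "2 * (K * B * (B + d)) + 2 * (lip_const p s * ?V) * B\<^sup>2"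
  let ?f = "\<lambda>t. energy p s (v t) (u t)"
  have V0: "0 \<le> ?V" using A by simp
  have s1: "s > 1 / 2" "s - 1 > 1 / 2" "s + 1 > 1 / 2" using s by auto
  \<comment> \<open>The equation trades the time derivative for a bounded multiplier and one space
    derivative of the flux, hence the loss of one order and the factor \<open>A\<close>.\<close>
  have V: "Sob_norm (s - 1) (v' t) \<le> ?V" if t: "t \<in> {0..T}" for t
  proof -
    note Xs = wave_solution_X[OF v t]
    have fX: "Sob s (flux p (v t))" "Sob_norm s (flux p (v t)) \<le> 1 + alg_const s ^ p"
    proof -
      show "Sob s (flux p (v t))" by (rule Sob_flux(1)[OF Xs(2) s1(1)])
      have "alg_const s ^ p * Sob_norm s (v t) ^ (p + 1) \<le> alg_const s ^ p * 1"
        using vb[OF t] by (intro mult_left_mono power_le_one) auto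
      then show "Sob_norm s (flux p (v t)) \<le> 1 + alg_const s ^ p"
        using Sob_flux(2)[OF Xs(2) s1(1), of p] vb[OF t] by linarith
    qed
    have fX': "Sob (s - 1 + 1) (flux p (v t))" using fX(1) by simp
    note dX = Sob_dx[OF fX' s1(2)]
    note M = Sob_fmult[OF dX(1) mm mA]
    have "AE \<xi> in lborel. hat (v' t) \<xi> = - 1 * hat (fmult m (dx (flux p (v t)))) \<xi>"
    proof -
      have "AE \<xi> in lborel. hat (v' t) \<xi> = - (m \<xi> * hat (dx (flux p (v t))) \<xi>)"
        using v t by (auto simp: wave_solution_def)
      then show ?thesis using M(3) by eventually_elim simp
    qed
    then have "Sob_norm (s - 1) (v' t) = Sob_norm (s - 1) (fmult m (dx (flux p (v t))))"
      unfolding Sob_norm_def using Hs_cong_AE(2)[OF Hs_scale(1)[OF Sob_hat(2)[OF M(1)], of "- 1"] Sob_measurable_hat[OF Xs(3)]]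
        Hs_scale(2)[OF Sob_hat(2)[OF M(1)], of "- 1"] by simp
    also have "\<dots> \<le> A * Sob_norm (s - 1 + 1) (flux p (v t))"
      by (rule order_trans[OF M(2) mult_left_mono[OF dX(2) A]])
    also have "\<dots> \<le> ?V" using fX(2) A by (simp add: mult_left_mono)
    finally show ?thesis .
  qed
  have inc: "(?f \<longlongrightarrow> ?f t) (at t within {0..T})"
    "\<eta> > 0 \<Longrightarrow> eventually (\<lambda>\<tau>. t < \<tau> \<longrightarrow> ?f \<tau> \<le> ?f t + (\<tau> - t) * (?m + \<eta>)) (at t within {0..T})"
    if t: "t \<in> {0..T}" for t \<eta>
  proof -
    let ?x = "Sob_norm s (\<lambda>x. v t x - u t x)"
    note E = energy_increment[OF s p v u t small[OF t] vb[OF t] V[OF t] refl conjunct1[OF K[OF t]] conjunct2[OF K[OF t]] refl]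
    show "(?f \<longlongrightarrow> ?f t) (at t within {0..T})" by (rule E(1))
    have xB: "0 \<le> ?x" "?x \<le> B" using B[OF t] by auto
    then have B0: "0 \<le> B" by linarith
    have "2 * (K * ?x * (?x + d)) + 2 * (lip_const p s * ?V) * ?x\<^sup>2 \<le> ?m"
      using xB K0 d B0 A lip_const_nonneg[of p s]
      by (intro add_mono mult_left_mono mult_mono power_mono mult_nonneg_nonneg add_nonneg_nonneg) auto
    then have le: "(\<tau> - t) * (2 * (K * ?x * (?x + d)) + 2 * (lip_const p s * ?V) * ?x\<^sup>2 + \<eta>) \<le> (\<tau> - t) * (?m + \<eta>)" if "t < \<tau>" for \<tau>
      using that by (intro mult_left_mono) auto
    assume "\<eta> > 0"
    from E(2)[OF this] show "eventually (\<lambda>\<tau>. t < \<tau> \<longrightarrow> ?f \<tau> \<le> ?f t + (\<tau> - t) * (?m + \<eta>)) (at t within {0..T})"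
    proof eventually_elim
      case (elim \<tau>)
      show ?case
      proof
        assume "t < \<tau>"
        from elim[rule_format, OF this] le[OF this] show "?f \<tau> \<le> ?f t + (\<tau> - t) * (?m + \<eta>)" by linarith
      qed
    qed
  qed
  have "?f T \<le> ?f 0 + T * ?m"
  proof (rule Dini_upper_bound[OF T])
    show "continuous_on {0..T} ?f" unfolding continuous_on_def using inc(1) by blast
  qed (use inc(2) in auto)
  moreover have "?f 0 = 0"
  proof -
    have "err s (v 0) (u 0) = (\<lambda>\<xi>. 0)" by (rule ext) (simp add: err_def init)
    then show ?thesis by (simp add: energy_def eform_def)
  qed
  moreover have "(Sob_norm s (\<lambda>x. v T x - u T x))\<^sup>2 / 2 \<le> ?f T"
    using T by (intro energy_lower_bound[OF _ _ s1(1) p] wave_solution_X(2)[OF v] wave_solution_X(2)[OF u] small) auto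
  ultimately show ?thesis by linarith
qed

abbreviation error_estimate :: "nat \<Rightarrow> nat \<Rightarrow> real \<Rightarrow> real \<Rightarrow> real \<Rightarrow> (real \<Rightarrow> real \<Rightarrow> complex) \<Rightarrow> real \<Rightarrow> real \<Rightarrow> bool" where
  "error_estimate p k s A T0 u C T \<equiv> \<forall>m d v v'. m \<in> borel_measurable borel \<longrightarrow> (\<forall>\<xi>. \<bar>m \<xi>\<bar> \<le> A) \<longrightarrow>
      (\<forall>\<xi>. \<bar>m \<xi> - 1\<bar> \<le> d * \<bar>\<xi>\<bar> ^ (2 * k)) \<longrightarrow> 0 \<le> d \<longrightarrow> wave_solution m p s T0 v v' \<longrightarrow> v 0 = u 0 \<longrightarrow>
      (\<forall>t\<in>{0..T}. Sob_norm s (\<lambda>x. v t x - u t x) \<le> C * d * t)"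

text \<open>The analytic core, with the kernel replaced by an arbitrary multiplier. The order of
  quantifiers carries the uniformity: \<epsilon> precedes the reference solution, and
  \<open>C\<close> and \<open>T\<close> precede \<open>m\<close>, \<open>d\<close> and
  \<open>v\<close>.\<close>

theorem uniform_error:
  fixes s A :: real and p k :: nat
  assumes s: "s > 3 / 2" and p: "p \<ge> 1" and A: "0 \<le> A"
  shows "\<exists>\<epsilon>>0. \<forall>T0 N u u'. T0 > 0 \<longrightarrow> wave_solution (\<lambda>_. 1) p s T0 u u' \<longrightarrow>
    (\<forall>t\<in>{0..T0}. Sob (s + 2 * real k + 1) (u t) \<and> Sob_norm (s + 2 * real k + 1) (u t) \<le> N) \<longrightarrow> Sob_norm s (u 0) < \<epsilon> \<longrightarrow>
    (\<exists>C>0. \<exists>T>0. T \<le> T0 \<and> error_estimate p k s A T0 u C T)"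
proof -
  define c where "c = emb_const s * (real (p + 1) * alg_const s ^ (p - 1))"
  have c: "0 \<le> c" by (simp add: c_def)
  \<comment> \<open>The reference solution will stay below \<open>2 * \<epsilon>\<close> and the
    error below \<epsilon>, so \<open>v\<close> stays below \<open>3 * \<epsilon>\<close>. The first
    entry makes this at most 1, the second makes \<open>c * (3 * \<epsilon>)\<close> at most 1/4 as
    coercivity demands.\<close>
  define \<epsilon> where "\<epsilon> = min (1 / 3) (1 / (12 * (c + 1)))"
  have \<epsilon>: "\<epsilon> > 0" "\<epsilon> \<le> 1 / 3" using c by (auto simp: \<epsilon>_def)
  have "\<epsilon> \<le> 1 / (12 * (c + 1))" unfolding \<epsilon>_def by simp
  then have "\<epsilon> * (12 * (c + 1)) \<le> 1" using c by (simp add: pos_le_divide_eq)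
  then have c\<epsilon>: "c * (3 * \<epsilon>) \<le> 1 / 4" using \<epsilon>(1) by (simp add: algebra_simps)
  have s1: "s > 1 / 2" using s by simp
  show ?thesis
  proof (rule exI[of _ \<epsilon>], intro conjI \<epsilon>(1) allI impI)
    fix T0 N :: real and u u'
    assume T0: "T0 > 0" and u: "wave_solution (\<lambda>_. 1) p s T0 u u'"
      and uN: "\<forall>t\<in>{0..T0}. Sob (s + 2 * real k + 1) (u t) \<and> Sob_norm (s + 2 * real k + 1) (u t) \<le> N"
      and u0: "Sob_norm s (u 0) < \<epsilon>"
    have N: "0 \<le> N" 
    proof -
      have "Sob_norm (s + 2 * real k + 1) (u 0) \<le> N" using uN T0 by simp
      then show ?thesis by (rule order_trans[OF Sob_norm_nonneg])
    qed
    obtain K where K0: "0 \<le> K" and K': "energy_estimate p s A N K"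
      using energy_inequality_unit[OF s p A N] by (elim exE conjE)
    note K = K'[rule_format]
    define G where "G = N + alg_const (s + 2 * real k + 1) ^ p * N ^ (p + 1)"
    have G: "0 \<le> G" using N by (simp add: G_def)
    have fG: "Sob (s + 2 * real k) (dx (flux p (u t)))" "Sob_norm (s + 2 * real k) (dx (flux p (u t))) \<le> G"
      if t: "t \<in> {0..T0}" for t
    proof -
      have Xu: "Sob (s + 2 * real k + 1) (u t)" "Sob_norm (s + 2 * real k + 1) (u t) \<le> N" using uN t by auto
      have s2: "s + 2 * real k + 1 > 1 / 2" "s + 2 * real k > 1 / 2" using s by auto
      note F = Sob_flux[OF Xu(1) s2(1), of p]
      show "Sob (s + 2 * real k) (dx (flux p (u t)))" by (rule Sob_dx(1)[OF F(1) s2(2)])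
      have "Sob_norm (s + 2 * real k + 1) (flux p (u t)) \<le> G"
        unfolding G_def using Xu(2) N by (intro order_trans[OF F(2)] add_mono mult_left_mono power_mono) auto
      then show "Sob_norm (s + 2 * real k) (dx (flux p (u t))) \<le> G"
        using Sob_dx(2)[OF F(1) s2(2)] by linarith
    qed
    define L where "L = lip_const p s * (A * (1 + alg_const s ^ p))"
    have L: "0 \<le> L" using A lip_const_nonneg[of p s] by (simp add: L_def)
    define dmax where "dmax = (A + 1) * G"
    have dmax: "0 \<le> dmax" using A G by (simp add: dmax_def)
    have "((\<lambda>\<tau>. Sob_norm s (\<lambda>x. u \<tau> x - u 0 x)) \<longlongrightarrow> 0) (at 0 within {0..T0})"
      using u T0 by (auto simp: wave_solution_def)
    then have "eventually (\<lambda>\<tau>. Sob_norm s (\<lambda>x. u \<tau> x - u 0 x) < \<epsilon>) (at 0 within {0..T0})"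
      by (rule order_tendstoD) (rule \<epsilon>(1))
    then obtain r where r: "r > 0" and rr: "\<And>\<tau>. \<tau> \<in> {0..T0} \<Longrightarrow> \<tau> \<noteq> 0 \<Longrightarrow> dist \<tau> 0 < r \<Longrightarrow> Sob_norm s (\<lambda>x. u \<tau> x - u 0 x) < \<epsilon>"
      unfolding eventually_at by blast
    \<comment> \<open>\<open>r / 2\<close> keeps \<open>u\<close> within \<epsilon> of its initial
      value; the third entry lets the terms quadratic in the error be absorbed; the last one gives
      \<open>8 * K * T * dmax < \<epsilon>\<close> and closes the continuation argument. None of
      them involves the multiplier.\<close>
    define T where "T = min (min T0 (r / 2)) (min (1 / (8 * (K + L + 1))) (\<epsilon> / (16 * (K + 1) * (dmax + 1))))"
    have T: "T > 0" "T \<le> T0" "T < r" "T \<le> 1 / (8 * (K + L + 1))" "T \<le> \<epsilon> / (16 * (K + 1) * (dmax + 1))"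
      using T0 r K0 L \<epsilon>(1) dmax by (auto simp: T_def)
    have T4: "T * (8 * (K + L + 1)) \<le> 1" using T(4) K0 L by (simp add: pos_le_divide_eq)
    have T5: "T * (16 * (K + 1) * (dmax + 1)) \<le> \<epsilon>" using T(5) K0 dmax by (simp add: pos_le_divide_eq)
    have u2: "Sob_norm s (u t) \<le> 2 * \<epsilon>" if t: "t \<in> {0..T}" for t
    proof (cases "t = 0")
      case False
      then have "Sob_norm s (\<lambda>x. u t x - u 0 x) < \<epsilon>" using rr[of t] t T by (auto simp: dist_real_def)
      moreover have "t \<in> {0..T0}" "0 \<in> {0..T0}" using t T by auto
      ultimately show ?thesis
        using Sob_norm_triangle[OF wave_solution_X(2)[OF u] wave_solution_X(2)[OF u], of t 0] u0 by fastforce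
    qed (use u0 \<epsilon> in simp)
    show "\<exists>C>0. \<exists>T>0. T \<le> T0 \<and> error_estimate p k s A T0 u C T"
    \<comment> \<open>\<open>8 * K * G\<close> is what \<open>step\<close> delivers together with
      \<open>dd \<le> d * G\<close>; the 1 secures positivity.\<close>
    proof (rule exI[of _ "8 * K * G + 1"], intro conjI)
      show "0 < 8 * K * G + 1" using K0 G by (simp add: add_nonneg_pos)
      show "\<exists>T>0. T \<le> T0 \<and> error_estimate p k s A T0 u (8 * K * G + 1) T"
      proof (intro exI[of _ T] conjI T(1,2) allI impI)
        fix m :: "real \<Rightarrow> real" and d v v'
        assume mm: "m \<in> borel_measurable borel" and mA: "\<forall>\<xi>. \<bar>m \<xi>\<bar> \<le> A"
          and md: "\<forall>\<xi>. \<bar>m \<xi> - 1\<bar> \<le> d * \<bar>\<xi>\<bar> ^ (2 * k)" and d: "0 \<le> d"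
          and v: "wave_solution m p s T0 v v'" and init: "v 0 = u 0"
        define dd where "dd = min d (A + 1) * G"
        have dd: "0 \<le> dd" "dd \<le> d * G" "dd \<le> dmax"
          using d A G by (auto simp: dd_def dmax_def intro: mult_right_mono)
        define y where "y t = Sob_norm s (\<lambda>x. v t x - u t x)" for t
        note vT = wave_solution_mono[OF v T(2)] and uT = wave_solution_mono[OF u T(2)]
        have yc: "continuous_on {0..T} y" unfolding y_def by (rule wave_solution_diff_continuous[OF vT uT])
        have y0: "y 0 = 0"
        proof -
          have "0 \<in> {0..T0}" using T0 by simp
          from wave_solution_X(2)[OF u this] have "Sob_norm s (\<lambda>x. 0 * u 0 x) = 0" using Sob_scale(2)[of s "u 0" 0] by simp
          then show ?thesis by (simp add: y_def init)
        qed
        have step: "y \<tau> \<le> 8 * K * \<tau> * dd"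
          if \<tau>: "0 \<le> \<tau>" "\<tau> \<le> T" and y\<epsilon>: "\<And>t. 0 \<le> t \<Longrightarrow> t \<le> \<tau> \<Longrightarrow> y t \<le> \<epsilon>" for \<tau>
        proof -
          have "continuous_on {0..\<tau>} y" by (rule continuous_on_subset[OF yc]) (use \<tau> in auto)
          moreover have "{0..\<tau>} \<noteq> {}" using \<tau> by simp
          \<comment> \<open>The energy estimate is run up to the time of the largest error, so that
            the same number \<open>?B\<close> stands on both sides of \<open>main\<close>.\<close>
          ultimately obtain tm where tm: "tm \<in> {0..\<tau>}" and mx: "\<And>t. t \<in> {0..\<tau>} \<Longrightarrow> y t \<le> y tm"
            using continuous_attains_sup[OF compact_Icc] by blast
          let ?B = "y tm"
          have tmT: "tm \<le> T" "0 \<le> tm" using tm \<tau> by auto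
          have inT: "t \<in> {0..T}" "t \<in> {0..T0}" "t \<in> {0..\<tau>}" if "t \<in> {0..tm}" for t
            using that tm \<tau> T(2) by auto
          have nmv: "Sob_norm s (v t) \<le> 3 * \<epsilon>" if t: "t \<in> {0..tm}" for t
            using Sob_norm_triangle[OF wave_solution_X(2)[OF vT inT(1)[OF t]] wave_solution_X(2)[OF uT inT(1)[OF t]]]
              y\<epsilon>[of t] u2[OF inT(1)[OF t]] inT(3)[OF t] by (auto simp: y_def)
          have nmv1: "Sob_norm s (v t) \<le> 1" if t: "t \<in> {0..tm}" for t using nmv[OF t] \<epsilon> by linarith
          have small: "l1 (wave_coeff p (v t)) \<le> 1 / 4" if t: "t \<in> {0..tm}" for t
          proof -
            \<comment> \<open>With the norm at most 1 and \<open>p >= 1\<close>, the power may be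
              replaced by the norm itself, so that smallness is linear in \<epsilon>.\<close>
            have "Sob_norm s (v t) ^ p \<le> Sob_norm s (v t) ^ 1"
              using nmv1[OF t] p by (intro power_decreasing) auto
            then have "Sob_norm s (v t) ^ p \<le> 3 * \<epsilon>" using nmv[OF t] by simp
            then have "c * Sob_norm s (v t) ^ p \<le> c * (3 * \<epsilon>)" using c by (rule mult_left_mono)
            then show ?thesis
              using wave_coeff(4)[OF wave_solution_X(2)[OF vT inT(1)[OF t]] s1 p] c\<epsilon>
              by (simp add: c_def mult.assoc)
          qed
          have Kt: "sq_int (weighted_rhs s m p (v t) (u t)) \<and>
            eform (wave_coeff p (v t)) (err s (v t) (u t)) (weighted_rhs s m p (v t) (u t))
            \<le> K * Sob_norm s (\<lambda>x. v t x - u t x) * (Sob_norm s (\<lambda>x. v t x - u t x) + dd)" if t: "t \<in> {0..tm}" for t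
          proof (rule K[OF mm mA[rule_format] wave_solution_X(1)[OF vT inT(1)[OF t]] wave_solution_X(1)[OF uT inT(1)[OF t]] nmv1[OF t]])
            show "Sob_norm s (u t) \<le> 1" using u2[OF inT(1)[OF t]] \<epsilon> by linarith
            have "Sob (s + 2 * real k + 1) (u t)" "Sob_norm (s + 2 * real k + 1) (u t) \<le> N" using uN inT(2)[OF t] by auto
            then show "Sob_norm (s + 1) (u t) \<le> N" using Sob_mono(2)[of "s + 2 * real k + 1" "u t" "s + 1"] by simp
            have "hs s (\<lambda>\<xi>. complex_of_real (m \<xi> - 1) * hat (dx (flux p (u t))) \<xi>)
                \<le> min d (A + 1) * Sob_norm (s + 2 * real k) (dx (flux p (u t)))"
              using multiplier_error[OF fG(1)[OF inT(2)[OF t]] mm A d] mA md by blast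
            also have "\<dots> \<le> dd" unfolding dd_def using fG(2)[OF inT(2)[OF t]] d A by (intro mult_left_mono) auto
            finally show "hs s (\<lambda>\<xi>. complex_of_real (m \<xi> - 1) * hat (dx (flux p (u t))) \<xi>) \<le> dd" .
          qed
          have yB: "Sob_norm s (\<lambda>x. v t x - u t x) \<le> ?B" if t: "t \<in> {0..tm}" for t
            using mx[OF inT(3)[OF t]] by (simp add: y_def)
          have main: "?B\<^sup>2 / 2 \<le> tm * (2 * (K * ?B * (?B + dd)) + 2 * L * ?B\<^sup>2)"
            using energy_growth[OF s p A K0 Kt dd(1) tmT(2) wave_solution_mono[OF vT tmT(1)] wave_solution_mono[OF uT tmT(1)]
                init mm mA[rule_format] small nmv1 yB]
            by (simp add: y_def L_def)
          have B0: "0 \<le> ?B" by (simp add: y_def)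
          \<comment> \<open>One factor \<open>?B\<close> is divided out of \<open>main\<close>, and
            the remaining terms proportional to \<open>?B\<close> are absorbed because \<tau> is
            small. The result is linear in \<open>\<tau>\<close> and \<open>dd\<close>; taking a
            square root instead would lose half of both orders.\<close>
          have "?B \<le> 8 * K * \<tau> * dd"
          proof (cases "?B = 0")
            case True then show ?thesis using K0 \<tau> dd by simp
          next
            case False
            then have Bp: "0 < ?B" using B0 by simp
            have "tm * (2 * (K * ?B * (?B + dd)) + 2 * L * ?B\<^sup>2) \<le> \<tau> * (2 * (K * ?B * (?B + dd)) + 2 * L * ?B\<^sup>2)"
              using tm K0 L dd B0 by (intro mult_right_mono add_nonneg_nonneg mult_nonneg_nonneg) auto
            with main have "?B * (?B / 2) \<le> ?B * (\<tau> * (2 * (K * (?B + dd)) + 2 * L * ?B))"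
              by (simp add: power2_eq_square algebra_simps)
            then have "?B / 2 \<le> \<tau> * (2 * (K * (?B + dd)) + 2 * L * ?B)" using Bp by (rule mult_left_le_imp_le)
            also have "\<dots> = (\<tau> * (2 * (K + L))) * ?B + 2 * K * \<tau> * dd" by (simp add: algebra_simps)
            also have "\<dots> \<le> (1 / 4) * ?B + 2 * K * \<tau> * dd"
            proof (intro add_right_mono mult_right_mono B0)
              have "0 \<le> 8 * (K + L + 1)" using K0 L by simp
              from mult_right_mono[OF \<tau>(2) this] T4 have "\<tau> * (8 * (K + L + 1)) \<le> 1" by linarith
              then show "\<tau> * (2 * (K + L)) \<le> 1 / 4" using \<tau>(1) by (simp add: algebra_simps)
            qed
            finally show ?thesis by simp
          qed
          moreover have "y \<tau> \<le> ?B" using mx[of \<tau>] \<tau> by simp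
          ultimately show ?thesis by linarith
        qed
        have fin: "y t \<le> \<epsilon>" if t: "0 \<le> t" "t \<le> T" for t
        proof (rule bootstrap_bound[OF yc _ _ t])
          show "y 0 < \<epsilon>" using y0 \<epsilon> by simp
          fix \<tau> assume \<tau>: "0 \<le> \<tau>" "\<tau> \<le> T" and "\<And>t. 0 \<le> t \<Longrightarrow> t \<le> \<tau> \<Longrightarrow> y t \<le> \<epsilon>"
          then have "y \<tau> \<le> 8 * K * \<tau> * dd" by (rule step)
          also have "\<dots> \<le> 8 * K * T * dmax" using \<tau> K0 dd by (intro mult_mono mult_left_mono) auto
          also have "\<dots> < \<epsilon>"
          proof -
            have "8 * K * T * dmax \<le> T * (8 * (K + 1) * (dmax + 1))"
              using T(1) K0 dmax by (simp add: algebra_simps)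
            moreover have "T * (16 * (K + 1) * (dmax + 1)) = 2 * (T * (8 * (K + 1) * (dmax + 1)))" by simp
            ultimately show ?thesis using T5 \<epsilon>(1) by linarith
          qed
          finally show "y \<tau> < \<epsilon>" .
        qed
        show "\<forall>t\<in>{0..T}. Sob_norm s (\<lambda>x. v t x - u t x) \<le> (8 * K * G + 1) * d * t"
        proof
          fix t assume t: "t \<in> {0..T}"
          have "y t \<le> 8 * K * t * dd" by (rule step) (use t fin in auto)
          also have "\<dots> \<le> 8 * K * t * (d * G)" using t K0 dd by (intro mult_left_mono) auto
          also have "\<dots> = (8 * K * G) * (d * t)" by simp
          also have "\<dots> \<le> (8 * K * G + 1) * (d * t)" using d t by (intro mult_right_mono) auto
          finally show "Sob_norm s (\<lambda>x. v t x - u t x) \<le> (8 * K * G + 1) * d * t" by (simp add: y_def mult.assoc)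
        qed
      qed
    qed
  qed
qed

subsection \<open>Multipliers of even kernels\<close>

text \<open>The symbol of convolution with an even kernel: the sine part of its transform vanishes,
  which leaves this real function.\<close>

definition kmult :: "kernel \<Rightarrow> real \<Rightarrow> real" where
  "kmult \<alpha> \<xi> = kint \<alpha> (\<lambda>y. cos (\<xi> * y))"

lemma finite_borel_measureD:
  assumes "finite_borel_measure M" shows "finite_measure M" "sets M = sets borel" "space M = UNIV"
  using assms sets_eq_imp_space_eq[of M borel]
  by (auto simp: finite_borel_measure_def finite_borel_measure_axioms_def)

lemma integrable_finite_borel_bounded:
  fixes f :: "real \<Rightarrow> 'b::{banach, second_countable_topology}"
  assumes M: "finite_borel_measure M" and f: "f \<in> borel_measurable borel" and B: "\<And>x. norm (f x) \<le> B"
  shows "integrable M f"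
proof -
  interpret finite_measure M by (rule finite_borel_measureD(1)[OF M])
  show ?thesis
    by (rule integrable_const_bound[of _ B]) (use B f measurable_cong_sets[OF finite_borel_measureD(2)[OF M] refl] in auto)
qed

lemma integral_ft_translate:
  assumes M: "finite_borel_measure M" and F: "integrable lborel F"
  shows "(LINT y|M. ft F (x - y)) = (LINT \<xi>|lborel. F \<xi> * iexp (x * \<xi>) * (LINT y|M. iexp (- (\<xi> * y))))"
proof -
  note Md = finite_borel_measureD[OF M]
  interpret M: finite_measure M by (rule Md(1))
  interpret P: pair_sigma_finite M lborel by standard
  have [measurable]: "F \<in> borel_measurable borel" by (rule integrable_lborel_measurable[OF F])
  have [measurable_cong]: "sets M = sets borel" by (rule Md(2))
  let ?K = "\<lambda>y \<xi>. F \<xi> * iexp ((x - y) * \<xi>)"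
  have Km: "(\<lambda>(y, \<xi>). ?K y \<xi>) \<in> borel_measurable (M \<Otimes>\<^sub>M lborel)" by measurable
  have int: "integrable (M \<Otimes>\<^sub>M lborel) (\<lambda>(y, \<xi>). ?K y \<xi>)"
  proof (subst integrable_iff_bounded, intro conjI Km)
    have "(\<integral>\<^sup>+z. ennreal (norm (case z of (y, \<xi>) \<Rightarrow> ?K y \<xi>)) \<partial>(M \<Otimes>\<^sub>M lborel))
        = (\<integral>\<^sup>+y. \<integral>\<^sup>+\<xi>. ennreal (cmod (?K y \<xi>)) \<partial>lborel \<partial>M)"
      by (subst lborel.nn_integral_fst[symmetric]) (use Km in auto)
    also have "\<dots> = (\<integral>\<^sup>+y. ennreal (l1 F) \<partial>M)"
      by (simp add: norm_mult nn_l1[OF F])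
    also have "\<dots> < \<infinity>" by (simp add: ennreal_mult_eq_top_iff M.emeasure_finite less_top[symmetric])
    finally show "(\<integral>\<^sup>+z. ennreal (norm (case z of (y, \<xi>) \<Rightarrow> ?K y \<xi>)) \<partial>(M \<Otimes>\<^sub>M lborel)) < \<infinity>" .
  qed
  have "(LINT y|M. ft F (x - y)) = (LINT y|M. LINT \<xi>|lborel. ?K y \<xi>)" by (simp add: ft_def)
  also have "\<dots> = (LINT \<xi>|lborel. LINT y|M. ?K y \<xi>)"
    by (rule P.Fubini_integral[symmetric]) (use int in simp)
  also have "\<dots> = (LINT \<xi>|lborel. F \<xi> * iexp (x * \<xi>) * (LINT y|M. iexp (- (\<xi> * y))))"
  proof (intro Bochner_Integration.integral_cong refl)
    fix \<xi>
    have "?K y \<xi> = (F \<xi> * iexp (x * \<xi>)) * iexp (- (\<xi> * y))" for y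
      by (simp add: exp_add[symmetric] algebra_simps)
    then show "(LINT y|M. ?K y \<xi>) = F \<xi> * iexp (x * \<xi>) * (LINT y|M. iexp (- (\<xi> * y)))"
      by (simp only: integral_mult_right_zero)
  qed
  finally show ?thesis .
qed

lemma integral_iexp_minus:
  assumes M: "finite_borel_measure M"
  shows "(LINT y|M. iexp (- (\<xi> * y))) = complex_of_real (LINT y|M. cos (\<xi> * y)) - \<i> * complex_of_real (LINT y|M. sin (\<xi> * y))"
proof -
  have c: "integrable M (\<lambda>y. complex_of_real (cos (\<xi> * y)))" "integrable M (\<lambda>y. complex_of_real (sin (\<xi> * y)))"
    by (rule integrable_finite_borel_bounded[OF M, of _ 1]; simp)+
  have "iexp (- (\<xi> * y)) = complex_of_real (cos (\<xi> * y)) - \<i> * complex_of_real (sin (\<xi> * y))" for y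
    unfolding cis_conv_exp[symmetric] by (simp add: complex_eq_iff)
  then have "(LINT y|M. iexp (- (\<xi> * y))) = (LINT y|M. complex_of_real (cos (\<xi> * y)) - \<i> * complex_of_real (sin (\<xi> * y)))"
    by (simp only:)
  also have "\<dots> = (LINT y|M. complex_of_real (cos (\<xi> * y))) - (LINT y|M. \<i> * complex_of_real (sin (\<xi> * y)))"
    by (rule Bochner_Integration.integral_diff) (use c in auto)
  finally show ?thesis by (simp only: integral_mult_right_zero integral_complex_of_real)
qed

text \<open>Fubini against the inversion formula. Evenness is stated through vanishing sine
  integrals, a condition that passes to scaled kernels by substitution, without returning to the
  Jordan decomposition.\<close>

lemma kconv_eq_fmult:
  assumes M: "finite_borel_measure (fst \<alpha>)" "finite_borel_measure (snd \<alpha>)"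
    and odd: "\<And>\<xi>. kint \<alpha> (\<lambda>y. sin (\<xi> * y)) = 0"
    and W: "Sob \<sigma> W" and g: "\<And>x. W x = complex_of_real (g x)"
  shows "complex_of_real (kconv \<alpha> g x) = fmult (kmult \<alpha>) W x"
proof -
  have F: "integrable lborel (hat W)" by (rule Sob_hat(1)[OF W])
  have [measurable]: "hat W \<in> borel_measurable borel" by (rule Sob_measurable_hat[OF W])
  have Wft: "W = ft (hat W)" by (simp add: Sob_hat(3)[OF W])
  have one: "complex_of_real (LINT y|M. g (x - y)) = (LINT \<xi>|lborel. hat W \<xi> * iexp (x * \<xi>) * (LINT y|M. iexp (- (\<xi> * y))))"
    if "finite_borel_measure M" for M
  proof -
    have "complex_of_real (LINT y|M. g (x - y)) = (LINT y|M. ft (hat W) (x - y))"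
      unfolding Wft[symmetric] g by (rule integral_complex_of_real[symmetric])
    then show ?thesis unfolding integral_ft_translate[OF that F] .
  qed
  have int: "integrable lborel (\<lambda>\<xi>. hat W \<xi> * iexp (x * \<xi>) * (LINT y|M. iexp (- (\<xi> * y))))"
    if M: "finite_borel_measure M" for M
  proof (rule Bochner_Integration.integrable_bound)
    note Md = finite_borel_measureD[OF M]
    interpret M: finite_measure M by (rule Md(1))
    have [measurable_cong]: "sets M = sets borel" by (rule Md(2))
    show "integrable lborel (\<lambda>\<xi>. measure M UNIV * cmod (hat W \<xi>))" using integrable_norm[OF F] by simp
    have [measurable]: "(\<lambda>\<xi>. LINT y|M. iexp (- (\<xi> * y))) \<in> borel_measurable borel"
      by (rule M.borel_measurable_lebesgue_integral) measurable
    show "(\<lambda>\<xi>. hat W \<xi> * iexp (x * \<xi>) * (LINT y|M. iexp (- (\<xi> * y)))) \<in> borel_measurable lborel" by measurable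
    have le: "cmod (LINT y|M. iexp (- (\<xi> * y))) \<le> measure M UNIV" for \<xi>
    proof -
      have "cmod (LINT y|M. iexp (- (\<xi> * y))) \<le> (LINT y|M. cmod (iexp (- (\<xi> * y))))" by (rule integral_norm_bound)
      also have "\<dots> = measure M UNIV" by (simp add: Md(3))
      finally show ?thesis .
    qed
    show "AE \<xi> in lborel. norm (hat W \<xi> * iexp (x * \<xi>) * (LINT y|M. iexp (- (\<xi> * y)))) \<le> norm (measure M UNIV * cmod (hat W \<xi>))"
    proof (rule AE_I2)
      fix \<xi>
      show "norm (hat W \<xi> * iexp (x * \<xi>) * (LINT y|M. iexp (- (\<xi> * y)))) \<le> norm (measure M UNIV * cmod (hat W \<xi>))"
        using mult_right_mono[OF le[of \<xi>] norm_ge_zero[of "hat W \<xi>"]] by (simp add: norm_mult mult.commute)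
    qed
  qed
  have "complex_of_real (kconv \<alpha> g x) = (LINT \<xi>|lborel. hat W \<xi> * iexp (x * \<xi>) * (LINT y|fst \<alpha>. iexp (- (\<xi> * y))))
      - (LINT \<xi>|lborel. hat W \<xi> * iexp (x * \<xi>) * (LINT y|snd \<alpha>. iexp (- (\<xi> * y))))"
    unfolding kconv_def kint_def of_real_diff one[OF M(1)] one[OF M(2)] ..
  also have "\<dots> = (LINT \<xi>|lborel. hat W \<xi> * iexp (x * \<xi>) * (LINT y|fst \<alpha>. iexp (- (\<xi> * y)))
      - hat W \<xi> * iexp (x * \<xi>) * (LINT y|snd \<alpha>. iexp (- (\<xi> * y))))"
    by (rule Bochner_Integration.integral_diff[symmetric, OF int[OF M(1)] int[OF M(2)]])
  also have "\<dots> = (LINT \<xi>|lborel. kmult \<alpha> \<xi> * hat W \<xi> * iexp (x * \<xi>))"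
  proof (intro Bochner_Integration.integral_cong refl)
    fix \<xi>
    have "(LINT y|fst \<alpha>. iexp (- (\<xi> * y))) - (LINT y|snd \<alpha>. iexp (- (\<xi> * y)))
        = complex_of_real (kmult \<alpha> \<xi>) - \<i> * complex_of_real (kint \<alpha> (\<lambda>y. sin (\<xi> * y)))"
      unfolding integral_iexp_minus[OF M(1)] integral_iexp_minus[OF M(2)] kmult_def kint_def
      by (simp add: algebra_simps)
    then have eq: "(LINT y|fst \<alpha>. iexp (- (\<xi> * y))) - (LINT y|snd \<alpha>. iexp (- (\<xi> * y))) = complex_of_real (kmult \<alpha> \<xi>)"
      by (simp add: odd)
    show "hat W \<xi> * iexp (x * \<xi>) * (LINT y|fst \<alpha>. iexp (- (\<xi> * y))) - hat W \<xi> * iexp (x * \<xi>) * (LINT y|snd \<alpha>. iexp (- (\<xi> * y)))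
        = kmult \<alpha> \<xi> * hat W \<xi> * iexp (x * \<xi>)"
      unfolding right_diff_distrib[symmetric] eq by (simp only: mult_ac)
  qed
  finally show ?thesis by (simp only: fmult_def ft_def)
qed

lemma kscale_props:
  assumes "finite_borel_measure (fst \<alpha>)" "finite_borel_measure (snd \<alpha>)"
  shows "finite_borel_measure (fst (kscale \<delta> \<alpha>))" "finite_borel_measure (snd (kscale \<delta> \<alpha>))"
    and "f \<in> borel_measurable borel \<Longrightarrow> kint (kscale \<delta> \<alpha>) f = kint \<alpha> (\<lambda>y. f (\<delta> * y))"
proof -
  have m: "(\<lambda>x. \<delta> * x) \<in> measurable M borel" if "finite_borel_measure M" for M
    by (subst measurable_cong_sets[OF finite_borel_measureD(2)[OF that] refl]) measurable
  have fin: "finite_borel_measure (distr M borel (\<lambda>x. \<delta> * x))" if "finite_borel_measure M" for M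
  proof -
    interpret finite_measure M by (rule finite_borel_measureD(1)[OF that])
    show ?thesis
      by (intro finite_borel_measure.intro finite_borel_measure_axioms.intro finite_measure_distr m[OF that]) simp
  qed
  show "finite_borel_measure (fst (kscale \<delta> \<alpha>))" "finite_borel_measure (snd (kscale \<delta> \<alpha>))"
    using fin assms by (simp_all add: kscale_def)
  show "kint (kscale \<delta> \<alpha>) f = kint \<alpha> (\<lambda>y. f (\<delta> * y))" if "f \<in> borel_measurable borel"
    unfolding kint_def kscale_def fst_conv snd_conv
    by (subst (1 2) integral_distr) (use that m assms in auto)
qed

text \<open>Comparing the even set function $M - N$ on \<open>B \<inter> A\<close> and on its reflection gives
  $M(B) \le M(-B)$, so \<open>M\<close> is itself even.\<close>

lemma Jordan_part_even:
  assumes M: "finite_borel_measure M" and N: "finite_borel_measure N"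
    and A: "A \<in> sets borel" "emeasure M (- A) = 0" "emeasure N A = 0"
    and even: "\<And>B. B \<in> sets borel \<Longrightarrow> measure M (uminus ` B) - measure N (uminus ` B) = measure M B - measure N B"
  shows "(LINT y|M. sin (\<xi> * y)) = 0"
proof -
  note Md = finite_borel_measureD[OF M] and Nd = finite_borel_measureD[OF N]
  interpret M: finite_measure M by (rule Md(1))
  interpret N: finite_measure N by (rule Nd(1))
  have um: "uminus ` B = uminus -` B" for B :: "real set" by force
  have us: "uminus ` B \<in> sets borel" if "B \<in> sets borel" for B :: "real set"
    unfolding um using measurable_sets[OF borel_measurable_uminus[OF measurable_ident_sets[OF refl]] that] by simp
  have le: "measure M B \<le> measure M (uminus ` B)" if B: "B \<in> sets borel" for B
  proof -
    have BA: "B \<inter> A \<in> sets borel" using A B by simp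
    have "measure M (B - A) \<le> measure M (- A)"
      by (rule M.finite_measure_mono) (use A in \<open>auto simp: Md(2)\<close>)
    then have "measure M (B - A) = 0" using A(2) measure_nonneg[of M "B - A"] by (simp add: measure_def[of M "- A"])
    then have 1: "measure M B = measure M (B \<inter> A)"
      using M.finite_measure_Union[of "B \<inter> A" "B - A"] A B by (simp add: Md(2) Int_Diff_Un Int_Diff_disjoint)
    have "measure N (B \<inter> A) \<le> measure N A"
      by (rule N.finite_measure_mono) (use A in \<open>auto simp: Nd(2)\<close>)
    then have 2: "measure N (B \<inter> A) = 0" using A(3) measure_nonneg[of N "B \<inter> A"] by (simp add: measure_def[of N A])
    have "measure M (uminus ` (B \<inter> A)) \<le> measure M (uminus ` B)"
      by (rule M.finite_measure_mono) (use us[OF B] in \<open>auto simp: Md(2)\<close>)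
    then show ?thesis using even[OF BA] 1 2 measure_nonneg[of N "uminus ` (B \<inter> A)"] by linarith
  qed
  have eq: "measure M (uminus ` B) = measure M B" if B: "B \<in> sets borel" for B
    using le[OF B] le[OF us[OF B]] by (simp add: image_image)
  have mu: "uminus \<in> measurable M borel"
    by (subst measurable_cong_sets[OF Md(2) refl]) measurable
  have "distr M borel uminus = M"
  proof (rule measure_eqI)
    fix B assume "B \<in> sets (distr M borel uminus)"
    then have B: "B \<in> sets borel" by simp
    have "emeasure (distr M borel uminus) B = emeasure M (uminus ` B)"
      using emeasure_distr[OF mu B] by (simp add: um Md(3))
    also have "\<dots> = emeasure M B" by (simp add: M.emeasure_eq_measure eq[OF B])
    finally show "emeasure (distr M borel uminus) B = emeasure M B" .
  qed (simp add: Md(2))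
  then have "(LINT y|M. sin (\<xi> * y)) = (LINT y|distr M borel uminus. sin (\<xi> * y))" by simp
  also have "\<dots> = (LINT y|M. sin (\<xi> * (- y)))" by (rule integral_distr[OF mu]) simp
  also have "\<dots> = - (LINT y|M. sin (\<xi> * y))" by simp
  finally show ?thesis by simp
qed

lemma kint_sin_even:
  assumes sb: "signed_borel \<alpha>" and ev: "even_kernel \<alpha>"
  shows "kint \<alpha> (\<lambda>y. sin (\<xi> * y)) = 0"
proof -
  obtain A where A: "A \<in> sets borel" "emeasure (fst \<alpha>) (- A) = 0" "emeasure (snd \<alpha>) A = 0"
    and M: "finite_borel_measure (fst \<alpha>)" "finite_borel_measure (snd \<alpha>)"
    using sb unfolding signed_borel_def by blast
  have e: "measure (fst \<alpha>) (uminus ` B) - measure (snd \<alpha>) (uminus ` B) = measure (fst \<alpha>) B - measure (snd \<alpha>) B"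
    if "B \<in> sets borel" for B
    using ev that by (simp add: even_kernel_def kmeasure_def)
  have e': "measure (snd \<alpha>) (uminus ` B) - measure (fst \<alpha>) (uminus ` B) = measure (snd \<alpha>) B - measure (fst \<alpha>) B"
    if "B \<in> sets borel" for B
    using e[OF that] by linarith
  have "(LINT y|snd \<alpha>. sin (\<xi> * y)) = 0"
    by (rule Jordan_part_even[OF M(2,1), of "- A"]) (use A e' borel_comp in auto)
  then show ?thesis using Jordan_part_even[OF M A e] by (simp add: kint_def)
qed

lemma kmult_bound:
  assumes M: "finite_borel_measure (fst \<alpha>)" "finite_borel_measure (snd \<alpha>)"
  shows "\<bar>kmult \<alpha> \<xi>\<bar> \<le> measure (fst \<alpha>) UNIV + measure (snd \<alpha>) UNIV"
proof -
  have "\<bar>LINT y|M. cos (\<xi> * y)\<bar> \<le> measure M UNIV" if M: "finite_borel_measure M" for M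
  proof -
    interpret finite_measure M by (rule finite_borel_measureD(1)[OF M])
    have "\<bar>LINT y|M. cos (\<xi> * y)\<bar> \<le> (LINT y|M. \<bar>cos (\<xi> * y)\<bar>)"
      using integral_norm_bound[of M "\<lambda>y. cos (\<xi> * y)"] by simp
    also have "\<dots> \<le> (LINT y|M. 1)"
      by (intro integral_mono integrable_finite_borel_bounded[OF M, of _ 1]) auto
    finally show ?thesis by (simp add: finite_borel_measureD(3)[OF M])
  qed
  from this[OF M(1)] this[OF M(2)] show ?thesis unfolding kmult_def kint_def by linarith
qed

lemma kmult_measurable:
  assumes M: "finite_borel_measure (fst \<alpha>)" "finite_borel_measure (snd \<alpha>)"
  shows "kmult \<alpha> \<in> borel_measurable borel"
proof -
  have m: "(\<lambda>\<xi>. LINT y|M. cos (\<xi> * y)) \<in> borel_measurable borel" if M: "finite_borel_measure M" for M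
  proof -
    interpret M: finite_measure M by (rule finite_borel_measureD(1)[OF M])
    have [measurable_cong]: "sets M = sets borel" by (rule finite_borel_measureD(2)[OF M])
    show ?thesis by (rule M.borel_measurable_lebesgue_integral) measurable
  qed
  show ?thesis unfolding kmult_def[abs_def] kint_def
    by (rule borel_measurable_diff[OF m[OF M(1)] m[OF M(2)]])
qed

text \<open>The Taylor polynomial of the cosine below degree 2k integrates to 1, because the mass is
  1 and the intermediate moments vanish. Lagrange's remainder is at most
  \<open>|\<xi> y| ^ (2 * k) / fact (2 * k)\<close>, which explains \<open>c\<close> as an absolute
  moment.\<close>

lemma kmult_Taylor:
  assumes adm: "admissible_kernel k \<alpha>" and k: "k \<ge> 1"
  defines "c \<equiv> ((LINT y|fst \<alpha>. \<bar>y\<bar> ^ (2 * k)) + (LINT y|snd \<alpha>. \<bar>y\<bar> ^ (2 * k))) / fact (2 * k)"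
  shows "\<bar>kmult \<alpha> \<xi> - 1\<bar> \<le> c * \<bar>\<xi>\<bar> ^ (2 * k)"
proof -
  have M: "finite_borel_measure (fst \<alpha>)" "finite_borel_measure (snd \<alpha>)"
    and mom: "integrable (fst \<alpha>) (\<lambda>x. \<bar>x\<bar> ^ (2 * k))" "integrable (snd \<alpha>) (\<lambda>x. \<bar>x\<bar> ^ (2 * k))"
    and m0: "kint \<alpha> (\<lambda>x. 1) = 1" and mj: "\<And>j. 1 \<le> j \<Longrightarrow> j \<le> 2 * k - 1 \<Longrightarrow> kint \<alpha> (\<lambda>x. x ^ j) = 0"
    using adm by (auto simp: admissible_kernel_def signed_borel_def kintegrable_def)
  let ?P = "\<lambda>y. \<Sum>j<2 * k. cos_coeff j * (\<xi> * y) ^ j"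
  let ?R = "\<lambda>y. cos (\<xi> * y) - ?P y"
  have Rle: "\<bar>?R y\<bar> \<le> \<bar>\<xi>\<bar> ^ (2 * k) / fact (2 * k) * \<bar>y\<bar> ^ (2 * k)" for y
  proof -
    obtain t where "cos (\<xi> * y) = ?P y + cos (t + 1 / 2 * real (2 * k) * pi) / fact (2 * k) * (\<xi> * y) ^ (2 * k)"
      using Maclaurin_cos_expansion[of "\<xi> * y" "2 * k"] by blast
    then have "\<bar>?R y\<bar> = \<bar>cos (t + 1 / 2 * real (2 * k) * pi)\<bar> * (\<bar>\<xi>\<bar> ^ (2 * k) / fact (2 * k) * \<bar>y\<bar> ^ (2 * k))"
      by (simp add: abs_mult power_abs power_mult_distrib)
    also have "\<dots> \<le> 1 * (\<bar>\<xi>\<bar> ^ (2 * k) / fact (2 * k) * \<bar>y\<bar> ^ (2 * k))"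
      by (intro mult_right_mono) auto
    finally show ?thesis by simp
  qed
  have pw: "integrable M (\<lambda>y. y ^ j)"
    if M: "finite_borel_measure M" and i: "integrable M (\<lambda>x. \<bar>x\<bar> ^ (2 * k))" and j: "j < 2 * k" for M j
  proof (rule Bochner_Integration.integrable_bound)
    show "integrable M (\<lambda>y. 1 + \<bar>y\<bar> ^ (2 * k))"
      by (intro Bochner_Integration.integrable_add i integrable_finite_borel_bounded[OF M, of _ 1]) auto
    show "(\<lambda>y. y ^ j) \<in> borel_measurable M"
      by (subst measurable_cong_sets[OF finite_borel_measureD(2)[OF M] refl]) measurable
    \<comment> \<open>Finiteness of the measure together with the moment of order 2k yields all
      lower moments.\<close>
    have "\<bar>y\<bar> ^ j \<le> 1 + \<bar>y\<bar> ^ (2 * k)" for y :: real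
    proof (cases "\<bar>y\<bar> \<le> 1")
      case True then show ?thesis using power_le_one[of "\<bar>y\<bar>" j] by (simp add: add_increasing2)
    next
      case False
      then have "\<bar>y\<bar> ^ j \<le> \<bar>y\<bar> ^ (2 * k)" using j by (intro power_increasing) auto
      then show ?thesis by simp
    qed
    then show "AE y in M. norm (y ^ j) \<le> norm (1 + \<bar>y\<bar> ^ (2 * k))" by (simp add: power_abs)
  qed
  have Pint: "integrable M ?P" if "finite_borel_measure M" "integrable M (\<lambda>x. \<bar>x\<bar> ^ (2 * k))" for M
    unfolding power_mult_distrib
    by (intro Bochner_Integration.integrable_sum integrable_mult_right pw that) auto
  have cint: "integrable M (\<lambda>y. cos (\<xi> * y))" if "finite_borel_measure M" for M
    by (rule integrable_finite_borel_bounded[OF that, of _ 1]) auto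
  have IP: "(LINT y|M. ?P y) = (\<Sum>j<2 * k. cos_coeff j * \<xi> ^ j * (LINT y|M. y ^ j))"
    if "finite_borel_measure M" "integrable M (\<lambda>x. \<bar>x\<bar> ^ (2 * k))" for M
  proof -
    have "(LINT y|M. ?P y) = (\<Sum>j<2 * k. LINT y|M. cos_coeff j * \<xi> ^ j * y ^ j)"
      unfolding power_mult_distrib mult.assoc[symmetric]
      by (rule Bochner_Integration.integral_sum) (intro integrable_mult_right pw that, simp)
    then show ?thesis by simp
  qed
  have "kint \<alpha> ?P = (\<Sum>j<2 * k. cos_coeff j * \<xi> ^ j * kint \<alpha> (\<lambda>y. y ^ j))"
    unfolding kint_def IP[OF M(1) mom(1)] IP[OF M(2) mom(2)] by (simp add: sum_subtractf right_diff_distrib)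
  also have "\<dots> = (\<Sum>j<2 * k. if j = 0 then 1 else 0)"
  proof (intro sum.cong refl)
    fix j assume "j \<in> {..<2 * k}"
    then show "cos_coeff j * \<xi> ^ j * kint \<alpha> (\<lambda>y. y ^ j) = (if j = 0 then 1 else 0)"
      using m0 mj[of j] by (cases "j = 0") auto
  qed
  also have "\<dots> = 1" using k by simp
  finally have P1: "kint \<alpha> ?P = 1" .
  have Ile: "\<bar>LINT y|M. ?R y\<bar> \<le> \<bar>\<xi>\<bar> ^ (2 * k) / fact (2 * k) * (LINT y|M. \<bar>y\<bar> ^ (2 * k))"
    if "finite_borel_measure M" "integrable M (\<lambda>x. \<bar>x\<bar> ^ (2 * k))" for M
  proof -
    have Ri: "integrable M ?R" using cint[OF that(1)] Pint[OF that] by simp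
    have "\<bar>LINT y|M. ?R y\<bar> \<le> (LINT y|M. \<bar>?R y\<bar>)"
      using integral_norm_bound[of M ?R] by simp
    also have "\<dots> \<le> (LINT y|M. \<bar>\<xi>\<bar> ^ (2 * k) / fact (2 * k) * \<bar>y\<bar> ^ (2 * k))"
      by (intro integral_mono Rle integrable_abs Ri integrable_mult_right that)
    finally show ?thesis by simp
  qed
  have "kmult \<alpha> \<xi> - 1 = (LINT y|fst \<alpha>. ?R y) - (LINT y|snd \<alpha>. ?R y)"
    unfolding P1[symmetric] kmult_def kint_def
    using cint[OF M(1)] cint[OF M(2)] Pint[OF M(1) mom(1)] Pint[OF M(2) mom(2)] by simp
  then have "\<bar>kmult \<alpha> \<xi> - 1\<bar> \<le> \<bar>LINT y|fst \<alpha>. ?R y\<bar> + \<bar>LINT y|snd \<alpha>. ?R y\<bar>" by linarith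
  also have "\<dots> \<le> \<bar>\<xi>\<bar> ^ (2 * k) / fact (2 * k) * (LINT y|fst \<alpha>. \<bar>y\<bar> ^ (2 * k)) + \<bar>\<xi>\<bar> ^ (2 * k) / fact (2 * k) * (LINT y|snd \<alpha>. \<bar>y\<bar> ^ (2 * k))"
    by (rule add_mono[OF Ile[OF M(1) mom(1)] Ile[OF M(2) mom(2)]])
  also have "\<dots> = c * \<bar>\<xi>\<bar> ^ (2 * k)" by (simp add: c_def field_simps)
  finally show ?thesis .
qed

subsection \<open>Transfer to the Sobolev spaces of real functions\<close>

lemma AE_zero_imp_zero:
  fixes g :: "real \<Rightarrow> complex"
  assumes c: "\<And>x. isCont g x" and z: "AE x in lborel. g x = 0"
  shows "g x = 0"
proof (rule ccontr)
  assume "g x \<noteq> 0"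
  have "open {y. g y \<noteq> 0}"
    by (intro open_Collect_neq continuous_at_imp_continuous_on continuous_on_const) (use c in auto)
  then obtain e where e: "e > 0" "ball x e \<subseteq> {y. g y \<noteq> 0}"
    using \<open>g x \<noteq> 0\<close> by (auto simp: open_contains_ball)
  have "AE y in lborel. y \<notin> ball x e" using z by eventually_elim (use e in auto)
  then have "ball x e \<in> null_sets lborel" by (subst AE_iff_null_sets) simp_all
  moreover have "emeasure lborel (ball x e) = ennreal (2 * e)"
    using e(1) by (simp add: ball_eq_greaterThanLessThan emeasure_lborel_Ioo)
  ultimately show False using e(1) by auto
qed

lemma AE_eq_imp_eq:
  fixes f g :: "real \<Rightarrow> complex"
  assumes "\<And>x. isCont f x" "\<And>x. isCont g x" "AE x in lborel. f x = g x"
  shows "f x = g x"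
proof -
  have "AE x in lborel. f x - g x = 0" using assms(3) by eventually_elim simp
  from AE_zero_imp_zero[OF _ this, of x] assms show ?thesis by auto
qed

lemma Sob_isCont: "Sob \<sigma> f \<Longrightarrow> isCont f x"
  using continuous_ft[OF Sob_hat(1)[of \<sigma> f]] Sob_hat(3)[of \<sigma> f] by simp

lemma in_H_iff: "in_H \<sigma> f \<longleftrightarrow> L2_fun f \<and> Hs \<sigma> (fourier f)"
proof -
  have "Hs \<sigma> (fourier f) \<longleftrightarrow> integrable lborel (\<lambda>\<xi>. (1 + \<xi>\<^sup>2) powr \<sigma> * (cmod (fourier f \<xi>))\<^sup>2)" if f: "L2_fun f"
  proof -
    have [measurable]: "fourier f \<in> borel_measurable borel" using sq_int_fourier[OF f] by auto
    have "(\<lambda>\<xi>. wtc \<sigma> \<xi> * fourier f \<xi>) \<in> borel_measurable borel" by measurable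
    then show ?thesis
      by (simp add: Hs_def sq_int_def norm_mult power_mult_distrib wt_square)
  qed
  then show ?thesis unfolding in_H_def by auto
qed

lemma H_norm_eq: "H_norm \<sigma> f = hs \<sigma> (fourier f)"
  by (simp add: H_norm_def hs_def l2_def norm_mult power_mult_distrib wt_square)

text \<open>The continuous representative of a function in $H^s$, \<open>s > 1 / 2\<close>, as a complex function.\<close>

definition cfun :: "(real \<Rightarrow> real) \<Rightarrow> real \<Rightarrow> complex" where
  "cfun f = ft (\<lambda>\<xi>. complex_of_real (1 / (2 * pi)) * fourier f \<xi>)"

lemma cfun:
  assumes f: "in_H \<sigma> f" and \<sigma>: "\<sigma> > 1 / 2"
  shows "Sob \<sigma> (cfun f)" "H_norm \<sigma> f = 2 * pi * Sob_norm \<sigma> (cfun f)"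
    "AE x in lborel. complex_of_real (f x) = cfun f x" "cnj (cfun f x) = cfun f x"
    "AE \<xi> in lborel. hat (cfun f) \<xi> = complex_of_real (1 / (2 * pi)) * fourier f \<xi>"
proof -
  have L: "L2_fun f" and H: "Hs \<sigma> (fourier f)" using f by (auto simp: in_H_iff)
  note i = Hs_integrable(1)[OF H \<sigma>]
  note S = Hs_scale[OF H, of "complex_of_real (1 / (2 * pi))"]
  note iS = Hs_integrable(1)[OF S(1) \<sigma>]
  note T = Sob_transfer[OF iS S(1), of "cfun f", unfolded cfun_def, OF refl, folded cfun_def]
  show "Sob \<sigma> (cfun f)" "AE \<xi> in lborel. hat (cfun f) \<xi> = complex_of_real (1 / (2 * pi)) * fourier f \<xi>" by (rule T)+
  show "H_norm \<sigma> f = 2 * pi * Sob_norm \<sigma> (cfun f)"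
    unfolding H_norm_eq T(2) S(2) norm_of_real by simp
  have eq: "cfun f x = ft (fourier f) x / (2 * pi)" for x unfolding cfun_def ft_scale by simp
  show AE: "AE x in lborel. complex_of_real (f x) = cfun f x"
    using fourier_inversion[OF L i] by (simp add: eq)
  have c: "isCont (cfun f) y" for y by (rule Sob_isCont[OF T(1)])
  show "cnj (cfun f x) = cfun f x"
  proof (rule AE_eq_imp_eq[OF _ c])
    show "isCont (\<lambda>x. cnj (cfun f x)) y" for y by (intro continuous_intros c)
    show "AE x in lborel. cnj (cfun f x) = cfun f x"
      using AE by eventually_elim (metis complex_cnj_complex_of_real)
  qed
qed

lemma in_H_lin:
  assumes f: "in_H \<sigma> f" and g: "in_H \<sigma> g" and \<sigma>: "\<sigma> > 1 / 2"
  shows "in_H \<sigma> (\<lambda>x. a * f x + b * g x)"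
    "cfun (\<lambda>x. a * f x + b * g x) x = complex_of_real a * cfun f x + complex_of_real b * cfun g x"
proof -
  let ?h = "\<lambda>x. a * f x + b * g x"
  have Lf: "L2_fun f" "Hs \<sigma> (fourier f)" and Lg: "L2_fun g" "Hs \<sigma> (fourier g)" using f g by (auto simp: in_H_iff)
  have Lh: "L2_fun ?h" by (rule is_fourier_lin(1)[OF Lf(1) Lg(1) is_fourier_exists[OF Lf(1)] is_fourier_exists[OF Lg(1)]])
  note AE = fourier_lin[OF Lf(1) Lg(1), of a b]
  have m: "fourier ?h \<in> borel_measurable borel" using sq_int_fourier[OF Lh] by auto
  note Sf = Hs_scale(1)[OF Lf(2), of "complex_of_real a"] and Sg = Hs_scale(1)[OF Lg(2), of "complex_of_real b"]
  show "in_H \<sigma> ?h"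
    unfolding in_H_iff using Lh Hs_cong_AE(1)[OF Hs_add(1)[OF Sf Sg] m AE] by simp
  have "ft (fourier ?h) x = ft (\<lambda>\<xi>. complex_of_real a * fourier f \<xi> + complex_of_real b * fourier g \<xi>) x"
    by (rule ft_cong_AE[OF m _ AE]) (rule Hs_measurable[OF Hs_add(1)[OF Sf Sg]])
  also have "\<dots> = complex_of_real a * ft (fourier f) x + complex_of_real b * ft (fourier g) x"
    using ft_add[OF Hs_integrable(1)[OF Sf \<sigma>] Hs_integrable(1)[OF Sg \<sigma>]] by (simp add: ft_scale)
  finally show "cfun ?h x = complex_of_real a * cfun f x + complex_of_real b * cfun g x"
    unfolding cfun_def ft_scale by (simp add: add_divide_distrib)
qed

lemma in_H_diff:
  assumes f: "in_H \<sigma> f" and g: "in_H \<sigma> g" and \<sigma>: "\<sigma> > 1 / 2"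
  shows "in_H \<sigma> (\<lambda>x. f x - g x)" "H_norm \<sigma> (\<lambda>x. f x - g x) = 2 * pi * Sob_norm \<sigma> (\<lambda>x. cfun f x - cfun g x)"
proof -
  note L = in_H_lin[OF f g \<sigma>, of 1 "-1"]
  show H: "in_H \<sigma> (\<lambda>x. f x - g x)" using L(1) by simp
  have "cfun (\<lambda>x. f x - g x) = (\<lambda>x. cfun f x - cfun g x)" using L(2) by (intro ext) simp
  then show "H_norm \<sigma> (\<lambda>x. f x - g x) = 2 * pi * Sob_norm \<sigma> (\<lambda>x. cfun f x - cfun g x)"
    using cfun(2)[OF H \<sigma>] by simp
qed

lemma in_H_quotient:
  assumes f: "in_H \<sigma> f" and g: "in_H \<sigma> g" and h: "in_H \<sigma> h" and \<sigma>: "\<sigma> > 1 / 2"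
  shows "H_norm \<sigma> (\<lambda>x. (f x - g x) / c - h x)
    = 2 * pi * Sob_norm \<sigma> (\<lambda>x. (cfun f x - cfun g x) / complex_of_real c - cfun h x)"
proof -
  note L = in_H_lin[OF f g \<sigma>, of "1 / c" "- 1 / c"]
  note M = in_H_lin[OF L(1) h \<sigma>, of 1 "-1"]
  have eq: "(\<lambda>x. 1 * (1 / c * f x + - 1 / c * g x) + - 1 * h x) = (\<lambda>x. (f x - g x) / c - h x)"
    by (rule ext) (simp add: diff_divide_distrib)
  have H: "in_H \<sigma> (\<lambda>x. (f x - g x) / c - h x)" using M(1) unfolding eq .
  have "cfun (\<lambda>x. (f x - g x) / c - h x) = (\<lambda>x. (cfun f x - cfun g x) / complex_of_real c - cfun h x)"
    using M(2) unfolding eq L(2) by (intro ext) (simp add: diff_divide_distrib)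
  then show ?thesis using cfun(2)[OF H \<sigma>] by simp
qed

lemma cfun_cong_AE:
  assumes "in_H \<sigma> f" "in_H \<sigma> g" "AE x in lborel. f x = g x"
  shows "cfun f = cfun g" "H_norm \<tau> f = H_norm \<tau> g"
proof -
  have "fourier f = fourier g"
    by (rule fourier_cong_AE) (use assms in \<open>auto simp: in_H_iff L2_fun_sq_int\<close>)
  then show "cfun f = cfun g" "H_norm \<tau> f = H_norm \<tau> g" by (simp_all add: cfun_def H_norm_def)
qed

text \<open>The comparison is made for the flux rather than for \<open>f\<close>: the hypothesis
  makes \<open>f + f ^ (p + 1)\<close> continuous, from which continuity of \<open>f\<close> itself
  does not follow directly. Two continuous functions that agree almost everywhere agree, and so do
  their derivatives.\<close>

lemma dx_flux_cfun:
  assumes f: "in_H (\<sigma> + 1) f" and \<sigma>: "\<sigma> > 1 / 2"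
    and D: "\<And>x. ((\<lambda>y. f y + f y ^ (p + 1)) has_real_derivative g x) (at x)"
  shows "dx (flux p (cfun f)) x = complex_of_real (g x)"
proof -
  have \<sigma>1: "\<sigma> + 1 > 1 / 2" using \<sigma> by simp
  note F = cfun[OF f \<sigma>1]
  note fX = Sob_flux(1)[OF F(1) \<sigma>1, of p]
  let ?h = "\<lambda>y. complex_of_real (f y + f y ^ (p + 1))"
  have Dv: "(?h has_vector_derivative complex_of_real (g x)) (at x)" for x
    using D[of x] by (intro has_vector_derivative_of_real) (simp add: has_real_derivative_iff_has_vector_derivative)
  have "flux p (cfun f) y = ?h y" for y
  proof (rule AE_eq_imp_eq[OF Sob_isCont[OF fX]])
    show "isCont ?h x" for x using has_vector_derivative_continuous[OF Dv[of x]] .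
    show "AE x in lborel. flux p (cfun f) x = ?h x"
      using F(3) by eventually_elim (simp add: flux_def)
  qed
  then have "flux p (cfun f) = ?h" by auto
  then have "dx (flux p (cfun f)) = (\<lambda>x. complex_of_real (g x))"
    using dx_eqI[OF fX \<sigma>] Dv by simp
  then show ?thesis by simp
qed

text \<open>Both sides of the equation have continuous representatives, so the identity holds at
  every point and can be read on the Fourier side. The two limits descend from order r to order s,
  where the energy lives.\<close>

lemma wave_solutionI:
  assumes s: "s > 1 / 2" and r: "s \<le> r" and sc: "solution_class T r v v'"
    and mm: "m \<in> borel_measurable borel" and mA: "\<And>\<xi>. \<bar>m \<xi>\<bar> \<le> A"
    and eq: "\<And>t. t \<in> {0..T} \<Longrightarrow> AE x in lborel. complex_of_real (v' t x) = - fmult m (dx (flux p (cfun (v t)))) x"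
  shows "wave_solution m p s T (\<lambda>t. cfun (v t)) (\<lambda>t. cfun (v' t))"
  unfolding wave_solution_def
proof (intro ballI conjI allI)
  fix t assume t: "t \<in> {0..T}"
  have r2: "r > 1 / 2" "r + 1 > 1 / 2" using s r by auto
  have vr1: "in_H (r + 1) (v t)" if "t \<in> {0..T}" for t using sc that by (auto simp: solution_class_def C0_H_def)
  have vr: "in_H r (v t)" if "t \<in> {0..T}" for t using sc that by (auto simp: solution_class_def C0_H_def)
  have v'r: "in_H r (v' t)" using sc t by (auto simp: solution_class_def C0_H_def)
  note V = cfun[OF vr1[OF t] r2(2)] and V' = cfun[OF v'r r2(1)]
  show "Sob (s + 1) (cfun (v t))" using Sob_mono(1)[OF V(1)] r by simp
  show Sob': "Sob s (cfun (v' t))" by (rule Sob_mono(1)[OF V'(1) r])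
  show "cnj (cfun (v t) x) = cfun (v t) x" for x by (rule V(4))
  have fX: "Sob r (dx (flux p (cfun (v t))))" by (rule Sob_dx(1)[OF Sob_flux(1)[OF V(1) r2(2)] r2(1)])
  note M = Sob_fmult[OF fX mm mA]
  note M' = Sob_scale[OF M(1), of "-1"]
  have "cfun (v' t) x = -1 * fmult m (dx (flux p (cfun (v t)))) x" for x
  proof (rule AE_eq_imp_eq[OF Sob_isCont[OF V'(1)] Sob_isCont[OF M'(1)]])
    show "AE x in lborel. cfun (v' t) x = -1 * fmult m (dx (flux p (cfun (v t)))) x"
      using V'(3) eq[OF t] by eventually_elim simp
  qed
  then have V'eq: "cfun (v' t) = (\<lambda>x. -1 * fmult m (dx (flux p (cfun (v t)))) x)" by auto
  show "AE \<xi> in lborel. hat (cfun (v' t)) \<xi> = - (m \<xi> * hat (dx (flux p (cfun (v t)))) \<xi>)"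
    unfolding V'eq using M'(3) M(3) by eventually_elim simp
  have ev: "eventually (\<lambda>\<tau>. \<tau> \<in> {0..T}) (at t within {0..T})" by (auto simp: eventually_at_filter)
  have "((\<lambda>\<tau>. H_norm r (\<lambda>x. v \<tau> x - v t x) / (2 * pi)) \<longlongrightarrow> 0 / (2 * pi)) (at t within {0..T})"
    by (intro tendsto_divide tendsto_const) (use sc t in \<open>auto simp: solution_class_def C0_H_def\<close>)
  then have 1: "((\<lambda>\<tau>. H_norm r (\<lambda>x. v \<tau> x - v t x) / (2 * pi)) \<longlongrightarrow> 0) (at t within {0..T})" by simp
  show "((\<lambda>\<tau>. Sob_norm s (\<lambda>x. cfun (v \<tau>) x - cfun (v t) x)) \<longlongrightarrow> 0) (at t within {0..T})"
  proof (rule tendsto_sandwich[OF _ _ tendsto_const 1])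
    show "\<forall>\<^sub>F \<tau> in at t within {0..T}. Sob_norm s (\<lambda>x. cfun (v \<tau>) x - cfun (v t) x) \<le> H_norm r (\<lambda>x. v \<tau> x - v t x) / (2 * pi)"
      using ev
    proof eventually_elim
      case (elim \<tau>)
      have "Sob r (\<lambda>x. cfun (v \<tau>) x - cfun (v t) x)"
        by (rule Sob_diff(1)[OF cfun(1)[OF vr[OF elim] r2(1)] cfun(1)[OF vr[OF t] r2(1)]])
      from Sob_mono(2)[OF this r] show ?case using in_H_diff(2)[OF vr[OF elim] vr[OF t] r2(1)] by simp
    qed
  qed simp
  have "((\<lambda>\<tau>. H_norm r (\<lambda>x. (v \<tau> x - v t x) / (\<tau> - t) - v' t x) / (2 * pi)) \<longlongrightarrow> 0 / (2 * pi)) (at t within {0..T})"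
    by (intro tendsto_divide tendsto_const) (use sc t in \<open>auto simp: solution_class_def has_time_derivative_H_def\<close>)
  then have 2: "((\<lambda>\<tau>. H_norm r (\<lambda>x. (v \<tau> x - v t x) / (\<tau> - t) - v' t x) / (2 * pi)) \<longlongrightarrow> 0) (at t within {0..T})" by simp
  show "((\<lambda>\<tau>. Sob_norm s (\<lambda>x. (cfun (v \<tau>) x - cfun (v t) x) / complex_of_real (\<tau> - t) - cfun (v' t) x)) \<longlongrightarrow> 0) (at t within {0..T})"
  proof (rule tendsto_sandwich[OF _ _ tendsto_const 2])
    show "\<forall>\<^sub>F \<tau> in at t within {0..T}. Sob_norm s (\<lambda>x. (cfun (v \<tau>) x - cfun (v t) x) / complex_of_real (\<tau> - t) - cfun (v' t) x)
        \<le> H_norm r (\<lambda>x. (v \<tau> x - v t x) / (\<tau> - t) - v' t x) / (2 * pi)"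
      using ev
    proof eventually_elim
      case (elim \<tau>)
      have "Sob r (\<lambda>x. (cfun (v \<tau>) x - cfun (v t) x) / complex_of_real (\<tau> - t) - cfun (v' t) x)"
        by (rule Sob_quotient(1)[OF cfun(1)[OF vr[OF elim] r2(1)] cfun(1)[OF vr[OF t] r2(1)] V'(1)])
      from Sob_mono(2)[OF this r] show ?case
        using in_H_quotient[OF vr[OF elim] vr[OF t] v'r r2(1), of "\<tau> - t"] by simp
    qed
  qed simp
qed

text \<open>A continuous norm on a compact time interval attains its maximum; this supplies the
  high-order bound \<open>N\<close> on the reference solution in
  \<open>uniform_error\<close>.\<close>

lemma C0_H_bounded:
  assumes c: "C0_H T \<sigma> u" and \<sigma>: "\<sigma> > 1 / 2" and T: "0 \<le> T"
  shows "\<exists>N. \<forall>t\<in>{0..T}. Sob \<sigma> (cfun (u t)) \<and> Sob_norm \<sigma> (cfun (u t)) \<le> N"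
proof -
  have H: "in_H \<sigma> (u t)" if "t \<in> {0..T}" for t using c that by (auto simp: C0_H_def)
  have XX: "Sob \<sigma> (cfun (u t))" if "t \<in> {0..T}" for t by (rule cfun(1)[OF H[OF that] \<sigma>])
  have "continuous_on {0..T} (\<lambda>t. Sob_norm \<sigma> (cfun (u t)))"
    unfolding continuous_on_def
  proof
    fix t assume t: "t \<in> {0..T}"
    have "((\<lambda>\<tau>. H_norm \<sigma> (\<lambda>x. u \<tau> x - u t x) / (2 * pi)) \<longlongrightarrow> 0 / (2 * pi)) (at t within {0..T})"
      by (intro tendsto_divide tendsto_const) (use c t in \<open>auto simp: C0_H_def\<close>)
    then have lim: "((\<lambda>\<tau>. H_norm \<sigma> (\<lambda>x. u \<tau> x - u t x) / (2 * pi)) \<longlongrightarrow> 0) (at t within {0..T})" by simp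
    show "((\<lambda>t. Sob_norm \<sigma> (cfun (u t))) \<longlongrightarrow> Sob_norm \<sigma> (cfun (u t))) (at t within {0..T})"
    proof (rule LIM_zero_cancel, rule tendsto_rabs_zero_cancel, rule tendsto_sandwich[OF _ _ tendsto_const lim])
      have "\<bar>Sob_norm \<sigma> (cfun (u \<tau>)) - Sob_norm \<sigma> (cfun (u t))\<bar> \<le> H_norm \<sigma> (\<lambda>x. u \<tau> x - u t x) / (2 * pi)" if \<tau>: "\<tau> \<in> {0..T}" for \<tau>
        using Sob_norm_triangle[OF XX[OF \<tau>] XX[OF t]] Sob_norm_triangle[OF XX[OF t] XX[OF \<tau>]] Sob_norm_minus_commute[OF XX[OF t] XX[OF \<tau>]]
          in_H_diff(2)[OF H[OF \<tau>] H[OF t] \<sigma>] by simp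
      then show "\<forall>\<^sub>F \<tau> in at t within {0..T}. \<bar>Sob_norm \<sigma> (cfun (u \<tau>)) - Sob_norm \<sigma> (cfun (u t))\<bar> \<le> H_norm \<sigma> (\<lambda>x. u \<tau> x - u t x) / (2 * pi)"
        by (simp add: eventually_at_filter)
    qed simp
  qed
  moreover have "{0..T} \<noteq> {}" using T by simp
  ultimately obtain tm where "\<And>t. t \<in> {0..T} \<Longrightarrow> Sob_norm \<sigma> (cfun (u t)) \<le> Sob_norm \<sigma> (cfun (u tm))"
    using continuous_attains_sup[OF compact_Icc] by blast
  then show ?thesis using XX by blast
qed

lemma fmult_one: "Sob \<sigma> f \<Longrightarrow> fmult (\<lambda>_. 1) f = f"
  by (simp add: fmult_def Sob_hat(3))

lemma local_wave_solution:
  assumes s: "s > 1 / 2" and r: "s \<le> r" and sol: "local_solution p r T u0 u"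
  shows "\<exists>u'. wave_solution (\<lambda>_. 1) p s T (\<lambda>t. cfun (u t)) (\<lambda>t. cfun (u' t)) \<and> C0_H T (r + 1) u"
proof -
  from sol obtain ut where sc: "solution_class T r u ut"
    and eq: "\<And>t. t \<in> {0..T} \<Longrightarrow> \<exists>ux fx. (\<forall>x. (u t has_real_derivative ux x) (at x)) \<and>
           (\<forall>x. ((\<lambda>y. u t y ^ (p + 1)) has_real_derivative fx x) (at x)) \<and> (AE x in lborel. ut t x + ux x + fx x = 0)"
    unfolding local_solution_def by blast
  have r2: "r > 1 / 2" "r + 1 > 1 / 2" using s r by auto
  have "wave_solution (\<lambda>_. 1) p s T (\<lambda>t. cfun (u t)) (\<lambda>t. cfun (ut t))"
  proof (rule wave_solutionI[OF s r sc])
    fix t assume t: "t \<in> {0..T}"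
    obtain ux fx where D: "\<And>x. (u t has_real_derivative ux x) (at x)"
        "\<And>x. ((\<lambda>y. u t y ^ (p + 1)) has_real_derivative fx x) (at x)"
      and z: "AE x in lborel. ut t x + ux x + fx x = 0" using eq[OF t] by blast
    have H: "in_H (r + 1) (u t)" using sc t by (auto simp: solution_class_def C0_H_def)
    have d: "dx (flux p (cfun (u t))) x = complex_of_real (ux x + fx x)" for x
      by (rule dx_flux_cfun[OF H r2(1)]) (rule DERIV_add[OF D])
    have "Sob r (dx (flux p (cfun (u t))))"
      by (rule Sob_dx(1)[OF Sob_flux(1)[OF cfun(1)[OF H r2(2)] r2(2)] r2(1)])
    then have f: "fmult (\<lambda>_. 1) (dx (flux p (cfun (u t)))) = dx (flux p (cfun (u t)))" by (rule fmult_one)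
    show "AE x in lborel. complex_of_real (ut t x) = - fmult (\<lambda>_. 1) (dx (flux p (cfun (u t)))) x"
      using z
    proof eventually_elim
      case (elim x)
      then have "ut t x = - (ux x + fx x)" by linarith
      then show ?case unfolding f d by simp
    qed
  qed (simp_all, rule order_refl)
  then show ?thesis using sc by (auto simp: solution_class_def)
qed

lemma nonlocal_wave_solution:
  assumes s: "s > 1 / 2" and r: "s \<le> r" and sol: "nonlocal_solution \<kappa> p r T u0 v"
    and M: "finite_borel_measure (fst \<kappa>)" "finite_borel_measure (snd \<kappa>)"
    and odd: "\<And>\<xi>. kint \<kappa> (\<lambda>y. sin (\<xi> * y)) = 0"
  shows "\<exists>v'. wave_solution (kmult \<kappa>) p s T (\<lambda>t. cfun (v t)) (\<lambda>t. cfun (v' t)) \<and> C0_H T (r + 1) v"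
proof -
  from sol obtain vt where sc: "solution_class T r v vt"
    and eq: "\<And>t. t \<in> {0..T} \<Longrightarrow> \<exists>g. (\<forall>x. ((\<lambda>y. v t y + v t y ^ (p + 1)) has_real_derivative g x) (at x)) \<and>
           (AE x in lborel. vt t x + kconv \<kappa> g x = 0)"
    unfolding nonlocal_solution_def by blast
  have r2: "r > 1 / 2" "r + 1 > 1 / 2" using s r by auto
  have "wave_solution (kmult \<kappa>) p s T (\<lambda>t. cfun (v t)) (\<lambda>t. cfun (vt t))"
  proof (rule wave_solutionI[OF s r sc kmult_measurable[OF M] kmult_bound[OF M]])
    fix t assume t: "t \<in> {0..T}"
    obtain g where D: "\<And>x. ((\<lambda>y. v t y + v t y ^ (p + 1)) has_real_derivative g x) (at x)"
      and z: "AE x in lborel. vt t x + kconv \<kappa> g x = 0" using eq[OF t] by blast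
    have H: "in_H (r + 1) (v t)" using sc t by (auto simp: solution_class_def C0_H_def)
    have d: "dx (flux p (cfun (v t))) x = complex_of_real (g x)" for x
      by (rule dx_flux_cfun[OF H r2(1) D])
    have Xd: "Sob r (dx (flux p (cfun (v t))))"
      by (rule Sob_dx(1)[OF Sob_flux(1)[OF cfun(1)[OF H r2(2)] r2(2)] r2(1)])
    show "AE x in lborel. complex_of_real (vt t x) = - fmult (kmult \<kappa>) (dx (flux p (cfun (v t)))) x"
      using z
    proof eventually_elim
      case (elim x)
      then have "vt t x = - kconv \<kappa> g x" by linarith
      then show ?case using kconv_eq_fmult[OF M odd Xd d, of x] by simp
    qed
  qed
  then show ?thesis using sc by (auto simp: solution_class_def)
qed

text \<open>The kernel enters \<open>uniform_error\<close> only through its total variation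
  \<open>A\<close> and through \<open>d = c * \<delta> ^ (2 * k)\<close>. Dilation leaves the former
  unchanged and produces the power of \<delta> in the latter.\<close>

theorem theorem4p1:
  fixes p k :: nat and s :: real and \<alpha> :: kernel
  assumes p: "p \<ge> 1" and k: "k \<ge> 1" and s: "s > 3 / 2"
    and kernel: "admissible_kernel k \<alpha>"
  shows "\<exists>\<epsilon>>0. \<forall>u0 :: real \<Rightarrow> real.
    in_H (s + 2 * real k + 1) u0 \<and> H_norm (s + 2 * real k + 1) u0 < \<epsilon> \<longrightarrow>
    (\<forall>T0>0. \<forall>(v :: real \<Rightarrow> real \<Rightarrow> real \<Rightarrow> real) (u :: real \<Rightarrow> real \<Rightarrow> real).
       (\<forall>\<delta>>0. nonlocal_solution (kscale \<delta> \<alpha>) p (s + 2 * real k) T0 u0 (v \<delta>)) \<and>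
       local_solution p (s + 2 * real k) T0 u0 u \<longrightarrow>
       (\<exists>C>0. \<exists>T>0. T \<le> T0 \<and>
          (\<forall>\<delta>>0. \<forall>t\<in>{0..T}.
             in_H s (\<lambda>x. v \<delta> t x - u t x) \<and>
             H_norm s (\<lambda>x. v \<delta> t x - u t x) \<le> C * \<delta> ^ (2 * k) * t)))"
proof -
  let ?r = "s + 2 * real k"
  have M: "finite_borel_measure (fst \<alpha>)" "finite_borel_measure (snd \<alpha>)"
    using kernel by (auto simp: admissible_kernel_def signed_borel_def)
  define A where "A = measure (fst \<alpha>) UNIV + measure (snd \<alpha>) UNIV"
  have A: "0 \<le> A" by (simp add: A_def)
  define c where "c = ((LINT y|fst \<alpha>. \<bar>y\<bar> ^ (2 * k)) + (LINT y|snd \<alpha>. \<bar>y\<bar> ^ (2 * k))) / fact (2 * k)"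
  have c: "0 \<le> c" by (simp add: c_def)
  have s1: "s > 1 / 2" and sr: "s \<le> ?r" and r1: "?r + 1 > 1 / 2" and sr1: "s \<le> ?r + 1" using s by auto
  obtain \<epsilon> where \<epsilon>: "\<epsilon> > 0" and main: "\<forall>T0 N u u'. T0 > 0 \<longrightarrow> wave_solution (\<lambda>_. 1) p s T0 u u' \<longrightarrow>
    (\<forall>t\<in>{0..T0}. Sob (?r + 1) (u t) \<and> Sob_norm (?r + 1) (u t) \<le> N) \<longrightarrow> Sob_norm s (u 0) < \<epsilon> \<longrightarrow>
    (\<exists>C>0. \<exists>T>0. T \<le> T0 \<and> error_estimate p k s A T0 u C T)"
    using uniform_error[OF s p A, of k] by (elim exE conjE)
  show ?thesis
  \<comment> \<open>The factor 2\<pi> converts \<open>Sob_norm\<close>, which is based on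
    \<open>hat\<close>, into \<open>H_norm\<close>, which is based on
    \<open>fourier\<close>.\<close>
  proof (rule exI[of _ "2 * pi * \<epsilon>"], intro conjI allI impI)
    show "0 < 2 * pi * \<epsilon>" using \<epsilon> by simp
    fix u0 T0 v u
    assume u0: "in_H (?r + 1) u0 \<and> H_norm (?r + 1) u0 < 2 * pi * \<epsilon>" and T0: "0 < T0"
      and sol: "(\<forall>\<delta>>0. nonlocal_solution (kscale \<delta> \<alpha>) p ?r T0 u0 (v \<delta>)) \<and> local_solution p ?r T0 u0 u"
    obtain u' where uw: "wave_solution (\<lambda>_. 1) p s T0 (\<lambda>t. cfun (u t)) (\<lambda>t. cfun (u' t))" and uC: "C0_H T0 (?r + 1) u"
      using local_wave_solution[OF s1 sr] sol by blast
    obtain N where N: "\<forall>t\<in>{0..T0}. Sob (?r + 1) (cfun (u t)) \<and> Sob_norm (?r + 1) (cfun (u t)) \<le> N"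
      using C0_H_bounded[OF uC r1] T0 by auto
    have z: "0 \<in> {0..T0}" using T0 by simp
    have uH: "in_H (?r + 1) (u t)" if "t \<in> {0..T0}" for t using uC that by (auto simp: C0_H_def)
    have "AE x in lborel. u 0 x = u0 x" using sol by (auto simp: local_solution_def)
    note init = cfun_cong_AE[OF uH[OF z] conjunct1[OF u0] this]
    have "Sob_norm s (cfun (u 0)) \<le> Sob_norm (?r + 1) (cfun u0)"
      unfolding init(1) by (rule Sob_mono(2)[OF cfun(1)[OF conjunct1[OF u0] r1] sr1])
    also have "\<dots> < \<epsilon>" using u0 cfun(2)[OF conjunct1[OF u0] r1] by simp
    finally have small: "Sob_norm s (cfun (u 0)) < \<epsilon>" .
    from main[rule_format, OF T0 uw N[rule_format] small] obtain C T where CT: "C > 0" "T > 0" "T \<le> T0"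
      and est: "error_estimate p k s A T0 (\<lambda>t. cfun (u t)) C T"
      by blast
    show "\<exists>C>0. \<exists>T>0. T \<le> T0 \<and> (\<forall>\<delta>>0. \<forall>t\<in>{0..T}. in_H s (\<lambda>x. v \<delta> t x - u t x) \<and>
             H_norm s (\<lambda>x. v \<delta> t x - u t x) \<le> C * \<delta> ^ (2 * k) * t)"
    proof (rule exI[of _ "2 * pi * (C * c) + 1"], intro conjI)
      show "0 < 2 * pi * (C * c) + 1" using CT c by (simp add: add_nonneg_pos)
      show "\<exists>T>0. T \<le> T0 \<and> (\<forall>\<delta>>0. \<forall>t\<in>{0..T}. in_H s (\<lambda>x. v \<delta> t x - u t x) \<and>
             H_norm s (\<lambda>x. v \<delta> t x - u t x) \<le> (2 * pi * (C * c) + 1) * \<delta> ^ (2 * k) * t)"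
      proof (rule exI[of _ T], intro conjI CT(2,3) allI impI ballI)
        fix \<delta> t :: real assume \<delta>: "0 < \<delta>" and t: "t \<in> {0..T}"
        let ?\<kappa> = "kscale \<delta> \<alpha>"
        note S = kscale_props[OF M, where \<delta> = \<delta>]
        have odd: "kint ?\<kappa> (\<lambda>y. sin (\<xi> * y)) = 0" for \<xi>
        proof -
          have "kint ?\<kappa> (\<lambda>y. sin (\<xi> * y)) = kint \<alpha> (\<lambda>y. sin ((\<xi> * \<delta>) * y))"
            by (subst S(3)) (simp_all add: mult.assoc)
          then show ?thesis
            using kint_sin_even[of \<alpha> "\<xi> * \<delta>"] kernel by (simp add: admissible_kernel_def)
        qed
        \<comment> \<open>Dilating the kernel by \<delta> dilates the frequency of its symbol, so
          the sup bound is inherited and the Taylor bound gains the factor \<delta>^(2k).\<close>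
        have km: "kmult ?\<kappa> \<xi> = kmult \<alpha> (\<xi> * \<delta>)" for \<xi>
          unfolding kmult_def by (subst S(3)) (simp_all add: mult.assoc)
        have nl: "nonlocal_solution ?\<kappa> p ?r T0 u0 (v \<delta>)" using sol \<delta> by blast
        obtain v' where vw: "wave_solution (kmult ?\<kappa>) p s T0 (\<lambda>t. cfun (v \<delta> t)) (\<lambda>t. cfun (v' t))"
          and vC: "C0_H T0 (?r + 1) (v \<delta>)"
          using nonlocal_wave_solution[OF s1 sr nl S(1,2) odd] by blast
        have vH: "in_H (?r + 1) (v \<delta> t)" if "t \<in> {0..T0}" for t using vC that by (auto simp: C0_H_def)
        have "AE x in lborel. v \<delta> 0 x = u0 x" using nl by (auto simp: nonlocal_solution_def)
        from cfun_cong_AE(1)[OF vH[OF z] conjunct1[OF u0] this] have v0: "cfun (v \<delta> 0) = cfun (u 0)"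
          using init(1) by simp
        have kA: "\<forall>\<xi>. \<bar>kmult ?\<kappa> \<xi>\<bar> \<le> A" unfolding km A_def using kmult_bound[OF M] by blast
        have kd: "\<forall>\<xi>. \<bar>kmult ?\<kappa> \<xi> - 1\<bar> \<le> (c * \<delta> ^ (2 * k)) * \<bar>\<xi>\<bar> ^ (2 * k)"
        proof
          fix \<xi>
          show "\<bar>kmult ?\<kappa> \<xi> - 1\<bar> \<le> (c * \<delta> ^ (2 * k)) * \<bar>\<xi>\<bar> ^ (2 * k)"
            using kmult_Taylor[OF kernel k, of "\<xi> * \<delta>"] \<delta>
            unfolding km c_def by (simp add: abs_mult power_mult_distrib mult_ac)
        qed
        have d0: "0 \<le> c * \<delta> ^ (2 * k)" using c \<delta> by simp
        have tT: "t \<in> {0..T0}" using t CT by auto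
        have sH: "in_H s (v \<delta> t)" "in_H s (u t)"
          using vH[OF tT] uH[OF tT] Hs_mono(1)[OF _ sr1] by (auto simp: in_H_iff)
        note D = in_H_diff[OF sH s1]
        show "in_H s (\<lambda>x. v \<delta> t x - u t x)" by (rule D(1))
        have "Sob_norm s (\<lambda>x. cfun (v \<delta> t) x - cfun (u t) x) \<le> C * (c * \<delta> ^ (2 * k)) * t"
          using est[rule_format, OF kmult_measurable[OF S(1,2)] kA[rule_format] kd[rule_format] d0 vw v0 t] .
        then have "H_norm s (\<lambda>x. v \<delta> t x - u t x) \<le> 2 * pi * (C * (c * \<delta> ^ (2 * k)) * t)"
          unfolding D(2) by (intro mult_left_mono) auto
        also have "\<dots> = (2 * pi * (C * c)) * (\<delta> ^ (2 * k) * t)" by (simp only: mult_ac)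
        also have "\<dots> \<le> (2 * pi * (C * c) + 1) * (\<delta> ^ (2 * k) * t)"
          using \<delta> t by (intro mult_right_mono) auto
        finally show "H_norm s (\<lambda>x. v \<delta> t x - u t x) \<le> (2 * pi * (C * c) + 1) * \<delta> ^ (2 * k) * t"
          by (simp only: mult.assoc)
      qed
    qed
  qed
qed

end
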